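(* Let $r:=q^3$, $K:=\mathbb{F}_r$ and $\zeta:=\zeta_r$, where $q$ is a prime power and $\zeta_r$ is a generator of the multiplicative group $\mathbb{F}_r^*$. Let $V:=K^2$ and $G:=V{:}(\mathrm{GL}_2(q)\circ K^* )$. Let $x:=(1,\zeta)\in V$. Then $(V,\mathcal{L})$ is a $G$-affine proper partial linear space for which $0$ and $x$ are collinear if and only if $\mathcal{L}=L^G$ and one of the following holds. (i) $L=\{\lambda x : \lambda\in F\}$, where $F$ is a subfield of $K$ and $|F|>2$. (ii) $L=\{x\,\mathrm{diag}(\lambda,\lambda^\tau)^g: \lambda\in F\}$, where $F$ is a subfield of $\mathbb{F}_q$, $\tau$ is a non-trivial element of $\mathrm{Aut}(F)$, and $g\in\mathrm{GL}_2(q)$. (iii) $L=\{x[\varphi_\lambda]_\mathcal{B}^g : \lambda\in F\}$, where $F$ is a field with $[F: F\cap \mathbb{F}_q]=2$, the map $\varphi_\lambda\in \mathrm{End}_{F\cap \mathbb{F}_q}(F)$ is defined by $v\mapsto \lambda v$ for all $v\in F$, the set $\mathcal{B}$ is an $(F\cap \mathbb{F}_q)$-basis of $F$, and $g\in \mathrm{GL}_2(q)$.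
   Context: A partial linear space is a pair $(\mathcal{P},\mathcal{L})$ with $\mathcal{P}$ a non-empty finite set of points and $\mathcal{L}$ a collection of subsets (lines) such that any two distinct points lie on at most one line and every line has at least two points. It is a linear space if any two distinct points lie on exactly one line, a graph if every line has exactly two points, and proper if it is neither. $\mathrm{Aut}$ denotes the group of point permutations preserving the line set. $(V,\mathcal{L})$ is $G$-affine if its point set is $V$ and $G\leq\mathrm{Aut}(V,\mathcal{L})$, where $G$ is an affine permutation group on $V$ (it contains all translations). $\mathrm{GL}_2(q)\circ K^*$ is the subgroup of $\mathrm{GL}_2(K)$ generated by $\mathrm{GL}_2(q)$ (matrices over $\mathbb{F}_q$) and the scalars $K^*$; it acts on row vectors of $K^2$ by right multiplication. $G$ is the group generated by translations and this linear group, and $L^G=\{L^g:g\in G\}$. For a $2\times2$ matrix $A$, $A^g=g^{-1}Ag$. For a field extension $F/E$ of degree $2$, an $E$-basis $\mathcal{B}=\{b_1,b_2\}$ of $F$ and $\varphi\in\mathrm{End}_E(F)$, $[\varphi]_{\mathcal{B}}$ is the $2\times2$ matrix over $E$ with $(\lambda_1,\lambda_2)[\varphi]_{\mathcal{B}}=(\mu_1,\mu_2)$ iff $(\lambda_1b_1+\lambda_2b_2)\varphi=\mu_1b_1+\mu_2b_2$. In (iii), the field $F$ is finite and the intersection $F\cap\mathbb{F}_q$ is taken in a common algebraic closure. *)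

theory Defs
  imports
    "HOL-Analysis.Finite_Cartesian_Product"
    "HOL-Analysis.Cartesian_Space"
    "HOL-Algebra.Bij"
    "HOL-Algebra.QuotRing"
    "HOL-Algebra.Generated_Groups"
    "HOL-Algebra.Embedded_Algebras"
    "HOL-Algebra.Algebraic_Closure_Type"
    "HOL-Number_Theory.Prime_Powers"
begin

section \<open>Partial linear spaces\<close>

definition partial_linear_space :: "'p set \<Rightarrow> 'p set set \<Rightarrow> bool" where
  "partial_linear_space P \<L> \<longleftrightarrow>
     finite P \<and> P \<noteq> {} \<and> \<L> \<subseteq> Pow P \<and>
     (\<forall>a\<in>P. \<forall>b\<in>P. a \<noteq> b \<longrightarrow>
        (\<forall>l\<in>\<L>. \<forall>m\<in>\<L>. a \<in> l \<and> b \<in> l \<and> a \<in> m \<and> b \<in> m \<longrightarrow> l = m)) \<and>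
     (\<forall>l\<in>\<L>. 2 \<le> card l)"

definition linear_space :: "'p set \<Rightarrow> 'p set set \<Rightarrow> bool" where
  "linear_space P \<L> \<longleftrightarrow>
     partial_linear_space P \<L> \<and>
     (\<forall>a\<in>P. \<forall>b\<in>P. a \<noteq> b \<longrightarrow> (\<exists>!l. l \<in> \<L> \<and> a \<in> l \<and> b \<in> l))"

definition pls_graph :: "'p set \<Rightarrow> 'p set set \<Rightarrow> bool" where
  "pls_graph P \<L> \<longleftrightarrow> partial_linear_space P \<L> \<and> (\<forall>l\<in>\<L>. card l = 2)"

definition proper_pls :: "'p set \<Rightarrow> 'p set set \<Rightarrow> bool" where
  "proper_pls P \<L> \<longleftrightarrow>
     partial_linear_space P \<L> \<and> \<not> linear_space P \<L> \<and> \<not> pls_graph P \<L>"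

definition collinear_pts :: "'p set set \<Rightarrow> 'p \<Rightarrow> 'p \<Rightarrow> bool" where
  "collinear_pts \<L> a b \<longleftrightarrow> a \<noteq> b \<and> (\<exists>l\<in>\<L>. a \<in> l \<and> b \<in> l)"

definition pls_Aut :: "'p set \<Rightarrow> 'p set set \<Rightarrow> ('p \<Rightarrow> 'p) set" where
  "pls_Aut P \<L> = {g \<in> Bij P. (\<lambda>l. g ` l) ` \<L> = \<L>}"

definition line_orbit :: "('p \<Rightarrow> 'p) set \<Rightarrow> 'p set \<Rightarrow> 'p set set" where
  "line_orbit G L = (\<lambda>g. g ` L) ` G"


section \<open>Affine permutation groups\<close>

definition translation :: "'v::ab_group_add \<Rightarrow> 'v \<Rightarrow> 'v" where
  "translation u = (\<lambda>w. w + u)"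

text \<open>
  Affine maps are taken over the prime field, i.e. their linear part is only required to be
  additive; this is the most general reading of \<open>G \<le> AGL(V)\<close> for a finite vector space \<open>V\<close>.
\<close>

definition affine_perm_group :: "('v::ab_group_add \<Rightarrow> 'v) set \<Rightarrow> bool" where
  "affine_perm_group G \<longleftrightarrow>
     subgroup G (BijGroup UNIV) \<and> range translation \<subseteq> G \<and>
     (\<forall>g\<in>G. \<exists>h u. additive h \<and> g = translation u \<circ> h)"

definition G_affine :: "('v::ab_group_add \<Rightarrow> 'v) set \<Rightarrow> 'v set set \<Rightarrow> bool" where
  "G_affine G \<L> \<longleftrightarrow> affine_perm_group G \<and> G \<subseteq> pls_Aut UNIV \<L>"


section \<open>Subfields and matrices\<close>

abbreviation is_subfield :: "'a::field set \<Rightarrow> bool" where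
  "is_subfield F \<equiv> subfield F ring_of_type_algebra"

definition field_Aut :: "'a::field set \<Rightarrow> ('a \<Rightarrow> 'a) set" where
  "field_Aut F = ring_iso (ring_of_type_algebra\<lparr>carrier := F\<rparr>) (ring_of_type_algebra\<lparr>carrier := F\<rparr>)"

text \<open>The copy of \<open>\<F>\<^sub>q\<close> inside the finite field \<^typ>\<open>'a\<close>.\<close>

definition GF_in :: "nat \<Rightarrow> 'a::field set" where
  "GF_in q = (THE F. is_subfield F \<and> card F = q)"

definition mats_over :: "'a set \<Rightarrow> ('a^2^2) set" where
  "mats_over S = {A. \<forall>i j. A $ i $ j \<in> S}"

definition GL2_over :: "'a::field set \<Rightarrow> ('a^2^2) set" where
  "GL2_over S = {A \<in> mats_over S. \<exists>B\<in>mats_over S. A ** B = mat 1 \<and> B ** A = mat 1}"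

definition GL2_group :: "('a::field^2^2) monoid" where
  "GL2_group = \<lparr>carrier = GL2_over UNIV, monoid.mult = (**), one = mat 1\<rparr>"

definition mat_conj :: "'a::field^2^2 \<Rightarrow> 'a^2^2 \<Rightarrow> 'a^2^2" where
  "mat_conj A g = matrix_inv g ** A ** g"

definition diag2 :: "'a::zero \<Rightarrow> 'a \<Rightarrow> 'a^2^2" where
  "diag2 a b = vector [vector [a, 0], vector [0, b]]"

definition GL2q_scalars :: "nat \<Rightarrow> ('a::field^2^2) set" where
  "GL2q_scalars q = generate GL2_group (GL2_over (GF_in q) \<union> {mat c | c. c \<noteq> 0})"

definition affine_G :: "nat \<Rightarrow> ('a::field^2 \<Rightarrow> 'a^2) set" where
  "affine_G q = generate (BijGroup UNIV)
     (range translation \<union> (\<lambda>A v. v v* A) ` GL2q_scalars q)"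


section \<open>Matrices of endomorphisms of a quadratic extension\<close>

definition quadratic_extension :: "'a::field set \<Rightarrow> 'a set \<Rightarrow> bool" where
  "quadratic_extension E F \<longleftrightarrow>
     is_subfield E \<and> is_subfield F \<and> E \<subseteq> F \<and> ring.dimension ring_of_type_algebra 2 E F"

definition is_basis2 :: "'a::field set \<Rightarrow> 'a set \<Rightarrow> 'a \<Rightarrow> 'a \<Rightarrow> bool" where
  "is_basis2 E F b1 b2 \<longleftrightarrow>
     ring.independent ring_of_type_algebra E [b1, b2] \<and>
     ring.Span ring_of_type_algebra E [b1, b2] = F"

definition endo_matrix :: "'a::field set \<Rightarrow> 'a \<Rightarrow> 'a \<Rightarrow> ('a \<Rightarrow> 'a) \<Rightarrow> 'a^2^2" where
  "endo_matrix E b1 b2 \<phi> = (THE M. M \<in> mats_over E \<and>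
     (\<forall>l1\<in>E. \<forall>l2\<in>E. \<forall>m1\<in>E. \<forall>m2\<in>E.
        vector [l1, l2] v* M = (vector [m1, m2] :: 'a^2) \<longleftrightarrow>
        \<phi> (l1 * b1 + l2 * b2) = m1 * b1 + m2 * b2))"

text \<open>
  For a matrix over the algebraic closure whose entries lie in the embedded copy of the base
  field \<^typ>\<open>'a\<close>, the same matrix over \<^typ>\<open>'a\<close>.
\<close>

definition mat_of_ac :: "'a::field alg_closure^2^2 \<Rightarrow> 'a^2^2" where
  "mat_of_ac M = (\<chi> i j. inv_into UNIV to_ac (M $ i $ j))"


section \<open>The three families of lines\<close>

definition line_i :: "'a::field^2 \<Rightarrow> ('a^2) set \<Rightarrow> bool" where
  "line_i x L \<longleftrightarrow> (\<exists>F. is_subfield F \<and> card F > 2 \<and> L = {c *s x | c. c \<in> F})"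

definition line_ii :: "nat \<Rightarrow> 'a::field^2 \<Rightarrow> ('a^2) set \<Rightarrow> bool" where
  "line_ii q x L \<longleftrightarrow>
     (\<exists>F \<tau> g. is_subfield F \<and> F \<subseteq> GF_in q \<and>
        \<tau> \<in> field_Aut F \<and> (\<exists>c\<in>F. \<tau> c \<noteq> c) \<and>
        g \<in> GL2_over (GF_in q) \<and>
        L = {x v* mat_conj (diag2 c (\<tau> c)) g | c. c \<in> F})"

text \<open>
  The field \<open>F\<close> need not embed into \<^typ>\<open>'a\<close>; it is a finite subfield of the algebraic closure
  of \<^typ>\<open>'a\<close>, in which \<open>F \<inter> \<F>\<^sub>q\<close> is formed.
\<close>

definition line_iii :: "nat \<Rightarrow> 'a::field^2 \<Rightarrow> ('a^2) set \<Rightarrow> bool" where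
  "line_iii q x L \<longleftrightarrow>
     (\<exists>(F :: 'a alg_closure set) E b1 b2 g.
        finite F \<and> is_subfield F \<and> E = F \<inter> to_ac ` GF_in q \<and>
        quadratic_extension E F \<and> is_basis2 E F b1 b2 \<and>
        g \<in> GL2_over (GF_in q) \<and>
        L = {x v* mat_conj (mat_of_ac (endo_matrix E b1 b2 (\<lambda>v. c * v))) g | c. c \<in> F})"

end

theory Submission
  imports Defs "HOL-Number_Theory.Residues"
begin

text \<open>
  Write \<open>\<Gamma>\<close> for \<open>GL\<^sub>2(q) \<circ> K\<^sup>*\<close> and \<open>e = (1, 0)\<close>.  Everything rests on one observation: \<open>\<zeta>\<close> has degree three
  over \<open>\<F>\<^sub>q\<close>, so a matrix over \<open>\<F>\<^sub>q\<close> having \<open>x = (1, \<zeta>)\<close> as an eigenvector is scalar, since the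
  eigenvector equation is a polynomial equation for \<open>\<zeta>\<close> of degree at most two.  Hence \<open>\<Gamma>\<close> acts
  regularly on the orbit of \<open>x\<close>, and a dimension count shows that the remaining nonzero vectors form
  the orbit of \<open>e\<close>.

  From geometry to algebra (\<open>proper_pls_homogeneous_line\<close>).  If \<open>0\<close> is collinear with \<open>x\<close> and the
  space is not linear, then \<open>0\<close> is not collinear with \<open>e\<close>; so differences of collinear points
  lie in the orbit of \<open>x\<close>, and the lines form the orbit of the line \<open>L\<close> on \<open>0\<close> and \<open>x\<close>.  For
  distinct \<open>a, b \<in> L\<close> the group contains a map taking \<open>(0, x)\<close> to \<open>(a, b)\<close> and one taking it to
  \<open>(b, a)\<close>.  By regularity their linear parts differ by the factor \<open>-1\<close>, so \<open>L\<close> is invariant under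
  \<open>w \<mapsto> a + b - w\<close>.  As \<open>L\<close> has at least three points, it is an additive group.

  The algebra (\<open>homogeneous_line_cases\<close>).  Let \<open>H\<close> consist of the elements of \<open>\<Gamma>\<close> that carry \<open>x\<close> into
  \<open>L\<close>.  It is a group, regular on \<open>L - {0}\<close>, but a priori \<open>H \<union> {0}\<close> is only a nearfield.  The part
  of it lying over \<open>\<F>\<^sub>q\<close> is closed under addition of matrices, because \<open>xM = xcA\<close> makes \<open>x\<close> an
  eigenvector of \<open>MA\<^sup>-\<^sup>1\<close>; it is a finite division ring and therefore commutative.  If \<open>H\<close> is commutative and not scalar,
  comparing scalar factors in \<open>1 + h = k\<close> shows that all of \<open>H\<close> lies over \<open>\<F>\<^sub>q\<close>.  Commutativity
  of \<open>H\<close> comes from the odd number \<open>N = q\<^sup>2 + q + 1\<close>: as \<open>c\<^sup>N \<in> \<F>\<^sub>q\<close> for all \<open>c \<in> K\<close>, the power \<open>h\<^sup>N\<close> of any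
  \<open>h \<in> H\<close> lies over \<open>\<F>\<^sub>q\<close>, whereas a failure of commutativity would show in an involution that every odd
  power of \<open>h\<close> induces as well.  So either \<open>L = Fx\<close> for a subfield \<open>F\<close>, or \<open>L = xD\<close> for a nonscalar
  field \<open>D\<close> of matrices over \<open>\<F>\<^sub>q\<close>.

  The families.  In the second case choose a nonscalar \<open>d \<in> D\<close>; all of \<open>D\<close> lies in the \<open>\<F>\<^sub>q\<close>-span of
  \<open>1\<close> and \<open>d\<close>.  If \<open>d\<close> has an eigenvalue in \<open>\<F>\<^sub>q\<close>, then it has two distinct ones, \<open>D\<close> is
  diagonalisable, and the two diagonal entries determine each other through an automorphism of a
  subfield of \<open>\<F>\<^sub>q\<close>.  Otherwise an eigenvalue \<open>\<alpha>\<close> in the algebraic closure embeds \<open>D\<close> as a field \<open>F\<close>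
  with basis \<open>1, \<alpha>\<close> over \<open>F \<inter> \<F>\<^sub>q\<close>, and the companion form of \<open>d\<close> exhibits \<open>D\<close> as the regular
  representation of \<open>F\<close> in this basis.

  Conversely (\<open>matrix_division_ring_pls\<close>), each family has the form \<open>L = xD\<close> with \<open>D\<close> a division
  ring contained in \<open>\<Gamma> \<union> {0}\<close>.  A line of \<open>L\<^sup>G\<close> through \<open>a\<close> and \<open>b\<close> is then \<open>a + LB\<close> for the unique
  \<open>B \<in> \<Gamma>\<close> with \<open>b - a = xB\<close>, which makes it unique.
\<close>

(* Both vectors and formal power series write their components with a dollar sign.  With both
   readings active, the number of parses of a componentwise identity grows exponentially. *)
no_notation fps_nth (infixl \<open>$\<close> 75)

section \<open>Finite subfields and Frobenius maps\<close>

lemma is_subfield_iff: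
  fixes S :: "'a::field set"
  shows "is_subfield S \<longleftrightarrow>
    1 \<in> S \<and> (\<forall>a\<in>S. \<forall>b\<in>S. a - b \<in> S \<and> a * b \<in> S) \<and> (\<forall>a\<in>S. inverse a \<in> S)"
    (is "?L \<longleftrightarrow> ?R")
proof -
  interpret R: field "ring_of_type_algebra :: 'a ring"
    by (rule field_from_type_algebra)
  have ainv: "\<ominus>\<^bsub>ring_of_type_algebra\<^esub> a = - a" for a :: 'a
    by (rule R.minus_equality[symmetric, THEN sym]) (auto simp: ring_of_type_algebra_def)
  have minv: "inv\<^bsub>ring_of_type_algebra\<^esub> a = inverse a" if "a \<noteq> 0" for a :: 'a
    by (rule R.comm_inv_char) (use that in \<open>auto simp: ring_of_type_algebra_def\<close>)
  show ?thesis
  proof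
    assume L: ?L
    have sub: "subring S ring_of_type_algebra"
      using subfieldE(1)[OF L] .
    have S: "1 \<in> S" "\<And>a b. a \<in> S \<Longrightarrow> b \<in> S \<Longrightarrow> a * b \<in> S"
        "\<And>a b. a \<in> S \<Longrightarrow> b \<in> S \<Longrightarrow> a + b \<in> S" "\<And>a. a \<in> S \<Longrightarrow> - a \<in> S" "0 \<in> S"
      using subringE[OF sub] by (auto simp: ring_of_type_algebra_def ainv[unfolded ring_of_type_algebra_def])
    have "inverse a \<in> S" if "a \<in> S" for a
    proof (cases "a = 0")
      case False
      then have "inv\<^bsub>ring_of_type_algebra\<^esub> a \<in> S"
        using R.subfield_m_inv(1)[OF L, of a] that by (auto simp: ring_of_type_algebra_def)
      then show ?thesis using minv[OF False] by simp
    qed (use S in simp)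
    then show ?R using S by (auto simp: diff_conv_add_uminus simp del: add_uminus_conv_diff)
  next
    assume ?R
    then have S: "1 \<in> S" "\<And>a b. a \<in> S \<Longrightarrow> b \<in> S \<Longrightarrow> a * b \<in> S"
        "\<And>a b. a \<in> S \<Longrightarrow> b \<in> S \<Longrightarrow> a - b \<in> S" "\<And>a. a \<in> S \<Longrightarrow> inverse a \<in> S"
      by auto
    have S0: "0 \<in> S" using S(3)[OF S(1) S(1)] by simp
    have Sm: "- a \<in> S" if "a \<in> S" for a using S(3)[OF S0 that] by simp
    have Sa: "a + b \<in> S" if "a \<in> S" "b \<in> S" for a b using S(3)[OF that(1) Sm[OF that(2)]] by simp
    show ?L
    proof (rule R.subfieldI')
      show "subring S ring_of_type_algebra"
        by (rule R.subringI) (use S Sm Sa in \<open>auto simp: ainv ring_of_type_algebra_def ainv[unfolded ring_of_type_algebra_def]\<close>)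
      show "inv\<^bsub>ring_of_type_algebra\<^esub> k \<in> S" if "k \<in> S - {\<zero>\<^bsub>ring_of_type_algebra\<^esub>}" for k
        using that S(4)[of k] minv[of k] by (auto simp: ring_of_type_algebra_def)
    qed
  qed
qed

lemma subfield_closed:
  fixes S :: "'a::field set"
  assumes "is_subfield S"
  shows subfield_0: "0 \<in> S"
    and subfield_1: "1 \<in> S"
    and subfield_diff: "\<And>a b. a \<in> S \<Longrightarrow> b \<in> S \<Longrightarrow> a - b \<in> S"
    and subfield_mult: "\<And>a b. a \<in> S \<Longrightarrow> b \<in> S \<Longrightarrow> a * b \<in> S"
    and subfield_inverse: "\<And>a. a \<in> S \<Longrightarrow> inverse a \<in> S"
    and subfield_uminus: "\<And>a. a \<in> S \<Longrightarrow> - a \<in> S"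
    and subfield_add: "\<And>a b. a \<in> S \<Longrightarrow> b \<in> S \<Longrightarrow> a + b \<in> S"
    and subfield_divide: "\<And>a b. a \<in> S \<Longrightarrow> b \<in> S \<Longrightarrow> a / b \<in> S"
proof -
  have S: "1 \<in> S" "\<And>a b. a \<in> S \<Longrightarrow> b \<in> S \<Longrightarrow> a * b \<in> S"
        "\<And>a b. a \<in> S \<Longrightarrow> b \<in> S \<Longrightarrow> a - b \<in> S" "\<And>a. a \<in> S \<Longrightarrow> inverse a \<in> S"
    using assms by (auto simp: is_subfield_iff)
  show S0: "0 \<in> S" using S(3)[OF S(1) S(1)] by simp
  show Sm: "- a \<in> S" if "a \<in> S" for a using S(3)[OF S0 that] by simp
  show "a + b \<in> S" if "a \<in> S" "b \<in> S" for a b using S(3)[OF that(1) Sm[OF that(2)]] by simp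
  show "a / b \<in> S" if "a \<in> S" "b \<in> S" for a b
    using S(2)[OF that(1) S(4)[OF that(2)]] by (simp add: divide_inverse)
qed (use assms in \<open>auto simp: is_subfield_iff\<close>)

lemma finite_subfieldI:
  fixes S :: "'a::field set"
  assumes "finite S" "1 \<in> S"
    and diff: "\<And>a b. a \<in> S \<Longrightarrow> b \<in> S \<Longrightarrow> a - b \<in> S"
    and mult: "\<And>a b. a \<in> S \<Longrightarrow> b \<in> S \<Longrightarrow> a * b \<in> S"
  shows "is_subfield S"
proof -
  have "inverse a \<in> S" if "a \<in> S" for a
  proof (cases "a = 0")
    case False
    have "(\<lambda>b. a * b) ` S = S"
      by (rule endo_inj_surj) (use assms that False in \<open>auto simp: inj_on_def\<close>)
    then obtain b where "b \<in> S" "a * b = 1" using \<open>1 \<in> S\<close> by (metis imageE)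
    then show ?thesis using inverse_unique by blast
  qed (use that in simp)
  then show ?thesis unfolding is_subfield_iff using assms by blast
qed

lemma subfield_power:
  assumes "is_subfield S" "a \<in> S"
  shows "a ^ n \<in> S"
  by (induction n) (use assms in \<open>auto simp: subfield_1 intro: subfield_mult\<close>)

text \<open>Multiplication by a nonzero element permutes the nonzero elements and so preserves their
  product.\<close>

lemma subfield_power_card:
  fixes S :: "'a::field set"
  assumes S: "is_subfield S" and fin: "finite S" and a: "a \<in> S"
  shows "a ^ card S = a"
proof (cases "a = 0")
  case True
  then show ?thesis using fin a by (auto simp: zero_power card_gt_0_iff)
next
  case False
  have "(\<Prod>y\<in>S-{0}. a * y) = (\<Prod>y\<in>S-{0}. y)"
    by (rule prod.reindex_bij_witness[of _ "\<lambda>y. y / a" "\<lambda>y. a * y"])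
      (use False S a in \<open>auto intro: subfield_divide subfield_mult\<close>)
  moreover have "(\<Prod>y\<in>S-{0}. a * y) = a ^ card (S - {0}) * (\<Prod>y\<in>S-{0}. y)"
    by (simp add: prod.distrib)
  moreover have "(\<Prod>y\<in>S-{0}. y) \<noteq> 0" using fin by simp
  ultimately have "a ^ card (S - {0}) = 1" by simp
  moreover have "card S = Suc (card (S - {0}))"
    using fin subfield_0[OF S] by (metis card.remove)
  ultimately show ?thesis by simp
qed

lemma power_fixed_bound:
  fixes n :: nat
  assumes "n > 1"
  shows "finite {c::'a::field. c ^ n = c}" "card {c::'a. c ^ n = c} \<le> n"
proof -
  define P where "P = Polynomial.monom (1::'a) n - Polynomial.monom 1 1"
  have deg: "Polynomial.degree P \<le> n"
    unfolding P_def by (rule degree_diff_le) (use assms in \<open>auto simp: degree_monom_eq\<close>)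
  have "Polynomial.coeff P n = 1" using assms by (simp add: P_def)
  then have "P \<noteq> 0" by auto
  moreover have "{c. poly P c = 0} = {c. c ^ n = c}" by (auto simp: P_def poly_monom)
  ultimately show "finite {c::'a. c ^ n = c}" "card {c::'a. c ^ n = c} \<le> n"
    using poly_roots_finite[of P] card_poly_roots_bound[of P] deg by auto
qed

lemma finite_subfield_eq_fixed:
  fixes S :: "'a::field set"
  assumes S: "is_subfield S" and fin: "finite S"
  shows "S = {c. c ^ card S = c}"
proof (rule card_seteq)
  have "card {0, 1::'a} \<le> card S"
    by (rule card_mono) (use fin S in \<open>auto simp: subfield_0 subfield_1\<close>)
  then have "card S > 1" by simp
  from power_fixed_bound[OF this] show "finite {c::'a. c ^ card S = c}" "card {c::'a. c ^ card S = c} \<le> card S"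
    by auto
  show "S \<subseteq> {c. c ^ card S = c}" using subfield_power_card[OF S fin] by auto
qed

section \<open>Two-by-two matrices\<close>

lemma num2_neq [simp]: "(1::2) \<noteq> 2" "(2::2) \<noteq> 1"
  by simp_all

lemma mat2_eq_iff:
  "A = B \<longleftrightarrow> A$1$1 = B$1$1 \<and> A$1$2 = B$1$2 \<and> A$2$1 = B$2$1 \<and> A$2$2 = (B$2$2 :: 'a)"
  for A B :: "'a^2^2"
  by (simp only: vec_eq_iff forall_2 conj_assoc)

lemma vec2_eq_iff: "v = w \<longleftrightarrow> v$1 = w$1 \<and> v$2 = (w$2 :: 'a)" for v w :: "'a^2"
  by (simp only: vec_eq_iff forall_2 conj_assoc)

lemma mat2_mult [simp]: "(A ** B)$i$j = A$i$1 * B$1$j + A$i$2 * B$2$j"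
  for A B :: "'a::comm_ring_1^2^2"
  by (simp add: matrix_matrix_mult_def sum_2)

lemma vec2_mult [simp]: "(v v* A)$j = v$1 * A$1$j + v$2 * A$2$j"
  for A :: "'a::comm_ring_1^2^2"
  by (simp add: vector_matrix_mult_def sum_2 mult.commute)

lemma mat_nth [simp]: "(mat c)$i$j = (if i = j then c else 0)"
  by (simp add: mat_def)

lemma diag2_nth [simp]:
  "diag2 a b $1$1 = a" "diag2 a b $1$2 = 0" "diag2 a b $2$1 = 0" "diag2 a b $2$2 = b"
  by (simp_all add: diag2_def)

lemma mat_add: "mat (a + b) = mat a + (mat b :: 'a::comm_ring_1^2^2)"
  and mat_diff: "mat (a - b) = mat a - (mat b :: 'a^2^2)"
  and mat_mult: "mat (a * b) = mat a ** (mat b :: 'a^2^2)"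
  and mat_commute: "mat a ** M = M ** mat a"
  for M :: "'a::comm_ring_1^2^2"
  by (simp_all add: mat2_eq_iff)

lemma vec_mult_mat: "v v* mat c = c *s v" for v :: "'a::comm_ring_1^2"
  by (simp add: vec2_eq_iff)

lemma matrix_mult_zero [simp]: "(0::'a::comm_ring_1^2^2) ** A = 0" "A ** (0::'a^2^2) = 0"
  by (simp_all add: mat2_eq_iff)

lemma mat2_rdiff: "A ** (B - C) = A ** B - A ** C" and mat2_ldiff: "(B - C) ** A = B ** A - C ** A"
  and mat2_radd: "A ** (B + C) = A ** B + A ** C" and mat2_ladd: "(B + C) ** A = B ** A + C ** A"
  for A B C :: "'a::comm_ring_1^2^2"
  by (simp_all add: mat2_eq_iff algebra_simps)

abbreviation tr2 :: "'a::comm_ring_1^2^2 \<Rightarrow> 'a" where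
  "tr2 A \<equiv> A$1$1 + A$2$2"

abbreviation det2 :: "'a::comm_ring_1^2^2 \<Rightarrow> 'a" where
  "det2 A \<equiv> A$1$1 * A$2$2 - A$1$2 * A$2$1"

lemma det2_mult: "det2 (A ** B) = det2 A * det2 B"
  by (simp add: algebra_simps)

lemma cayley_hamilton2: "A ** A = mat (tr2 A) ** A - mat (det2 A)"
  by (simp add: mat2_eq_iff algebra_simps)

text \<open>The adjugate divided by the determinant.\<close>

definition adj_inv :: "'a::field^2^2 \<Rightarrow> 'a^2^2" where
  "adj_inv A = mat (inverse (det2 A)) ** vector [vector [A$2$2, - A$1$2], vector [- A$2$1, A$1$1]]"

lemma adj_inv:
  assumes "det2 A \<noteq> 0"
  shows "A ** adj_inv A = mat 1" "adj_inv A ** A = mat 1"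
proof -
  have "A ** (mat k ** vector [vector [A$2$2, - A$1$2], vector [- A$2$1, A$1$1]]) = mat (k * det2 A)"
    "(mat k ** vector [vector [A$2$2, - A$1$2], vector [- A$2$1, A$1$1]]) ** A = mat (k * det2 A)" for k
    by (simp_all add: mat2_eq_iff algebra_simps)
  then show "A ** adj_inv A = mat 1" "adj_inv A ** A = mat 1"
    unfolding adj_inv_def using assms by simp_all
qed

lemma det2_nonzero_iff: "det2 A \<noteq> 0 \<longleftrightarrow> (\<exists>B. A ** B = mat 1)" for A :: "'a::field^2^2"
proof
  assume "\<exists>B. A ** B = mat 1"
  then obtain B where B: "A ** B = mat 1" ..
  have "det2 A * det2 B = 1" unfolding det2_mult[symmetric] B by simp
  then show "det2 A \<noteq> 0" by auto
qed (use adj_inv in blast)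

lemma matrix_inv2:
  fixes A :: "'a::field^2^2"
  assumes "det2 A \<noteq> 0"
  shows "A ** matrix_inv A = mat 1" "matrix_inv A ** A = mat 1"
  using someI_ex[of "\<lambda>B. A ** B = mat 1 \<and> B ** A = mat 1"] adj_inv[OF assms]
  unfolding matrix_inv_def by blast+

lemma mats_over_iff:
  "A \<in> mats_over S \<longleftrightarrow> A$1$1 \<in> S \<and> A$1$2 \<in> S \<and> A$2$1 \<in> S \<and> A$2$2 \<in> S" for A :: "'a^2^2"
  by (simp only: mats_over_def forall_2 conj_assoc mem_Collect_eq)

context
  fixes S :: "'a::field set"
  assumes S: "is_subfield S"
begin

lemma mats_over_mult: "A \<in> mats_over S \<Longrightarrow> B \<in> mats_over S \<Longrightarrow> A ** B \<in> mats_over S"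
  and mats_over_diff: "A \<in> mats_over S \<Longrightarrow> B \<in> mats_over S \<Longrightarrow> A - B \<in> mats_over S"
  and mats_over_mat: "c \<in> S \<Longrightarrow> mat c \<in> mats_over S"
  and mats_over_adj_inv: "A \<in> mats_over S \<Longrightarrow> adj_inv A \<in> mats_over S"
  by (auto simp: mats_over_iff adj_inv_def intro!: subfield_add[OF S] subfield_diff[OF S]
      subfield_uminus[OF S] subfield_inverse[OF S] subfield_mult[OF S] subfield_0[OF S])

lemma GL2_over_iff: "A \<in> GL2_over S \<longleftrightarrow> A \<in> mats_over S \<and> det2 A \<noteq> 0"
  unfolding GL2_over_def using adj_inv[of A] mats_over_adj_inv[of A] det2_nonzero_iff[of A] by blast

text \<open>A nonscalar two-by-two matrix has a cyclic vector, so its centraliser is spanned by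
  the identity and the matrix itself.\<close>

lemma commuting_matrix_span:
  assumes d: "d \<in> mats_over S" "\<nexists>c. d = mat c" and A: "A \<in> mats_over S" "A ** d = d ** A"
  obtains a b where "a \<in> S" "b \<in> S" "A = mat a + mat b ** d"
proof -
  have d': "d$1$1 \<in> S" "d$1$2 \<in> S" "d$2$1 \<in> S" "d$2$2 \<in> S"
    and A': "A$1$1 \<in> S" "A$1$2 \<in> S" "A$2$1 \<in> S" "A$2$2 \<in> S"
    using d A by (auto simp: mats_over_iff)
  have e1: "A$1$2 * d$2$1 = d$1$2 * A$2$1"
    and e2: "A$1$2 * (d$2$2 - d$1$1) = d$1$2 * (A$2$2 - A$1$1)"
    and e3: "A$2$1 * (d$2$2 - d$1$1) = d$2$1 * (A$2$2 - A$1$1)"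
    using arg_cong[OF A(2), of "\<lambda>M. M$1$1"] arg_cong[OF A(2), of "\<lambda>M. M$1$2"]
      arg_cong[OF A(2), of "\<lambda>M. M$2$1"]
    by (simp_all add: algebra_simps)
  note span = that
  have *: thesis if "b \<in> S" "A$1$2 = b * d$1$2" "A$2$1 = b * d$2$1" "A$2$2 - A$1$1 = b * (d$2$2 - d$1$1)" for b
  proof (rule span[of "A$1$1 - b * d$1$1" b])
    show "A$1$1 - b * d$1$1 \<in> S" using S A' d' \<open>b \<in> S\<close> by (intro subfield_diff subfield_mult)
    show "A = mat (A$1$1 - b * d$1$1) + mat b ** d" using that(2-4) by (simp add: mat2_eq_iff algebra_simps)
  qed (use \<open>b \<in> S\<close> in auto)
  have "d$1$2 \<noteq> 0 \<or> d$2$1 \<noteq> 0 \<or> d$2$2 - d$1$1 \<noteq> 0"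
  proof (rule ccontr)
    assume "\<not> ?thesis"
    then have "d = mat (d$1$1)" by (simp add: mat2_eq_iff)
    then show False using d(2) by blast
  qed
  then consider "d$1$2 \<noteq> 0" | "d$2$1 \<noteq> 0" | "d$2$2 - d$1$1 \<noteq> 0" by blast
  then show thesis
  proof cases
    case 1
    show thesis by (rule *[of "A$1$2 / d$1$2"])
      (use 1 e1 e2 e3 S A' d' in \<open>auto simp: field_simps intro!: subfield_divide\<close>)
  next
    case 2
    show thesis by (rule *[of "A$2$1 / d$2$1"])
      (use 2 e1 e2 e3 S A' d' in \<open>auto simp: field_simps intro!: subfield_divide\<close>)
  next
    case 3
    show thesis by (rule *[of "(A$2$2 - A$1$1) / (d$2$2 - d$1$1)"])
      (use 3 e1 e2 e3 S A' d' in \<open>auto simp: nonzero_eq_divide_eq mult.commute intro!: subfield_divide subfield_diff\<close>)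
  qed
qed

end

lemma is_subfield_UNIV: "is_subfield (UNIV :: 'a::field set)"
  by (simp add: is_subfield_iff)

lemma mats_over_UNIV: "A \<in> mats_over UNIV"
  by (simp add: mats_over_def)

lemma mat_plus_mat_eq_iff:
  fixes d :: "'a::field^2^2"
  assumes "\<nexists>c. d = mat c"
  shows "mat a + mat b ** d = mat a' + mat b' ** d \<longleftrightarrow> a = a' \<and> b = b'"
proof
  assume eq: "mat a + mat b ** d = mat a' + mat b' ** d"
  have b: "b = b'"
  proof (rule ccontr)
    assume nb: "b \<noteq> b'"
    have "(b - b') * d$1$2 = 0" "(b - b') * d$2$1 = 0" "(b - b') * (d$1$1 - d$2$2) = 0"
      using arg_cong[OF eq, of "\<lambda>M. M$1$2"] arg_cong[OF eq, of "\<lambda>M. M$2$1"]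
        arg_cong[OF eq, of "\<lambda>M. M$1$1 - M$2$2"]
      by (simp_all add: algebra_simps)
    then have "d$1$2 = 0" "d$2$1 = 0" "d$1$1 = d$2$2" using nb by auto
    then have "d = mat (d$1$1)" by (simp add: mat2_eq_iff)
    then show False using assms by blast
  qed
  then show "a = a' \<and> b = b'" using eq by (simp add: mat2_eq_iff)
qed auto

section \<open>Finite division rings of two-by-two matrices\<close>

text \<open>Wedderburn's theorem for division rings of two-by-two matrices.  Two matrices \<open>d, y\<close> that do not
  commute would give a quaternion algebra over the field of scalars in \<open>D\<close>; over a finite field it
  has zero divisors, because the norm form of a quadratic extension represents every scalar.\<close>

text \<open>More than half of the elements of \<open>Z\<close> are squares, so the set of squares meets its image under
  \<open>a \<mapsto> s - ka\<close>.\<close>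

lemma subfield_square_plus_multiple:
  fixes Z :: "'a::field set"
  assumes Z: "is_subfield Z" "finite Z" and k: "k \<in> Z" "k \<noteq> 0" and s: "s \<in> Z"
  obtains u v where "u \<in> Z" "v \<in> Z" "u\<^sup>2 + k * v\<^sup>2 = s"
proof -
  define A where "A = (\<lambda>u. u\<^sup>2) ` Z"
  define f where "f = inv_into Z (\<lambda>u. u\<^sup>2)"
  have finA: "finite A" and A0: "0 \<in> A" and AZ: "A \<subseteq> Z"
    using Z subfield_0[OF Z(1)] by (auto simp: A_def power2_eq_square intro: rev_image_eqI subfield_mult)
  have f: "(f a)\<^sup>2 = a" if "a \<in> A" for a
    using that unfolding A_def f_def by (rule f_inv_into_f)
  have "Z \<subseteq> f ` A \<union> (\<lambda>a. - f a) ` (A - {0})"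
  proof
    fix z assume "z \<in> Z"
    then have zA: "z\<^sup>2 \<in> A" by (auto simp: A_def)
    have "(z - f (z\<^sup>2)) * (z + f (z\<^sup>2)) = 0"
      using f[OF zA] by (simp add: algebra_simps power2_eq_square)
    then have "z = f (z\<^sup>2) \<or> z = - f (z\<^sup>2)" by (auto simp: add_eq_0_iff2)
    moreover have "z = f (z\<^sup>2)" if "z = 0" using that f[OF zA] by simp
    ultimately show "z \<in> f ` A \<union> (\<lambda>a. - f a) ` (A - {0})" using zA by fastforce
  qed
  then have "card Z \<le> card (f ` A \<union> (\<lambda>a. - f a) ` (A - {0}))"
    using finA by (intro card_mono) auto
  also have "\<dots> \<le> card (f ` A) + card ((\<lambda>a. - f a) ` (A - {0}))" by (rule card_Un_le)
  also have "\<dots> \<le> card A + card (A - {0})"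
    using finA by (intro add_mono card_image_le) auto
  also have "\<dots> < card A + card A"
    using psubset_card_mono[OF finA, of "A - {0}"] A0 by auto
  finally have big: "card Z < card A + card A" .
  define B where "B = (\<lambda>a. s - k * a) ` A"
  have "card B = card A"
    unfolding B_def by (rule card_image) (use k in \<open>auto simp: inj_on_def\<close>)
  moreover have "B \<subseteq> Z"
    using AZ k s Z(1) by (auto simp: B_def intro!: subfield_diff subfield_mult)
  ultimately have "A \<inter> B \<noteq> {}"
    using big card_Un_disjoint[of A B] card_mono[of Z "A \<union> B"] AZ Z(2)
    by (metis Un_least finite_subset not_less)
  then obtain u v where "u \<in> Z" "v \<in> Z" "u\<^sup>2 = s - k * v\<^sup>2"
    by (auto simp: A_def B_def)
  then show thesis using that by (simp add: algebra_simps)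
qed

lemma finite_field_char_2_sqrt:
  fixes Z :: "'a::field set"
  assumes Z: "is_subfield Z" "finite Z" and 2: "(2::'a) = 0" and s: "s \<in> Z"
  obtains u where "u \<in> Z" "u\<^sup>2 = s"
proof -
  have "inj_on (\<lambda>u. u\<^sup>2) Z"
  proof (rule inj_onI)
    fix a b :: 'a assume "a\<^sup>2 = b\<^sup>2"
    then have "(a - b)\<^sup>2 = 0" using 2 by (simp add: power2_eq_square algebra_simps) algebra
    then show "a = b" by simp
  qed
  then have "(\<lambda>u. u\<^sup>2) ` Z = Z"
    using Z by (intro endo_inj_surj) (auto simp: power2_eq_square intro: subfield_mult)
  then show thesis using s that by (metis imageE)
qed

text \<open>For a finite set \<open>D\<close>, closure under inverses follows from cancellation.\<close>

definition matrix_division_ring :: "('a::field^2^2) set \<Rightarrow> bool" where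
  "matrix_division_ring D \<longleftrightarrow> mat 1 \<in> D \<and> (\<forall>A\<in>D. \<forall>B\<in>D. A - B \<in> D \<and> A ** B \<in> D) \<and>
     (\<forall>A\<in>D. A \<noteq> 0 \<longrightarrow> det2 A \<noteq> 0)"

lemma matrix_division_ring_closed:
  assumes "matrix_division_ring D"
  shows "mat 1 \<in> D" "0 \<in> D" "\<And>A B. A \<in> D \<Longrightarrow> B \<in> D \<Longrightarrow> A - B \<in> D"
    "\<And>A B. A \<in> D \<Longrightarrow> B \<in> D \<Longrightarrow> A ** B \<in> D" "\<And>A. A \<in> D \<Longrightarrow> A \<noteq> 0 \<Longrightarrow> det2 A \<noteq> 0"
    "\<And>A. A \<in> D \<Longrightarrow> - A \<in> D" "\<And>A B. A \<in> D \<Longrightarrow> B \<in> D \<Longrightarrow> A + B \<in> D"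
    "\<And>A B. A \<in> D \<Longrightarrow> B \<in> D \<Longrightarrow> A ** B = 0 \<Longrightarrow> A = 0 \<or> B = 0"
proof -
  have D: "mat 1 \<in> D" "\<And>A B. A \<in> D \<Longrightarrow> B \<in> D \<Longrightarrow> A - B \<in> D"
    "\<And>A B. A \<in> D \<Longrightarrow> B \<in> D \<Longrightarrow> A ** B \<in> D" "\<And>A. A \<in> D \<Longrightarrow> A \<noteq> 0 \<Longrightarrow> det2 A \<noteq> 0"
    using assms by (auto simp: matrix_division_ring_def)
  show 0: "0 \<in> D" using D(2)[OF D(1) D(1)] by simp
  show m: "- A \<in> D" if "A \<in> D" for A using D(2)[OF 0 that] by simp
  show "A + B \<in> D" if "A \<in> D" "B \<in> D" for A B using D(2)[OF that(1) m[OF that(2)]] by simp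
  show "A = 0 \<or> B = 0" if "A \<in> D" "B \<in> D" "A ** B = 0" for A B
  proof (rule ccontr)
    assume "\<not> ?thesis"
    then have "det2 A * det2 B \<noteq> 0" using D(4) that by auto
    then show False using that(3) unfolding det2_mult[symmetric] by simp
  qed
  show "mat 1 \<in> D" "\<And>A B. A \<in> D \<Longrightarrow> B \<in> D \<Longrightarrow> A - B \<in> D"
    "\<And>A B. A \<in> D \<Longrightarrow> B \<in> D \<Longrightarrow> A ** B \<in> D" "\<And>A. A \<in> D \<Longrightarrow> A \<noteq> 0 \<Longrightarrow> det2 A \<noteq> 0"
    by (fact D)+
qed

lemma matrix_division_ring_divide:
  assumes D: "matrix_division_ring D" "finite D" and "A \<in> D" "B \<in> D" "A \<noteq> 0"
  obtains C where "C \<in> D" "C ** A = B"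
proof -
  note c = matrix_division_ring_closed[OF D(1)]
  have "inj_on (\<lambda>C. C ** A) D"
  proof (rule inj_onI)
    fix M N assume MN: "M \<in> D" "N \<in> D" "M ** A = N ** A"
    then have "(M - N) ** A = 0" by (simp add: mat2_ldiff)
    then show "M = N" using c(8)[of "M - N" A] c(3) MN \<open>A \<in> D\<close> \<open>A \<noteq> 0\<close> by auto
  qed
  then have "(\<lambda>C. C ** A) ` D = D"
    using D(2) c(4) \<open>A \<in> D\<close> by (intro endo_inj_surj) auto
  then show thesis using that \<open>B \<in> D\<close> by (metis imageE)
qed

text \<open>With \<open>t\<close> and \<open>n\<close> the trace and determinant of \<open>d\<close>, the commutator \<open>w = dy - yd\<close> satisfies
  \<open>wd = (t - d)w\<close> and has scalar square \<open>s\<close>.  The first relation makes \<open>t\<close>, and then \<open>n\<close> and \<open>s\<close>,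
  elements of \<open>D\<close>.  If \<open>p = a + bd\<close> has norm \<open>s\<close> and conjugate \<open>p'\<close>, then
  \<open>(w - p')(w + p) = w\<^sup>2 - p'p = 0\<close>, so \<open>w\<close> is one of two matrices commuting with \<open>d\<close>; together
  with the first relation this forces \<open>d\<close> to be scalar.\<close>

theorem finite_matrix_division_ring_commutative:
  fixes D :: "('a::field^2^2) set"
  assumes D: "matrix_division_ring D" and fin: "finite D"
    and y: "y \<in> D" and d: "d \<in> D"
  shows "d ** y = y ** d"
proof (rule ccontr)
  assume neq: "d ** y \<noteq> y ** d"
  note c = matrix_division_ring_closed[OF D]
  define t where "t = tr2 d"
  define n where "n = det2 d"
  define w where "w = d ** y - y ** d"
  define s where "s = - det2 w"
  define Z where "Z = {c. mat c \<in> D}"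
  have w: "w \<in> D" "w \<noteq> 0" using neq y d c(3,4) by (auto simp: w_def)
  have nonscalar: "d \<noteq> mat a" for a using neq mat_commute[of a y] by auto
  have finZ: "finite Z"
  proof (rule finite_imageD)
    show "finite (mat ` Z :: ('a^2^2) set)" by (rule finite_subset[OF _ fin]) (auto simp: Z_def)
    show "inj_on (mat :: 'a \<Rightarrow> 'a^2^2) Z" by (auto simp: inj_on_def mat2_eq_iff)
  qed
  have Z: "is_subfield Z"
    by (rule finite_subfieldI[OF finZ]) (auto simp: Z_def mat_diff mat_mult c)
  (* Dividing this identity by w shows that the scalar t belongs to D. *)
  have tw: "mat t ** w = d ** w + w ** d"
    by (simp add: mat2_eq_iff t_def w_def algebra_simps)
  obtain T where T: "T \<in> D" "T ** w = d ** w + w ** d"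
    using matrix_division_ring_divide[OF D fin w(1) c(7)[OF c(4)[OF d w(1)] c(4)[OF w(1) d]] w(2)] .
  have Tw: "(T - mat t) ** w = 0" using tw T(2) by (simp add: mat2_ldiff)
  have "T = mat t"
  proof -
    have "det2 w \<noteq> 0" using c(5) w by blast
    then obtain v where "w ** v = mat 1" using det2_nonzero_iff by blast
    then have "(T - mat t) ** w ** v = T - mat t" by (simp add: matrix_mul_assoc[symmetric])
    then show ?thesis using Tw by simp
  qed
  then have t: "t \<in> Z" using T(1) by (simp add: Z_def)
  have "mat n = mat t ** d - d ** d"
    using cayley_hamilton2[of d] by (simp add: t_def n_def)
  then have n: "n \<in> Z" using t d c by (simp add: Z_def)
  have dd: "d ** d = mat t ** d - mat n"
    using cayley_hamilton2[of d] by (simp add: t_def n_def)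
  have trw: "tr2 w = 0" by (simp add: w_def algebra_simps)
  have ww: "w ** w = mat s"
    using cayley_hamilton2[of w] unfolding trw by (simp add: s_def mat2_eq_iff)
  then have s: "s \<in> Z" using w c by (metis Z_def mem_Collect_eq)
  have wd: "w ** d = (mat t - d) ** w"
    by (simp add: mat2_eq_iff t_def w_def algebra_simps)
  have square_zero: "d = mat a" if "a \<in> Z" "(d - mat a) ** (d - mat a) = 0" for a
    using c(8)[OF c(3)[OF d] c(3)[OF d], of "mat a" "mat a"] that by (simp add: Z_def)
  have no_commute: False if comm: "w ** d = d ** w"
  proof -
    have "(mat t - d - d) ** w = 0" using wd comm by (subst mat2_ldiff) simp
    then have "mat t - d - d = 0"
      using c(8)[of "mat t - d - d" w] w c(3) t d by (metis Z_def mem_Collect_eq)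
    then have td: "mat t = d + d" by (simp only: diff_diff_eq right_minus_eq)
    show False
    proof (cases "(2::'a) = 0")
      case True
      have "t = 0" using td True by (simp add: mat2_eq_iff mult_2[symmetric])
      obtain m where m: "m \<in> Z" "m\<^sup>2 = n" using finite_field_char_2_sqrt[OF Z finZ True n] .
      have m2: "m + m = 0" "n + n = 0" using True by (simp_all flip: mult_2)
      have "(d - mat m) ** (d - mat m) = d ** d - mat (m + m) ** d + mat n"
        unfolding m(2)[symmetric] by (simp add: mat2_eq_iff power2_eq_square algebra_simps)
      also have "\<dots> = 0" using dd m2 by (simp add: \<open>t = 0\<close> mat2_eq_iff)
      finally show False using square_zero[OF m(1)] nonscalar by blast
    next
      case False
      have "t = 2 * d$1$1" "t = 2 * d$2$2" "d$1$2 = 0" "d$2$1 = 0"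
        using td False by (auto simp: mat2_eq_iff simp flip: mult_2)
      then have "d = mat (t / 2)" using False by (auto simp: mat2_eq_iff)
      then show False using nonscalar by auto
    qed
  qed
  (* The norm form of a + bd represents s: complete the square, or take b = 0 in characteristic 2. *)
  obtain a b where ab: "a \<in> Z" "b \<in> Z" "a\<^sup>2 + t * a * b + n * b\<^sup>2 = s"
  proof (cases "(2::'a) = 0")
    case True
    obtain u where "u \<in> Z" "u\<^sup>2 = s" using finite_field_char_2_sqrt[OF Z finZ True s] .
    then show thesis using that[of u 0] subfield_0[OF Z] by simp
  next
    case False
    define k where "k = n - (t / 2)\<^sup>2"
    have "1 + 1 \<in> Z" using Z by (intro subfield_add subfield_1)
    then have 2: "2 \<in> Z" by simp
    have th: "t / 2 \<in> Z" using Z t 2 by (rule subfield_divide)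
    have k: "k \<in> Z" unfolding k_def power2_eq_square using Z n th by (intro subfield_diff subfield_mult)
    have "k \<noteq> 0"
    proof
      assume "k = 0"
      have tt: "t / 2 + t / 2 = t" using False by (simp add: field_simps)
      have "(d - mat (t / 2)) ** (d - mat (t / 2)) = d ** d - mat (t / 2 + t / 2) ** d + mat ((t / 2)\<^sup>2)"
        by (simp add: mat2_eq_iff power2_eq_square algebra_simps)
      also have "\<dots> = 0" unfolding tt using \<open>k = 0\<close> dd by (simp add: k_def mat2_eq_iff)
      finally show False using square_zero[OF th] nonscalar by blast
    qed
    then obtain u v where uv: "u \<in> Z" "v \<in> Z" "u\<^sup>2 + k * v\<^sup>2 = s"
      using subfield_square_plus_multiple[OF Z finZ k _ s] by blast
    show thesis
    proof (rule that[of "u - t / 2 * v" v])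
      show "u - t / 2 * v \<in> Z" using Z uv th by (intro subfield_diff subfield_mult)
      define h where "h = t / 2"
      have t2: "t = h + h" using False by (simp add: h_def field_simps)
      have "(u - h * v)\<^sup>2 + (h + h) * (u - h * v) * v + n * v\<^sup>2 = u\<^sup>2 + (n - h\<^sup>2) * v\<^sup>2"
        by (simp add: power2_eq_square algebra_simps)
      then show "(u - t / 2 * v)\<^sup>2 + t * (u - t / 2 * v) * v + n * v\<^sup>2 = s"
        using uv(3) unfolding k_def h_def[symmetric] by (simp add: t2)
    qed (use uv in auto)
  qed
  define p where "p = mat a + mat b ** d"
  define p' where "p' = mat (a + b * t) - mat b ** d"
  have pD: "p \<in> D" "p' \<in> D"
    using ab d t c Z by (auto simp: p_def p'_def Z_def mat_add mat_mult)
  have wp: "w ** p = p' ** w"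
  proof -
    have "w ** p = mat a ** w + mat b ** (w ** d)"
      by (simp add: p_def mat2_eq_iff algebra_simps)
    also have "\<dots> = p' ** w" unfolding wd by (simp add: p'_def mat2_eq_iff algebra_simps)
    finally show ?thesis .
  qed
  have "p' ** p = mat s"
  proof -
    have "p' ** p = mat (a * (a + b * t)) + mat (b * b) ** (mat t ** d - d ** d)"
      by (simp add: p_def p'_def mat2_eq_iff algebra_simps)
    also have "\<dots> = mat (a * (a + b * t) + b * b * n)"
      unfolding dd by (simp add: mat2_eq_iff)
    also have "\<dots> = mat s" using ab(3) by (simp add: power2_eq_square algebra_simps)
    finally show ?thesis .
  qed
  then have "(w - p') ** (w + p) = 0"
    using ww wp by (simp add: mat2_ldiff mat2_radd)
  then have "w - p' = 0 \<or> w + p = 0"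
    by (rule c(8)[rotated 2]) (use pD w c(3,7) in auto)
  then have "w = p' \<or> w = - p" by (auto simp: add_eq_0_iff2)
  moreover have "p' ** d = d ** p'" "(- p) ** d = d ** (- p)"
    by (simp_all add: p_def p'_def mat2_eq_iff algebra_simps)
  ultimately have "w ** d = d ** w" by blast
  then show False by (rule no_commute)
qed

section \<open>The cubic extension and its linear group\<close>

lemma card_nth_roots_bound:
  fixes n :: nat
  assumes "n > 0"
  shows "card {c::'a::field. c ^ n = a} \<le> n"
proof -
  define P where "P = Polynomial.monom (1::'a) n - [:a:]"
  have deg: "Polynomial.degree P \<le> n"
    unfolding P_def by (rule degree_diff_le) (use assms in \<open>auto simp: degree_monom_eq\<close>)
  have "Polynomial.coeff P n = 1" using assms by (cases n) (simp_all add: P_def)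
  then have "P \<noteq> 0" by auto
  moreover have "{c. poly P c = 0} = {c. c ^ n = a}" by (auto simp: P_def poly_monom)
  ultimately show ?thesis using card_poly_roots_bound[of P] deg by auto
qed

locale cubic_extension =
  fixes q :: nat and \<zeta> :: "'k::{field,finite}"
  assumes q_primepow: "primepow q"
    and card_K: "CARD('k) = q ^ 3"
    and \<zeta>_generates: "range (\<lambda>n::int. \<zeta> powi n) = UNIV - {0}"
begin

lemma q_gt_1: "q > 1"
  using primepow_gt_Suc_0[OF q_primepow] by simp

lemma q_char: "prime CHAR('k)" "\<exists>k. q = CHAR('k) ^ k"
proof -
  obtain p k where p: "prime p" "q = p ^ k" using q_primepow by (auto simp: primepow_def)
  show prime: "prime CHAR('k)"
    using prime_CHAR_semidom[where ?'a = 'k] finite_imp_CHAR_pos[where ?'a = 'k] by simp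
  have "CHAR('k) dvd p ^ (k * 3)" using CHAR_dvd_CARD[where ?'a = 'k] card_K p by (simp add: power_mult)
  then have "CHAR('k) dvd p" using prime prime_dvd_power by blast
  then have "CHAR('k) = p" using p(1) prime by (simp add: primes_dvd_imp_eq)
  then show "\<exists>k. q = CHAR('k) ^ k" using p by auto
qed

lemma frobenius_add: "(a + b) ^ q = a ^ q + b ^ q" for a b :: 'k
  using q_char freshmans_dream'[where ?'a = 'k] by blast

lemma frobenius_add_ac: "(a + b) ^ q = a ^ q + b ^ q" for a b :: "'k alg_closure"
  using q_char freshmans_dream'[where ?'a = "'k alg_closure"] by (simp add: CHAR_alg_closure) blast

lemma frobenius_diff: "(a - b) ^ q = a ^ q - b ^ q" for a b :: 'k
  using frobenius_add[of "a - b" b] by simp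

lemma frobenius_diff_ac: "(a - b) ^ q = a ^ q - b ^ q" for a b :: "'k alg_closure"
  using frobenius_add_ac[of "a - b" b] by simp

lemma power_q3: "c ^ (q ^ 3) = c" for c :: 'k
  using subfield_power_card[OF is_subfield_UNIV, of c] card_K by simp

lemma of_nat_q3: "of_nat (q ^ 3) = (0::'k)"
  using CHAR_dvd_CARD[where ?'a = 'k] card_K by (simp only: of_nat_eq_0_iff_char_dvd)

text \<open>The exponent of the norm from \<open>K\<close> to \<open>\<F>\<^sub>q\<close>.  That it is odd is what makes the group \<open>H\<close> of a line
  commutative.\<close>

definition N :: nat where "N = q\<^sup>2 + q + 1"

lemma odd_N: "odd N"
  by (simp add: N_def power2_eq_square)

lemma power_N_fixed: "(c ^ N) ^ q = c ^ N" for c :: 'k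
proof -
  have "N * q = q ^ 3 + (q\<^sup>2 + q)" by (simp add: N_def power2_eq_square power3_eq_cube algebra_simps)
  then have "(c ^ N) ^ q = c * c ^ (q\<^sup>2 + q)"
    by (simp only: power_mult[symmetric] power_add[of c "q ^ 3"] power_q3)
  also have "\<dots> = c ^ N" by (simp add: N_def)
  finally show ?thesis .
qed

lemma fixed_subfield: "is_subfield {c::'k. c ^ q = c}"
  by (rule finite_subfieldI) (auto simp: frobenius_diff power_mult_distrib)

text \<open>The lower bound counts \<open>K\<^sup>*\<close> along the fibres of the norm \<open>c \<mapsto> c\<^sup>N\<close>, each of which has at most \<open>N\<close>
  elements, and \<open>(q - 1) N = q\<^sup>3 - 1\<close>.\<close>

lemma card_fixed: "card {c::'k. c ^ q = c} = q"
proof (rule antisym)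
  show "card {c::'k. c ^ q = c} \<le> q" using power_fixed_bound[OF q_gt_1] by blast
  define A where "A = {c::'k. c ^ q = c} - {0}"
  have N: "N > 0" by (simp add: N_def)
  have "UNIV - {0} \<subseteq> (\<Union>a\<in>A. {c::'k. c ^ N = a})"
    using power_N_fixed by (auto simp: A_def)
  then have "card (UNIV - {0::'k}) \<le> card (\<Union>a\<in>A. {c::'k. c ^ N = a})"
    by (intro card_mono) auto
  also have "\<dots> \<le> (\<Sum>a\<in>A. card {c::'k. c ^ N = a})" by (rule card_UN_le) simp
  also have "\<dots> \<le> (\<Sum>a\<in>A. N)" by (rule sum_mono) (rule card_nth_roots_bound[OF N])
  also have "\<dots> = card A * N" by simp
  finally have "q ^ 3 - 1 \<le> card A * N" by (simp add: card_Diff_singleton card_K)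
  moreover have "(q - 1) * N = q ^ 3 - 1"
  proof -
    obtain m where "q = Suc m" using q_gt_1 by (cases q) auto
    then show ?thesis unfolding N_def by (simp add: power2_eq_square power3_eq_cube algebra_simps)
  qed
  ultimately have "(q - 1) * N \<le> card A * N" by simp
  then have "q - 1 \<le> card A" using N by simp
  moreover have "card {c::'k. c ^ q = c} = Suc (card A)"
    unfolding A_def by (rule card.remove) (use q_gt_1 in auto)
  ultimately show "q \<le> card {c::'k. c ^ q = c}" by simp
qed

lemma GF_in_eq: "GF_in q = {c::'k. c ^ q = c}"
  unfolding GF_in_def
proof (rule the_equality)
  show "is_subfield {c::'k. c ^ q = c} \<and> card {c::'k. c ^ q = c} = q"
    using fixed_subfield card_fixed by simp
  show "F = {c. c ^ q = c}" if "is_subfield F \<and> card F = q" for F :: "'k set"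
    using finite_subfield_eq_fixed[of F] that by simp
qed

abbreviation Fq :: "'k set" where "Fq \<equiv> GF_in q"

lemma Fq_iff: "c \<in> Fq \<longleftrightarrow> c ^ q = c"
  by (simp add: GF_in_eq)

lemma Fq: "is_subfield Fq" and card_Fq: "card Fq = q"
  using fixed_subfield card_fixed by (simp_all add: GF_in_eq)

lemma power_N_in_Fq: "c ^ N \<in> Fq"
  using power_N_fixed by (simp add: Fq_iff)

text \<open>If \<open>\<zeta>\<close> had degree at most two over \<open>\<F>\<^sub>q\<close>, all its powers and hence all of \<open>K\<close> would lie in a
  space of \<open>q\<^sup>2\<close> elements.\<close>

lemma \<zeta>_square_not_in_span:
  assumes "u \<in> Fq" "v \<in> Fq"
  shows "\<zeta> * \<zeta> \<noteq> u + v * \<zeta>"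
proof
  assume sq: "\<zeta> * \<zeta> = u + v * \<zeta>"
  define W where "W = (\<lambda>(a, b). a + b * \<zeta>) ` (Fq \<times> Fq)"
  have W: "a + b * \<zeta> \<in> W" if "a \<in> Fq" "b \<in> Fq" for a b
    using that by (force simp: W_def)
  have step: "\<zeta> * w \<in> W" if wW: "w \<in> W" for w
  proof -
    obtain a b where ab: "a \<in> Fq" "b \<in> Fq" "w = a + b * \<zeta>" using wW by (auto simp: W_def)
    have "\<zeta> * w = a * \<zeta> + b * (\<zeta> * \<zeta>)" by (simp add: ab algebra_simps)
    also have "\<dots> = b * u + (a + b * v) * \<zeta>" unfolding sq by (simp add: algebra_simps)
    also have "\<dots> \<in> W" using ab assms Fq by (intro W subfield_add subfield_mult)
    finally show ?thesis .
  qed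
  have pow: "\<zeta> ^ n \<in> W" for n
  proof (induction n)
    case 0
    show ?case using W[of 1 0] subfield_0[OF Fq] subfield_1[OF Fq] by simp
  qed (use step in auto)
  have "y \<in> W" for y
  proof (cases "y = 0")
    case True
    then show ?thesis using W[of 0 0] subfield_0[OF Fq] by simp
  next
    case False
    then obtain n :: int where n: "y = \<zeta> powi n" using \<zeta>_generates by blast
    show ?thesis
    proof (cases "n \<ge> 0")
      case True
      then show ?thesis using pow n by (simp add: power_int_def)
    next
      case neg: False
      have z: "\<zeta> \<noteq> 0" using n neg False by auto
      have q3: "q ^ 3 = Suc (Suc (q ^ 3 - 2))"
        using one_less_power[OF q_gt_1, of 3] by simp
      (* Negative powers are also nonnegative ones, because K is finite. *)
      have "\<zeta> * (\<zeta> * \<zeta> ^ (q ^ 3 - 2)) = \<zeta>" using power_q3[of \<zeta>] q3 by (metis power_Suc)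
      then have "inverse \<zeta> = \<zeta> ^ (q ^ 3 - 2)" using z by (simp add: field_simps)
      then have "y = \<zeta> ^ ((q ^ 3 - 2) * nat (- n))"
        using neg n by (simp add: power_int_def power_mult power_inverse)
      then show ?thesis using pow by simp
    qed
  qed
  then have "card (UNIV::'k set) \<le> card (Fq \<times> Fq)"
    unfolding W_def by (metis UNIV_eq_I card_image_le finite)
  then have "q ^ 3 \<le> q ^ 2" by (simp add: card_K card_cartesian_product card_Fq power2_eq_square)
  then show False using q_gt_1 power_strict_increasing[of 2 3 q] by simp
qed

lemma \<zeta>_independent:
  assumes "a \<in> Fq" "b \<in> Fq" "c \<in> Fq" and eq: "a + b * \<zeta> + c * (\<zeta> * \<zeta>) = 0"
  shows "a = 0" "b = 0" "c = 0"
proof -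
  show c: "c = 0"
  proof (rule ccontr)
    assume "c \<noteq> 0"
    then have "\<zeta> * \<zeta> = - a / c + (- b / c) * \<zeta>" using eq by (simp add: field_simps add_eq_0_iff)
    moreover have "- a / c \<in> Fq" "- b / c \<in> Fq"
      using Fq assms by (auto intro!: subfield_divide subfield_uminus)
    ultimately show False using \<zeta>_square_not_in_span by blast
  qed
  show b: "b = 0"
  proof (rule ccontr)
    assume "b \<noteq> 0"
    then have "\<zeta> = - a / b" using eq c by (simp add: field_simps add_eq_0_iff)
    then have "\<zeta> * \<zeta> = 0 + (- a / b) * \<zeta>" by simp
    moreover have "- a / b \<in> Fq" using Fq assms by (auto intro!: subfield_divide subfield_uminus)
    ultimately show False using \<zeta>_square_not_in_span subfield_0[OF Fq] by blast
  qed
  show "a = 0" using eq b c by simp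
qed

abbreviation x :: "'k^2" where "x \<equiv> vector [1, \<zeta>]"

lemma x_neq_0: "x \<noteq> 0"
  by (auto simp: vec2_eq_iff)

text \<open>The equation says that \<open>\<zeta>\<close> is a root of a polynomial of degree at most two.\<close>

lemma x_eigenvector:
  assumes M: "M \<in> mats_over Fq" and eq: "x v* M = c *s x"
  shows "M = mat c"
proof -
  have 1: "M$1$1 + \<zeta> * M$2$1 = c" and 2: "M$1$2 + \<zeta> * M$2$2 = c * \<zeta>"
    using arg_cong[OF eq, of "\<lambda>v. v$1"] arg_cong[OF eq, of "\<lambda>v. v$2"] by simp_all
  have "M$1$2 + (M$2$2 - M$1$1) * \<zeta> + (- M$2$1) * (\<zeta> * \<zeta>) = 0"
    using 2 unfolding 1[symmetric] by (simp add: algebra_simps)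
  then have "M$1$2 = 0" "M$2$2 - M$1$1 = 0" "- M$2$1 = 0"
    using \<zeta>_independent[of "M$1$2" "M$2$2 - M$1$1" "- M$2$1"] M Fq
    by (simp_all add: mats_over_iff subfield_diff subfield_uminus)
  then show ?thesis using 1 by (simp add: mat2_eq_iff)
qed

subsection \<open>Regularity on the orbit of \<open>x\<close>\<close>

abbreviation \<Gamma> :: "('k^2^2) set" where "\<Gamma> \<equiv> GL2q_scalars q"

lemma inv_GL2_group:
  assumes "det2 A \<noteq> 0"
  shows "inv\<^bsub>GL2_group\<^esub> A = (adj_inv A :: 'k^2^2)"
  unfolding m_inv_def
proof (rule the_equality)
  have "det2 A * det2 (adj_inv A) = 1"
    unfolding det2_mult[symmetric] adj_inv[OF assms] by simp
  then have "det2 (adj_inv A) \<noteq> 0" by auto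
  then show "adj_inv A \<in> carrier GL2_group \<and>
      A \<otimes>\<^bsub>GL2_group\<^esub> adj_inv A = \<one>\<^bsub>GL2_group\<^esub> \<and> adj_inv A \<otimes>\<^bsub>GL2_group\<^esub> A = \<one>\<^bsub>GL2_group\<^esub>"
    using adj_inv[OF assms] by (simp add: GL2_group_def GL2_over_iff[OF is_subfield_UNIV] mats_over_UNIV)
  show "B = adj_inv A" if "B \<in> carrier GL2_group \<and>
      A \<otimes>\<^bsub>GL2_group\<^esub> B = \<one>\<^bsub>GL2_group\<^esub> \<and> B \<otimes>\<^bsub>GL2_group\<^esub> A = \<one>\<^bsub>GL2_group\<^esub>" for B
  proof -
    have "B ** (A ** adj_inv A) = adj_inv A"
      using that by (simp add: matrix_mul_assoc GL2_group_def)
    then show ?thesis using adj_inv[OF assms] by simp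
  qed
qed

lemma \<Gamma>_eq: "\<Gamma> = {mat c ** A | c A. c \<noteq> 0 \<and> A \<in> mats_over Fq \<and> det2 A \<noteq> 0}" (is "_ = ?R")
proof
  have one: "mat 1 \<in> mats_over Fq" using mats_over_mat[OF Fq] subfield_1[OF Fq] .
  have R: "mat c ** A \<in> ?R" if "c \<noteq> 0" "A \<in> mats_over Fq" "det2 A \<noteq> 0" for c A
    using that by blast
  have scalar: "mat c \<in> ?R" if "c \<noteq> 0" for c
    using R[OF that one] by simp
  have lin: "A \<in> ?R" if "A \<in> mats_over Fq" "det2 A \<noteq> 0" for A
    using R[of 1 A] that by simp
  show "\<Gamma> \<subseteq> ?R"
  proof
    fix h assume "h \<in> \<Gamma>"
    then have "h \<in> generate GL2_group (GL2_over Fq \<union> {mat c | c. c \<noteq> 0})"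
      by (simp add: GL2q_scalars_def)
    then show "h \<in> ?R"
    proof (induction rule: generate.induct)
      case one
      then show ?case using scalar[of 1] by (simp add: GL2_group_def)
    next
      case (incl h)
      then show ?case using scalar lin by (auto simp: GL2_over_iff[OF Fq])
    next
      case (inv h)
      then consider "h \<in> mats_over Fq" "det2 h \<noteq> 0" | c where "c \<noteq> 0" "h = mat c"
        by (auto simp: GL2_over_iff[OF Fq])
      then show ?case
      proof cases
        case 1
        then have "det2 h * det2 (adj_inv h) = 1"
          unfolding det2_mult[symmetric] adj_inv[OF 1(2)] by simp
        then have "det2 (adj_inv h) \<noteq> 0" by auto
        then show ?thesis
          using lin[OF mats_over_adj_inv[OF Fq 1(1)]] inv_GL2_group[OF 1(2)] by simp
      next
        case 2
        then have "adj_inv h = mat (inverse c)"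
          by (simp add: adj_inv_def mat2_eq_iff field_simps)
        moreover have "det2 h \<noteq> 0" using 2 by simp
        ultimately show ?thesis using inv_GL2_group[of h] scalar[of "inverse c"] 2 by simp
      qed
    next
      case (eng h1 h2)
      then obtain c A c' A' where h: "c \<noteq> 0" "A \<in> mats_over Fq" "det2 A \<noteq> 0" "h1 = mat c ** A"
        "c' \<noteq> 0" "A' \<in> mats_over Fq" "det2 A' \<noteq> 0" "h2 = mat c' ** A'" by blast
      have "h1 ** h2 = mat (c * c') ** (A ** A')" by (simp add: h mat2_eq_iff algebra_simps)
      moreover have "det2 (A ** A') \<noteq> 0" unfolding det2_mult using h by simp
      ultimately have "h1 ** h2 \<in> ?R" using R[of "c * c'" "A ** A'"] h mats_over_mult[OF Fq] by simp
      then show ?case by (simp add: GL2_group_def)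
    qed
  qed
  show "?R \<subseteq> \<Gamma>"
  proof clarify
    fix c :: 'k and A :: "'k^2^2" assume "c \<noteq> 0" "A \<in> mats_over Fq" "det2 A \<noteq> 0"
    then have "(mat c :: 'k^2^2) \<otimes>\<^bsub>GL2_group\<^esub> A \<in> \<Gamma>"
      unfolding GL2q_scalars_def by (intro generate.eng generate.incl) (auto simp: GL2_over_iff[OF Fq])
    then show "mat c ** A \<in> \<Gamma>" by (simp add: GL2_group_def)
  qed
qed

lemma \<Gamma>I: "c \<noteq> 0 \<Longrightarrow> A \<in> mats_over Fq \<Longrightarrow> det2 A \<noteq> 0 \<Longrightarrow> mat c ** A \<in> \<Gamma>"
  unfolding \<Gamma>_eq by blast

lemma \<Gamma>E:
  assumes "h \<in> \<Gamma>"
  obtains c A where "c \<noteq> 0" "A \<in> mats_over Fq" "det2 A \<noteq> 0" "h = mat c ** A"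
  using assms unfolding \<Gamma>_eq by blast

lemma GL_\<Gamma>: "A \<in> mats_over Fq \<Longrightarrow> det2 A \<noteq> 0 \<Longrightarrow> A \<in> \<Gamma>"
  using \<Gamma>I[of 1 A] by simp

lemma mat_\<Gamma>: "c \<noteq> 0 \<Longrightarrow> mat c \<in> \<Gamma>"
  using \<Gamma>I[of c "mat 1"] mats_over_mat[OF Fq] subfield_1[OF Fq] by simp

lemma \<Gamma>_det: "h \<in> \<Gamma> \<Longrightarrow> det2 h \<noteq> 0"
proof (elim \<Gamma>E)
  fix c A assume h: "c \<noteq> 0" "det2 A \<noteq> 0" "h = mat c ** A"
  have "det2 h = det2 (mat c) * det2 A" unfolding h(3) det2_mult ..
  then show ?thesis using h by simp
qed

lemma \<Gamma>_mult:
  assumes "g \<in> \<Gamma>" "h \<in> \<Gamma>"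
  shows "g ** h \<in> \<Gamma>"
  using generate.eng[of g GL2_group _ h] assms unfolding GL2q_scalars_def by (simp add: GL2_group_def)

lemma \<Gamma>_inverse:
  assumes "h \<in> \<Gamma>"
  obtains h' where "h' \<in> \<Gamma>" "h ** h' = mat 1" "h' ** h = mat 1"
proof -
  obtain c A where h: "c \<noteq> 0" "A \<in> mats_over Fq" "det2 A \<noteq> 0" "h = mat c ** A"
    using assms by (rule \<Gamma>E)
  have "det2 A * det2 (adj_inv A) = 1"
    unfolding det2_mult[symmetric] adj_inv[OF h(3)] by simp
  then have "mat (inverse c) ** adj_inv A \<in> \<Gamma>"
    using h mats_over_adj_inv[OF Fq h(2)] by (intro \<Gamma>I) auto
  moreover have "h ** (mat (inverse c) ** adj_inv A) = mat (c * inverse c) ** (A ** adj_inv A)"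
    "(mat (inverse c) ** adj_inv A) ** h = mat (c * inverse c) ** (adj_inv A ** A)"
    unfolding h(4) by (simp_all add: mat2_eq_iff algebra_simps)
  ultimately show thesis using that adj_inv[OF h(3)] h(1) by simp
qed

lemma \<Gamma>_eigenvector:
  assumes "h \<in> \<Gamma>" and eq: "x v* h = c *s x"
  shows "h = mat c"
proof -
  obtain b A where h: "b \<noteq> 0" "A \<in> mats_over Fq" "h = mat b ** A"
    using assms by (elim \<Gamma>E)
  have "x v* A = (c / b) *s x"
  proof -
    have "b *s (x v* A) = c *s x" unfolding eq[symmetric] h by (simp add: vec2_eq_iff algebra_simps)
    then have "inverse b *s (b *s (x v* A)) = inverse b *s (c *s x)" by simp
    then show ?thesis using h(1) by (simp add: vec2_eq_iff field_simps)
  qed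
  then have "A = mat (c / b)" using x_eigenvector h by blast
  then show ?thesis using h by (simp add: mat2_eq_iff)
qed

text \<open>This is the form in which the degree of \<open>\<zeta>\<close> enters the geometry: an element of \<open>\<Gamma>\<close> is determined
  by the image of \<open>x\<close>.\<close>

lemma \<Gamma>_regular:
  assumes "g \<in> \<Gamma>" "h \<in> \<Gamma>" "x v* g = x v* h"
  shows "g = h"
proof -
  obtain h' where h': "h' \<in> \<Gamma>" "h ** h' = mat 1" "h' ** h = mat 1" using assms(2) by (rule \<Gamma>_inverse)
  have "x v* (g ** h') = 1 *s x"
    by (simp add: vector_matrix_mul_assoc[symmetric] assms(3)) (simp add: vector_matrix_mul_assoc h' del: vec2_mult)
  then have "g ** h' = mat 1" using \<Gamma>_eigenvector \<Gamma>_mult[OF assms(1) h'(1)] by blast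
  then have "g ** h' ** h = h" by simp
  then show ?thesis using h' by (simp add: matrix_mul_assoc[symmetric])
qed

subsection \<open>Orbits on vectors\<close>

abbreviation e :: "'k^2" where "e \<equiv> vector [1, 0]"

lemma e_neq_0: "0 \<noteq> e"
  by (auto simp: vec2_eq_iff)

lemma e_not_in_orbit:
  assumes "h \<in> \<Gamma>"
  shows "x v* h \<noteq> e"
proof
  assume eq: "x v* h = e"
  obtain c A where h: "c \<noteq> 0" "A \<in> mats_over Fq" "det2 A \<noteq> 0" "h = mat c ** A"
    using assms by (rule \<Gamma>E)
  have "c * (A$1$2 + A$2$2 * \<zeta>) = 0"
    using arg_cong[OF eq, of "\<lambda>v. v$2"] by (simp add: h(4) algebra_simps)
  then have "A$1$2 + A$2$2 * \<zeta> + 0 * (\<zeta> * \<zeta>) = 0" using h(1) by simp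
  then have "A$1$2 = 0" "A$2$2 = 0"
    using \<zeta>_independent[of "A$1$2" "A$2$2" 0] h(2) Fq by (auto simp: mats_over_iff subfield_0)
  then show False using h(3) by simp
qed

text \<open>For \<open>\<beta>\<close> outside \<open>\<F>\<^sub>q\<close>, the four elements \<open>1, \<zeta>, \<beta>, \<beta>\<zeta>\<close> of the three-dimensional space \<open>K\<close>
  are dependent over \<open>\<F>\<^sub>q\<close>; this writes \<open>\<beta>\<close> as a fractional linear transform of \<open>\<zeta>\<close>.\<close>

lemma orbit_of_irrational:
  fixes \<beta> :: 'k
  assumes "\<beta> \<notin> Fq"
  obtains h where "h \<in> \<Gamma>" "vector [1, \<beta>] = x v* h"
proof -
  define f where "f = (\<lambda>(s, t, u, v). s + t * \<zeta> - \<beta> * (u + v * \<zeta>))"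
  define Q where "Q = Fq \<times> Fq \<times> Fq \<times> Fq"
  have "card Q = q ^ 4" by (simp add: Q_def card_cartesian_product card_Fq power4_eq_xxxx)
  moreover have "q ^ 3 < q ^ 4" using q_gt_1 by (intro power_strict_increasing) auto
  ultimately have "card (f ` Q) < card Q"
    using card_mono[of UNIV "f ` Q"] card_K by simp
  then have "\<not> inj_on f Q" by (rule pigeonhole)
  then obtain P P' where P: "P \<in> Q" "P' \<in> Q" "f P = f P'" "P \<noteq> P'"
    unfolding inj_on_def by blast
  obtain s t u v where P1: "P = (s, t, u, v)" by (cases P)
  obtain s' t' u' v' where P2: "P' = (s', t', u', v')" by (cases P')
  have Q: "s \<in> Fq" "t \<in> Fq" "u \<in> Fq" "v \<in> Fq" "s' \<in> Fq" "t' \<in> Fq" "u' \<in> Fq" "v' \<in> Fq"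
    using P(1,2) unfolding P1 P2 Q_def by simp_all
  have eq: "s + t * \<zeta> - \<beta> * (u + v * \<zeta>) = s' + t' * \<zeta> - \<beta> * (u' + v' * \<zeta>)"
    using P(3) unfolding P1 P2 f_def by simp
  have neq: "(s, t, u, v) \<noteq> (s', t', u', v')" using P(4) unfolding P1 P2 .
  define A :: "'k^2^2" where "A = vector [vector [u - u', s - s'], vector [v - v', t - t']]"
  have A: "A \<in> mats_over Fq" "A$1$1 \<in> Fq" "A$1$2 \<in> Fq" "A$2$1 \<in> Fq" "A$2$2 \<in> Fq"
    using Q Fq by (simp_all add: mats_over_iff A_def subfield_diff)
  define c where "c = A$1$1 + A$2$1 * \<zeta>"
  have rel: "A$1$2 + A$2$2 * \<zeta> = \<beta> * c"
    using eq by (simp add: A_def c_def algebra_simps)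
  have "c \<noteq> 0"
  proof
    assume "c = 0"
    then have "A$1$1 + A$2$1 * \<zeta> + 0 * (\<zeta> * \<zeta>) = 0" "A$1$2 + A$2$2 * \<zeta> + 0 * (\<zeta> * \<zeta>) = 0"
      using rel by (simp_all add: c_def)
    then have "A$1$1 = 0" "A$2$1 = 0" "A$1$2 = 0" "A$2$2 = 0"
      using \<zeta>_independent A subfield_0[OF Fq] by blast+
    then show False using neq by (simp add: A_def)
  qed
  moreover have "det2 A \<noteq> 0"
  proof
    assume det: "det2 A = 0"
    show False
    proof (cases "A$1$1 = 0 \<and> A$2$1 = 0")
      case True
      then show False using \<open>c \<noteq> 0\<close> by (simp add: c_def)
    next
      case False
      then obtain b where b: "b \<in> Fq" "A$1$2 = b * A$1$1" "A$2$2 = b * A$2$1"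
      proof (cases "A$1$1 = 0")
        case True
        then show ?thesis using that[of "A$2$2 / A$2$1"] det False A Fq
          by (auto simp: field_simps intro: subfield_divide)
      next
        case nz: False
        then show ?thesis using that[of "A$1$2 / A$1$1"] det A Fq
          by (auto simp: field_simps intro: subfield_divide)
      qed
      then have "\<beta> * c = b * c" using rel by (simp add: c_def algebra_simps)
      then show False using \<open>c \<noteq> 0\<close> b assms by simp
    qed
  qed
  ultimately have "mat (inverse c) ** A \<in> \<Gamma>" using A by (intro \<Gamma>I) auto
  moreover have "vector [1, \<beta>] = x v* (mat (inverse c) ** A)"
  proof -
    have "inverse c * (A$1$1 + A$2$1 * \<zeta>) = 1" "inverse c * (A$1$2 + A$2$2 * \<zeta>) = \<beta>"
      unfolding rel using \<open>c \<noteq> 0\<close> by (simp_all add: c_def[symmetric])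
    then show ?thesis by (simp add: vec2_eq_iff algebra_simps)
  qed
  ultimately show thesis by (rule that)
qed

text \<open>The orbit of \<open>e\<close> consists of the vectors whose coordinates have their ratio in \<open>\<F>\<^sub>q \<union> {\<infinity>}\<close>.\<close>

lemma two_orbits:
  fixes v :: "'k^2"
  assumes "v \<noteq> 0"
  obtains h where "h \<in> \<Gamma>" "v = x v* h" | h where "h \<in> \<Gamma>" "v = e v* h"
proof (cases "v$1 = 0")
  case True
  then have v2: "v$2 \<noteq> 0" using assms by (auto simp: vec2_eq_iff)
  define A :: "'k^2^2" where "A = vector [vector [0, 1], vector [1, 0]]"
  have "mat (v$2) ** A \<in> \<Gamma>"
    using v2 subfield_0[OF Fq] subfield_1[OF Fq] by (intro \<Gamma>I) (auto simp: A_def mats_over_iff)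
  moreover have "v = e v* (mat (v$2) ** A)" using True by (simp add: A_def vec2_eq_iff)
  ultimately show thesis by (rule that(2))
next
  case v1: False
  define \<beta> where "\<beta> = v$2 / v$1"
  have v: "v = v$1 *s vector [1, \<beta>]" using v1 by (simp add: \<beta>_def vec2_eq_iff)
  show thesis
  proof (cases "\<beta> \<in> Fq")
    case True
    define A :: "'k^2^2" where "A = vector [vector [1, \<beta>], vector [0, 1]]"
    have "mat (v$1) ** A \<in> \<Gamma>"
      using v1 True subfield_0[OF Fq] subfield_1[OF Fq] by (intro \<Gamma>I) (auto simp: A_def mats_over_iff)
    moreover have "v = e v* (mat (v$1) ** A)" using v1 by (simp add: A_def \<beta>_def vec2_eq_iff)
    ultimately show thesis by (rule that(2))
  next
    case False
    then obtain h where h: "h \<in> \<Gamma>" "vector [1, \<beta>] = x v* h" by (rule orbit_of_irrational)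
    have "mat (v$1) ** h \<in> \<Gamma>" using h v1 by (intro \<Gamma>_mult mat_\<Gamma>)
    moreover have "v = x v* (mat (v$1) ** h)"
    proof -
      have "x v* (mat (v$1) ** h) = v$1 *s (x v* h)" by (simp add: vec2_eq_iff algebra_simps)
      then show ?thesis using h(2) v by simp
    qed
    ultimately show thesis by (rule that(1))
  qed
qed

end

section \<open>Partial linear spaces and additive lines\<close>

context cubic_extension
begin

definition aff :: "'k^2^2 \<Rightarrow> 'k^2 \<Rightarrow> 'k^2 \<Rightarrow> 'k^2" where
  "aff A u v = v v* A + u"

lemma aff_comp: "aff A u (aff B w v) = aff (B ** A) (w v* A + u) v"
  by (simp add: aff_def vector_matrix_left_distrib vector_matrix_mul_assoc add.assoc del: vec2_mult)

lemma aff_inverse: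
  assumes "A \<in> \<Gamma>"
  obtains B w where "B \<in> \<Gamma>" "\<And>v. aff A u (aff B w v) = v" "\<And>v. aff B w (aff A u v) = v"
proof -
  obtain B where B: "B \<in> \<Gamma>" "A ** B = mat 1" "B ** A = mat 1" using assms by (rule \<Gamma>_inverse)
  show thesis
  proof (rule that[of B "- (u v* B)"])
    have "(- (u v* B)) v* A = - u"
      using arg_cong[OF B(3), of "\<lambda>M. - (u v* M)"]
      by (simp add: vector_matrix_mul_assoc[symmetric] del: vec2_mult) (simp add: vec2_eq_iff algebra_simps)
    then show "aff A u (aff B (- (u v* B)) v) = v" for v
      by (simp add: aff_comp B) (simp add: aff_def)
    show "aff B (- (u v* B)) (aff A u v) = v" for v
      by (simp add: aff_comp B) (simp add: aff_def)
  qed (fact B)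
qed

lemma aff_bij: "A \<in> \<Gamma> \<Longrightarrow> bij (aff A u)"
proof -
  assume "A \<in> \<Gamma>"
  then obtain B w where "\<And>v. aff A u (aff B w v) = v" "\<And>v. aff B w (aff A u v) = v"
    by (rule aff_inverse[where u = u]) blast
  then show ?thesis by (intro o_bij[of "aff B w"]) (auto simp: fun_eq_iff)
qed

lemma aff_Bij: "A \<in> \<Gamma> \<Longrightarrow> aff A u \<in> Bij UNIV"
  using aff_bij by (simp add: Bij_def extensional_def)

lemma BijGroup_UNIV_mult:
  "f \<in> Bij UNIV \<Longrightarrow> g \<in> Bij UNIV \<Longrightarrow> f \<otimes>\<^bsub>BijGroup UNIV\<^esub> g = f \<circ> g"
  by (auto simp: BijGroup_def compose_def fun_eq_iff)

lemma BijGroup_UNIV_one: "\<one>\<^bsub>BijGroup UNIV\<^esub> = id"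
  by (auto simp: BijGroup_def fun_eq_iff)

lemma translation_eq_aff: "translation u = aff (mat 1) u"
  by (simp add: translation_def aff_def fun_eq_iff del: vec2_mult)

lemma linear_eq_aff: "(\<lambda>v. v v* A) = aff A 0"
  by (simp add: aff_def fun_eq_iff)

lemma affine_G_generators: "range translation \<union> (\<lambda>A v. v v* A) ` \<Gamma> \<subseteq> {aff A u | A u. A \<in> \<Gamma>}"
  using mat_\<Gamma>[of 1] by (auto simp: translation_eq_aff linear_eq_aff)

lemma affine_G_eq: "affine_G q = {aff A u | A u. A \<in> \<Gamma>}"
proof
  interpret B: group "BijGroup (UNIV :: ('k^2) set)" by (rule group_BijGroup)
  have carr: "carrier (BijGroup UNIV) = (Bij UNIV :: ('k^2 \<Rightarrow> 'k^2) set)"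
    by (simp add: BijGroup_def)
  show "affine_G q \<subseteq> {aff A u | A u. A \<in> \<Gamma>}"
  proof
    fix f assume "f \<in> (affine_G q :: ('k^2 \<Rightarrow> 'k^2) set)"
    then have "f \<in> generate (BijGroup UNIV) (range translation \<union> (\<lambda>A v. v v* A) ` \<Gamma>)"
      by (simp add: affine_G_def)
    then show "f \<in> {aff A u | A u. A \<in> \<Gamma>}"
    proof (induction rule: generate.induct)
      case one
      have "id = aff (mat 1) 0" by (simp add: aff_def fun_eq_iff del: vec2_mult)
      then show ?case using mat_\<Gamma>[OF one_neq_zero] unfolding BijGroup_UNIV_one by blast
    next
      case (incl f)
      then show ?case using affine_G_generators by blast
    next
      case (inv f)
      then obtain A u where f: "f = aff A u" "A \<in> \<Gamma>" using affine_G_generators by blast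
      obtain B w where B: "B \<in> \<Gamma>" "\<And>v. aff B w (aff A u v) = v"
        using aff_inverse[OF f(2), of u] by metis
      have "inv\<^bsub>BijGroup UNIV\<^esub> (aff A u) = aff B w"
        by (rule B.inv_equality)
          (use B f aff_Bij in \<open>auto simp: BijGroup_UNIV_mult BijGroup_UNIV_one carr fun_eq_iff\<close>)
      then show ?case using f B by auto
    next
      case (eng f g)
      then obtain A u B w where f: "f = aff A u" "A \<in> \<Gamma>" "g = aff B w" "B \<in> \<Gamma>" by blast
      then have "f \<otimes>\<^bsub>BijGroup UNIV\<^esub> g = aff (B ** A) (w v* A + u)"
        unfolding f(1,3) using f(2,4)
        by (simp add: BijGroup_UNIV_mult aff_Bij) (simp add: fun_eq_iff aff_comp del: vec2_mult)
      then show ?case using f \<Gamma>_mult by blast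
    qed
  qed
  show "{aff A u | A u. A \<in> \<Gamma>} \<subseteq> affine_G q"
  proof clarify
    fix A u assume A: "A \<in> \<Gamma>"
    have "translation u \<otimes>\<^bsub>BijGroup UNIV\<^esub> (\<lambda>v. v v* A) \<in> affine_G q"
      unfolding affine_G_def by (intro generate.eng generate.incl) (use A in auto)
    moreover have "translation u \<otimes>\<^bsub>BijGroup UNIV\<^esub> (\<lambda>v. v v* A) = aff A u"
      unfolding translation_eq_aff linear_eq_aff
      using A mat_\<Gamma>[of 1] by (simp add: BijGroup_UNIV_mult aff_Bij) (simp add: fun_eq_iff aff_def)
    ultimately show "aff A u \<in> affine_G q" by simp
  qed
qed

lemma affine_perm_group_affine_G: "affine_perm_group (affine_G q :: ('k^2 \<Rightarrow> 'k^2) set)"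
  unfolding affine_perm_group_def
proof (intro conjI ballI)
  interpret B: group "BijGroup (UNIV :: ('k^2) set)" by (rule group_BijGroup)
  show "subgroup (affine_G q) (BijGroup (UNIV :: ('k^2) set))"
    unfolding affine_G_def
    by (rule B.generate_is_subgroup) (use affine_G_generators aff_Bij in \<open>auto simp: BijGroup_def\<close>)
  show "range translation \<subseteq> (affine_G q :: ('k^2 \<Rightarrow> 'k^2) set)"
    unfolding affine_G_def by (auto intro: generate.incl)
  show "\<exists>h u. additive h \<and> g = translation u \<circ> h" if gG: "g \<in> affine_G q" for g :: "'k^2 \<Rightarrow> 'k^2"
  proof -
    obtain A u where g: "g = aff A u" using gG by (auto simp: affine_G_eq)
    have "additive (\<lambda>v. v v* A)" by (simp add: additive_def vector_matrix_left_distrib del: vec2_mult)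
    moreover have "g = translation u \<circ> (\<lambda>v. v v* A)"
      by (simp add: g aff_def translation_def fun_eq_iff)
    ultimately show ?thesis by blast
  qed
qed

lemma line_orbit_eq: "line_orbit (affine_G q) L = {aff A u ` L | A u. A \<in> \<Gamma>}"
  unfolding line_orbit_def affine_G_eq by blast

lemma G_affine_iff: "G_affine (affine_G q) \<L> \<longleftrightarrow> (\<forall>A\<in>\<Gamma>. \<forall>u. \<forall>l\<in>\<L>. aff A u ` l \<in> \<L>)"
proof
  assume "G_affine (affine_G q) \<L>"
  then show "\<forall>A\<in>\<Gamma>. \<forall>u. \<forall>l\<in>\<L>. aff A u ` l \<in> \<L>"
    unfolding G_affine_def affine_G_eq pls_Aut_def by blast
next
  assume closed: "\<forall>A\<in>\<Gamma>. \<forall>u. \<forall>l\<in>\<L>. aff A u ` l \<in> \<L>"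
  have "(\<lambda>l. aff A u ` l) ` \<L> = \<L>" if A: "A \<in> \<Gamma>" for A u
  proof
    obtain B w where B: "B \<in> \<Gamma>" "\<And>v. aff A u (aff B w v) = v"
      using aff_inverse[OF A, of u] by metis
    show "\<L> \<subseteq> (\<lambda>l. aff A u ` l) ` \<L>"
    proof
      fix l assume "l \<in> \<L>"
      moreover have "l = aff A u ` (aff B w ` l)" by (simp add: image_image B)
      ultimately show "l \<in> (\<lambda>l. aff A u ` l) ` \<L>" using closed B(1) by blast
    qed
  qed (use closed A in auto)
  then show "G_affine (affine_G q) \<L>"
    unfolding G_affine_def affine_G_eq[symmetric] using affine_perm_group_affine_G aff_Bij
    by (auto simp: pls_Aut_def affine_G_eq)
qed

subsection \<open>Division rings of matrices give partial linear spaces\<close>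

text \<open>Difference and product of matrices in \<open>D\<close> move the base point and the frame of the line: with
  \<open>a = xM\<^sub>1A + u\<close> and \<open>b = xM\<^sub>2A + u\<close> the frame \<open>B = (M\<^sub>2 - M\<^sub>1)A\<close> works, as \<open>D(M\<^sub>2 - M\<^sub>1) + M\<^sub>1 = D\<close>.\<close>

lemma line_through_two_points:
  assumes D: "matrix_division_ring D" "D \<subseteq> insert 0 \<Gamma>" and L: "L = {x v* M | M. M \<in> D}"
    and A: "A \<in> \<Gamma>" and ab: "a \<in> aff A u ` L" "b \<in> aff A u ` L" "a \<noteq> b"
  obtains B where "B \<in> \<Gamma>" "b - a = x v* B" "aff A u ` L = aff B a ` L"
proof -
  note c = matrix_division_ring_closed[OF D(1)]
  obtain M1 M2 where M: "M1 \<in> D" "M2 \<in> D" "a = aff A u (x v* M1)" "b = aff A u (x v* M2)"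
    using ab unfolding L by blast
  define P where "P = M2 - M1"
  have P: "P \<in> D" "P \<noteq> 0" using M ab(3) c(3) by (auto simp: P_def)
  then have P\<Gamma>: "P \<in> \<Gamma>" using D(2) by blast
  show thesis
  proof (rule that)
    show "P ** A \<in> \<Gamma>" using P\<Gamma> A by (rule \<Gamma>_mult)
    show "b - a = x v* (P ** A)"
      unfolding M aff_def P_def by (simp add: vec2_eq_iff algebra_simps)
    have key: "aff (P ** A) a (x v* C) = aff A u (x v* (C ** P + M1))" for C
      unfolding M aff_def by (simp add: vec2_eq_iff algebra_simps)
    show "aff A u ` L = aff (P ** A) a ` L"
    proof
      show "aff (P ** A) a ` L \<subseteq> aff A u ` L"
      proof clarify
        fix v assume "v \<in> L"
        then obtain C where "C \<in> D" "v = x v* C" unfolding L by blast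
        then show "aff (P ** A) a v \<in> aff A u ` L"
          using key[of C] c(4,7) P(1) M(1) unfolding L by blast
      qed
      show "aff A u ` L \<subseteq> aff (P ** A) a ` L"
      proof clarify
        fix v assume "v \<in> L"
        then obtain M where "M \<in> D" "v = x v* M" unfolding L by blast
        moreover obtain C where "C \<in> D" "C ** P = M - M1"
          using matrix_division_ring_divide[OF D(1) _ P(1) _ P(2), of "M - M1"] c(3) \<open>M \<in> D\<close> M(1) by auto
        ultimately have "aff A u v = aff (P ** A) a (x v* C)" using key[of C] by simp
        then show "aff A u v \<in> aff (P ** A) a ` L" using \<open>C \<in> D\<close> unfolding L by blast
      qed
    qed
  qed
qed

text \<open>By regularity the frame \<open>B\<close> of a line through \<open>a\<close> and \<open>b\<close> depends only on \<open>b - a\<close>, so the line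
  does too; and \<open>0\<close> and \<open>e\<close> lie on no common line.\<close>

proposition matrix_division_ring_pls:
  assumes D: "matrix_division_ring D" "D \<subseteq> insert 0 \<Gamma>" "card D > 2" and L: "L = {x v* M | M. M \<in> D}"
  shows "G_affine (affine_G q) (line_orbit (affine_G q) L) \<and>
    proper_pls UNIV (line_orbit (affine_G q) L) \<and> collinear_pts (line_orbit (affine_G q) L) 0 x"
proof -
  note c = matrix_division_ring_closed[OF D(1)]
  define \<L> where "\<L> = line_orbit (affine_G q) L"
  have \<L>: "\<L> = {aff A u ` L | A u. A \<in> \<Gamma>}" by (simp add: \<L>_def line_orbit_eq)
  have "G_affine (affine_G q) \<L>"
    unfolding G_affine_iff
  proof (intro ballI allI)
    fix A u l assume "A \<in> \<Gamma>" "l \<in> \<L>"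
    then obtain B w where B: "B \<in> \<Gamma>" "l = aff B w ` L" unfolding \<L> by blast
    have "aff A u ` l = aff (B ** A) (w v* A + u) ` L"
      by (simp add: B image_image aff_comp del: vec2_mult)
    then show "aff A u ` l \<in> \<L>" unfolding \<L> using \<Gamma>_mult[OF B(1) \<open>A \<in> \<Gamma>\<close>] by blast
  qed
  moreover have card: "card l > 2" if l: "l \<in> \<L>" for l
  proof -
    obtain A u where A: "A \<in> \<Gamma>" "l = aff A u ` L" using l unfolding \<L> by blast
    have "inj_on (\<lambda>M. x v* M) D"
    proof (rule inj_onI)
      fix M M' assume M: "M \<in> D" "M' \<in> D" "x v* M = x v* M'"
      show "M = M'"
      proof (rule ccontr)
        assume "M \<noteq> M'"
        then have "M - M' \<in> \<Gamma>" using c(3)[OF M(1,2)] D(2) by auto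
        moreover have "x v* (M - M') = 0 *s x"
          by (simp add: vector_matrix_mult_diff_rdistrib M(3) del: vec2_mult)
        ultimately have "M - M' = mat 0" by (rule \<Gamma>_eigenvector)
        then show False using \<open>M \<noteq> M'\<close> by simp
      qed
    qed
    moreover have "L = (\<lambda>M. x v* M) ` D" by (auto simp: L)
    moreover have "inj_on (aff A u) L" using aff_bij[OF A(1)] by (metis bij_is_inj inj_on_subset subset_UNIV)
    ultimately have "card l = card D" by (simp add: A card_image)
    then show ?thesis using D(3) by simp
  qed
  moreover have pls: "partial_linear_space UNIV \<L>"
    unfolding partial_linear_space_def
  proof (intro conjI ballI impI)
    fix a b l m assume ab: "a \<noteq> b" and "l \<in> \<L>" "m \<in> \<L>" and lm: "a \<in> l \<and> b \<in> l \<and> a \<in> m \<and> b \<in> m"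
    obtain A u where A: "A \<in> \<Gamma>" "l = aff A u ` L" using \<open>l \<in> \<L>\<close> unfolding \<L> by blast
    obtain A' u' where A': "A' \<in> \<Gamma>" "m = aff A' u' ` L" using \<open>m \<in> \<L>\<close> unfolding \<L> by blast
    obtain B where B: "B \<in> \<Gamma>" "b - a = x v* B" "l = aff B a ` L"
      using line_through_two_points[OF D(1,2) L A(1), of a u b] lm ab A(2) by metis
    obtain B' where B': "B' \<in> \<Gamma>" "b - a = x v* B'" "m = aff B' a ` L"
      using line_through_two_points[OF D(1,2) L A'(1), of a u' b] lm ab A'(2) by metis
    have "B = B'" using \<Gamma>_regular B B' by metis
    then show "l = m" using B B' by simp
  qed (use card in \<open>force+\<close>)
  moreover have "\<not> linear_space UNIV \<L>"
  proof
    assume "linear_space UNIV \<L>"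
    then obtain l where "l \<in> \<L>" "0 \<in> l" "e \<in> l"
      unfolding linear_space_def by (metis UNIV_I e_neq_0)
    then obtain A u where A: "A \<in> \<Gamma>" "0 \<in> aff A u ` L" "e \<in> aff A u ` L" unfolding \<L> by blast
    then obtain B where "B \<in> \<Gamma>" "e - 0 = x v* B"
      using line_through_two_points[OF D(1,2) L A(1), of 0 u e] e_neq_0 by metis
    then show False using e_not_in_orbit[of B] by (metis diff_zero)
  qed
  moreover have "L \<in> \<L>"
  proof -
    have "L = aff (mat 1) 0 ` L" by (simp add: aff_def del: vec2_mult)
    then show ?thesis unfolding \<L> using mat_\<Gamma>[of 1] by force
  qed
  moreover have "0 \<in> L" "x \<in> L"
    unfolding L using c(1,2) vector_matrix_mult_0_right[of x] vector_matrix_mul_rid[of x] by (metis (mono_tags, lifting) mem_Collect_eq)+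
  ultimately show ?thesis
    unfolding \<L>_def[symmetric] proper_pls_def pls_graph_def collinear_pts_def
    using x_neq_0 by fastforce
qed

subsection \<open>The line through \<open>0\<close> and \<open>x\<close>\<close>

text \<open>These conditions are all that the classification retains of the geometry.\<close>

definition homogeneous_line :: "('k^2) set \<Rightarrow> bool" where
  "homogeneous_line L \<longleftrightarrow> x \<in> L \<and> 0 \<in> L \<and> card L > 2 \<and> (\<forall>a\<in>L. \<forall>b\<in>L. a + b \<in> L) \<and>
     (\<forall>v\<in>L. v \<noteq> 0 \<longrightarrow> (\<exists>B\<in>\<Gamma>. v = x v* B)) \<and>
     (\<forall>B\<in>\<Gamma>. x v* B \<in> L \<longrightarrow> (\<forall>v\<in>L. v v* B \<in> L))"

text \<open>The hypotheses exclude that \<open>0\<close> is collinear with \<open>e\<close>, because all pairs of points would then be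
  collinear.  The reflections \<open>w \<mapsto> a + b - w\<close> generate the translations by elements of \<open>L\<close>, and
  composing two of them needs a third point on the line.\<close>

proposition proper_pls_homogeneous_line:
  assumes G: "G_affine (affine_G q) \<L>" and proper: "proper_pls UNIV \<L>" and col: "collinear_pts \<L> 0 x"
  obtains L where "homogeneous_line L" "\<L> = line_orbit (affine_G q) L"
proof -
  have aff: "aff A u ` l \<in> \<L>" if "A \<in> \<Gamma>" "l \<in> \<L>" for A u l
    using G that unfolding G_affine_iff by blast
  have pls: "partial_linear_space UNIV \<L>" using proper by (simp add: proper_pls_def)
  have uniq: "l = m" if "a \<noteq> b" "l \<in> \<L>" "m \<in> \<L>" "a \<in> l" "b \<in> l" "a \<in> m" "b \<in> m" for a b l m
    using pls that unfolding partial_linear_space_def by blast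
  obtain L where L: "L \<in> \<L>" "0 \<in> L" "x \<in> L" using col by (auto simp: collinear_pts_def)
  (* The two orbits on nonzero vectors would both consist of neighbours of 0. *)
  have no_e: False if le: "l \<in> \<L>" "0 \<in> l" "e \<in> l" for l
  proof -
    have "linear_space UNIV \<L>" unfolding linear_space_def
    proof (intro conjI ballI impI pls)
      fix a b :: "'k^2" assume ab: "a \<noteq> b"
      have "\<exists>m\<in>\<L>. a \<in> m \<and> b \<in> m"
      proof -
        have "b - a \<noteq> 0" using ab by simp
        then show ?thesis
        proof (cases rule: two_orbits)
          case (1 h)
          have "aff h a 0 = a" "aff h a x = b" using 1(2) by (simp_all add: aff_def flip: 1(2) del: vec2_mult)
          then show ?thesis using aff[OF 1(1) L(1), of a] L(2,3) by (metis imageI)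
        next
          case (2 h)
          have "aff h a 0 = a" "aff h a e = b" using 2(2) by (simp_all add: aff_def flip: 2(2) del: vec2_mult)
          then show ?thesis using aff[OF 2(1) le(1), of a] le(2,3) by (metis imageI)
        qed
      qed
      then show "\<exists>!l. l \<in> \<L> \<and> a \<in> l \<and> b \<in> l" using uniq[OF ab] by metis
    qed
    then show False using proper by (simp add: proper_pls_def)
  qed
  have pair: "\<exists>h\<in>\<Gamma>. b - a = x v* h" if l: "l \<in> \<L>" "a \<in> l" "b \<in> l" "a \<noteq> b" for a b l
  proof -
    have "b - a \<noteq> 0" using l by simp
    then show ?thesis
    proof (cases rule: two_orbits)
      case (1 h)
      then show ?thesis by blast
    next
      case (2 h)
      have h: "aff h a 0 = a" "aff h a e = b" using 2(2) by (simp_all add: aff_def flip: 2(2) del: vec2_mult)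
      obtain B w where B: "B \<in> \<Gamma>" "\<And>v. aff B w (aff h a v) = v"
        using aff_inverse[OF 2(1), of a] by metis
      have "0 \<in> aff B w ` l" "e \<in> aff B w ` l"
        using B(2)[of 0] B(2)[of e] h l(2,3) by (metis imageI)+
      then show ?thesis using no_e aff[OF B(1) l(1)] by blast
    qed
  qed
  have line: "l = aff h a ` L" if "l \<in> \<L>" "a \<in> l" "b \<in> l" "a \<noteq> b" "h \<in> \<Gamma>" "b - a = x v* h" for l a b h
  proof -
    have "aff h a 0 = a" "aff h a x = b" using that(6) by (simp_all add: aff_def flip: that(6) del: vec2_mult)
    then have "a \<in> aff h a ` L" "b \<in> aff h a ` L" using L by (metis imageI)+
    then show ?thesis using uniq[OF that(4,1) aff[OF that(5) L(1)]] that by blast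
  qed
  have card2: "card l \<ge> 2" if "l \<in> \<L>" for l using pls that by (simp add: partial_linear_space_def)
  have orbit: "\<L> = line_orbit (affine_G q) L"
  proof
    show "line_orbit (affine_G q) L \<subseteq> \<L>" unfolding line_orbit_eq using aff L(1) by blast
    show "\<L> \<subseteq> line_orbit (affine_G q) L"
    proof
      fix l assume l: "l \<in> \<L>"
      have "\<not> card l \<le> Suc 0" using card2[OF l] by simp
      then obtain a b where ab: "a \<in> l" "b \<in> l" "a \<noteq> b" by (auto simp: card_le_Suc0_iff_eq)
      then obtain h where "h \<in> \<Gamma>" "b - a = x v* h" using pair[OF l] by blast
      then show "l \<in> line_orbit (affine_G q) L" unfolding line_orbit_eq using line[OF l ab] by blast
    qed
  qed
  have cardL: "card L > 2"
  proof -
    obtain l where l: "l \<in> \<L>" "card l \<noteq> 2" using proper pls by (auto simp: proper_pls_def pls_graph_def)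
    obtain A u where "l = aff A u ` L" using l(1) unfolding orbit line_orbit_eq by blast
    then have "card l \<le> card L" by (simp add: card_image_le)
    then show ?thesis using card2[OF l(1)] l(2) by simp
  qed
  (* The maps taking (0, x) to (a, b) and to (b, a) both map L onto itself, and they differ by the
     point reflection exchanging a and b. *)
  have reflect: "a + b - w \<in> L" if ab: "a \<in> L" "b \<in> L" "a \<noteq> b" and w: "w \<in> L" for a b w
  proof -
    obtain h where h: "h \<in> \<Gamma>" "b - a = x v* h" using pair[OF L(1) ab] by blast
    have mh: "mat (-1) ** h \<in> \<Gamma>" "a - b = x v* (mat (-1) ** h)"
    proof -
      show "mat (-1) ** h \<in> \<Gamma>" using h mat_\<Gamma>[of "-1"] by (intro \<Gamma>_mult) auto
      have "x v* (mat (-1) ** h) = - (x v* h)" by (simp add: vec2_eq_iff)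
      then show "a - b = x v* (mat (-1) ** h)" using h(2) by (metis minus_diff_eq)
    qed
    obtain v where v: "v \<in> L" "w = aff h a v" using line[OF L(1) ab h] w by blast
    have "aff (mat (-1) ** h) b v \<in> L" using line[OF L(1) ab(2,1) _ mh] ab(3) v(1) by blast
    moreover have "aff (mat (-1) ** h) b v = a + b - w"
      unfolding v aff_def by (simp add: vec2_eq_iff)
    ultimately show ?thesis by simp
  qed
  have "homogeneous_line L" unfolding homogeneous_line_def
  proof (intro conjI ballI impI)
    fix v b assume vb: "v \<in> L" "b \<in> L"
    show "v + b \<in> L"
    proof -
      have "\<not> L \<subseteq> {0, b}"
      proof
        assume "L \<subseteq> {0, b}"
        then have "card L \<le> card {0, b}" by (intro card_mono) auto
        also have "\<dots> \<le> 2" by (simp add: card_insert_if)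
        finally show False using cardL by simp
      qed
      then obtain a where a: "a \<in> L" "a \<noteq> 0" "a \<noteq> b" by blast
      have "a + 0 - v \<in> L" using reflect a L(2) vb by blast
      then have "a + b - (a + 0 - v) \<in> L" using reflect a vb by blast
      then show ?thesis by (simp add: algebra_simps)
    qed
  next
    fix v assume "v \<in> L" "v \<noteq> 0"
    then show "\<exists>B\<in>\<Gamma>. v = x v* B" using pair[OF L(1,2), of v] by auto
  next
    fix B v assume B: "B \<in> \<Gamma>" "x v* B \<in> L" "v \<in> L"
    have "x v* B \<noteq> 0"
    proof
      assume "x v* B = 0"
      then have "B = mat 0" using \<Gamma>_eigenvector[OF B(1), of 0] by (simp del: vec2_mult)
      then show False using \<Gamma>_det[OF B(1)] by simp
    qed
    then have "L = aff B 0 ` L" using line[OF L(1,2) B(2) _ B(1)] by (metis diff_zero)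
    then show "v v* B \<in> L" using B(3) by (metis (no_types) add.right_neutral aff_def image_eqI)
  qed (use L cardL in auto)
  then show thesis using orbit by (rule that)
qed

end

section \<open>The matrices of a homogeneous line\<close>

text \<open>The type of matrices carries the componentwise product, so powers have to be iterated by hand.\<close>

primrec mpow :: "'a::comm_ring_1^2^2 \<Rightarrow> nat \<Rightarrow> 'a^2^2" where
  "mpow A 0 = mat 1"
| "mpow A (Suc n) = A ** mpow A n"

lemma mpow_mat_mult: "mpow (mat c ** A) n = mat (c ^ n) ** mpow A n"
proof (induction n)
  case (Suc n)
  have "mpow (mat c ** A) (Suc n) = mat c ** A ** (mat (c ^ n) ** mpow A n)" by (simp add: Suc)
  also have "\<dots> = mat (c ^ Suc n) ** mpow A (Suc n)" by (simp add: mat2_eq_iff algebra_simps)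
  finally show ?case .
qed simp

lemma mpow_in:
  assumes "mat 1 \<in> S" "\<And>B C. B \<in> S \<Longrightarrow> C \<in> S \<Longrightarrow> B ** C \<in> S" "A \<in> S"
  shows "mpow A n \<in> S"
  by (induction n) (use assms in auto)

text \<open>If conjugation by \<open>h\<close> exchanges \<open>d\<close> and \<open>d'\<close>, then so does every odd power of \<open>h\<close>.\<close>

lemma mpow_swap:
  assumes "h ** d = d' ** h" "h ** d' = d ** h"
  shows "mpow h n ** d = (if even n then d else d') ** mpow h n"
proof (induction n)
  case (Suc n)
  have "mpow h (Suc n) ** d = h ** (mpow h n ** d)" by (simp add: matrix_mul_assoc)
  also have "\<dots> = (h ** (if even n then d else d')) ** mpow h n" unfolding Suc by (simp add: matrix_mul_assoc)
  also have "\<dots> = (if even (Suc n) then d else d') ** mpow h (Suc n)"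
    using assms by (simp add: matrix_mul_assoc)
  finally show ?case .
qed simp

lemma matrix_cancel_right:
  fixes A :: "'a::field^2^2"
  assumes "det2 A \<noteq> 0" "B ** A = C ** A"
  shows "B = C"
  using assms(2) adj_inv[OF assms(1)] by (metis matrix_mul_assoc matrix_mul_rid)

lemma matrix_cancel_left:
  fixes A :: "'a::field^2^2"
  assumes "det2 A \<noteq> 0" "A ** B = A ** C"
  shows "B = C"
  using assms(2) adj_inv[OF assms(1)] by (metis matrix_mul_assoc matrix_mul_lid)

lemma mat_scale_nth: "(mat c ** A)$i$j = c * A$i$j" for A :: "'a::comm_ring_1^2^2"
  using exhaust_2[of i] by auto

lemma mat_cancel:
  fixes A B :: "'a::field^2^2"
  assumes "c \<noteq> 0" "mat c ** A = mat c ** B"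
  shows "A = B"
  by (rule matrix_cancel_left[of "mat c"]) (use assms in auto)

locale homogeneous = cubic_extension q \<zeta> for q :: nat and \<zeta> :: "'k::{field,finite}" +
  fixes L :: "('k^2) set"
  assumes L: "homogeneous_line L"
begin

lemma x_in_L: "x \<in> L" and zero_in_L: "0 \<in> L" and card_L: "card L > 2"
  and L_add: "a \<in> L \<Longrightarrow> b \<in> L \<Longrightarrow> a + b \<in> L"
  and L_orbit: "v \<in> L \<Longrightarrow> v \<noteq> 0 \<Longrightarrow> \<exists>B\<in>\<Gamma>. v = x v* B"
  and L_mult: "B \<in> \<Gamma> \<Longrightarrow> x v* B \<in> L \<Longrightarrow> v \<in> L \<Longrightarrow> v v* B \<in> L"
  using L unfolding homogeneous_line_def by blast+

lemma L_diff:
  assumes "a \<in> L" "b \<in> L"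
  shows "a - b \<in> L"
proof -
  have "(\<lambda>v. v + b) ` L = L"
    by (rule endo_inj_surj) (use L_add assms in \<open>auto simp: inj_on_def\<close>)
  then obtain v where "v \<in> L" "a = v + b" using assms by blast
  then show ?thesis by simp
qed

definition H :: "('k^2^2) set" where "H = {B \<in> \<Gamma>. x v* B \<in> L}"

lemma H_\<Gamma>: "h \<in> H \<Longrightarrow> h \<in> \<Gamma>" and H_L: "h \<in> H \<Longrightarrow> x v* h \<in> L"
  by (simp_all add: H_def del: vec2_mult)

lemma H_det: "h \<in> H \<Longrightarrow> det2 h \<noteq> 0"
  using \<Gamma>_det H_\<Gamma> by blast

lemma H_one: "mat 1 \<in> H"
  using mat_\<Gamma>[of 1] x_in_L by (simp add: H_def del: vec2_mult)

lemma H_mult: "g \<in> H \<Longrightarrow> h \<in> H \<Longrightarrow> g ** h \<in> H"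
  using L_mult[of h "x v* g"] \<Gamma>_mult[of g h] by (simp add: H_def vector_matrix_mul_assoc del: vec2_mult)

lemma H_inverse:
  assumes "h \<in> H"
  obtains h' where "h' \<in> H" "h' ** h = mat 1" "h ** h' = mat 1"
proof -
  have "(\<lambda>g. g ** h) ` H = H"
    by (rule endo_inj_surj)
      (use H_mult assms matrix_cancel_right[OF H_det[OF assms]] in \<open>auto simp: inj_on_def\<close>)
  then obtain h' where h': "h' \<in> H" "h' ** h = mat 1" using H_one by (metis imageE)
  have "(h ** h') ** h = mat 1 ** h" using h'(2) by (simp add: matrix_mul_assoc[symmetric])
  then have "h ** h' = mat 1" by (rule matrix_cancel_right[OF H_det[OF assms]])
  then show thesis using that h' by blast
qed

lemma L_eq: "v \<in> L \<Longrightarrow> v \<noteq> 0 \<Longrightarrow> \<exists>h\<in>H. v = x v* h"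
  using L_orbit[of v] by (auto simp: H_def simp del: vec2_mult)

lemma H_eigenvector: "h \<in> H \<Longrightarrow> x v* h = c *s x \<Longrightarrow> h = mat c"
  using \<Gamma>_eigenvector H_\<Gamma> by blast

text \<open>When \<open>H\<close> is commutative, addition in the line agrees with addition of matrices: \<open>1 + h - k\<close>
  annihilates \<open>x\<close> and \<open>xh\<close> as soon as it annihilates \<open>x\<close>.  Comparing the scalar factors of \<open>h\<close> and
  \<open>1 + h\<close> then forces the one of \<open>h\<close> into \<open>\<F>\<^sub>q\<close>.\<close>

lemma nonscalar_in_commutative_over_Fq:
  assumes comm: "\<And>g h. g \<in> H \<Longrightarrow> h \<in> H \<Longrightarrow> g ** h = h ** g"
    and h: "h \<in> H" "\<nexists>c. h = mat c"
  shows "h \<in> mats_over Fq"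
proof -
  have "x + x v* h \<noteq> 0"
  proof
    assume "x + x v* h = 0"
    then have "x v* h = (-1) *s x" by (metis eq_neg_iff_add_eq_0 add.commute vector_sneg_minus1)
    then show False using H_eigenvector[OF h(1)] h(2) by blast
  qed
  then obtain k where k: "k \<in> H" "x + x v* h = x v* k"
    using L_eq[OF L_add[OF x_in_L H_L[OF h(1)]]] by blast
  define M where "M = mat 1 + h - k"
  define y where "y = x v* h"
  have xM: "x v* M = 0"
    unfolding M_def using k(2)
    by (simp add: vector_matrix_mult_diff_rdistrib vector_matrix_mult_add_rdistrib del: vec2_mult)
  have "h ** M = M ** h" unfolding M_def using comm[OF h(1) k(1)]
    by (simp add: mat2_radd mat2_rdiff mat2_ladd mat2_ldiff)
  then have yM: "y v* M = 0"
    unfolding y_def vector_matrix_mul_assoc by (simp add: vector_matrix_mul_assoc[symmetric] xM del: vec2_mult)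
  have y: "y$2 - \<zeta> * y$1 \<noteq> 0"
  proof
    assume "y$2 - \<zeta> * y$1 = 0"
    then have "y = y$1 *s x" by (simp add: vec2_eq_iff algebra_simps)
    then show False using H_eigenvector[OF h(1)] h(2) unfolding y_def by blast
  qed
  have rows: "M$1$j = 0 \<and> M$2$j = 0" for j
  proof -
    have e1: "M$1$j + \<zeta> * M$2$j = 0" using arg_cong[OF xM, of "\<lambda>v. v$j"] by simp
    have e2: "y$1 * M$1$j + y$2 * M$2$j = 0" using arg_cong[OF yM, of "\<lambda>v. v$j"] by simp
    have "(y$2 - \<zeta> * y$1) * M$2$j = (y$1 * M$1$j + y$2 * M$2$j) - y$1 * (M$1$j + \<zeta> * M$2$j)"
      by (simp add: algebra_simps)
    then have "M$2$j = 0" using e1 e2 y by simp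
    then show ?thesis using e1 by simp
  qed
  then have "M = 0" by (simp add: mat2_eq_iff)
  then have k1: "k = mat 1 + h" by (simp add: M_def)
  obtain c A where A: "c \<noteq> 0" "A \<in> mats_over Fq" "det2 A \<noteq> 0" "h = mat c ** A"
    using H_\<Gamma>[OF h(1)] by (rule \<Gamma>E)
  obtain c' A' where A': "c' \<noteq> 0" "A' \<in> mats_over Fq" "det2 A' \<noteq> 0" "k = mat c' ** A'"
    using H_\<Gamma>[OF k(1)] by (rule \<Gamma>E)
  have nonscalar: "\<nexists>s. A = mat s"
    using h(2) A(4) mat_mult by metis
  have "mat (c * c') ** (A' ** A) = mat (c * c') ** (A ** A')"
    using comm[OF h(1) k(1)] unfolding A(4) A'(4) by (simp add: mat2_eq_iff algebra_simps)
  then have "A' ** A = A ** A'" by (rule mat_cancel[rotated]) (use A A' in simp)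
  then obtain a b where ab: "a \<in> Fq" "b \<in> Fq" "A' = mat a + mat b ** A"
    using commuting_matrix_span[OF Fq A(2) nonscalar A'(2)] by metis
  have "mat 1 + mat c ** A = mat c' ** (mat a + mat b ** A)"
    using k1 unfolding A'(4) A(4) ab(3) by simp
  also have "\<dots> = mat (c' * a) + mat (c' * b) ** A" by (simp add: mat2_eq_iff algebra_simps)
  finally have "mat 1 + mat c ** A = mat (c' * a) + mat (c' * b) ** A" .
  then have "1 = c' * a" "c = c' * b" using mat_plus_mat_eq_iff[OF nonscalar] by blast+
  then have "c = b / a" by (metis mult.commute nonzero_eq_divide_eq mult_cancel_left1 mult.assoc mult_zero_left zero_neq_one)
  then have "c \<in> Fq" using Fq ab by (simp add: subfield_divide)
  then show ?thesis unfolding A(4) using A Fq by (intro mats_over_mult mats_over_mat)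
qed

text \<open>A scalar in \<open>H\<close> is the quotient of two nonscalar elements of \<open>H\<close>, so the previous lemma applies.\<close>

lemma commutative_over_Fq:
  assumes comm: "\<And>g h. g \<in> H \<Longrightarrow> h \<in> H \<Longrightarrow> g ** h = h ** g"
    and k: "k \<in> H" "\<nexists>c. k = mat c"
  shows "H \<subseteq> mats_over Fq"
proof
  fix h assume h: "h \<in> H"
  show "h \<in> mats_over Fq"
  proof (cases "\<exists>c. h = mat c")
    case False
    then show ?thesis using nonscalar_in_commutative_over_Fq[OF comm h] by blast
  next
    case True
    then obtain c where c: "h = mat c" by blast
    have "c \<noteq> 0" using H_det[OF h] by (auto simp: c)
    have "\<nexists>s. h ** k = mat s"
    proof
      assume "\<exists>s. h ** k = mat s"
      then obtain s where "mat c ** k = mat s" using c by blast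
      then have "mat c ** k = mat c ** mat (s / c)" using \<open>c \<noteq> 0\<close> by (simp flip: mat_mult)
      then have "k = mat (s / c)" by (rule mat_cancel[OF \<open>c \<noteq> 0\<close>])
      then show False using k(2) by blast
    qed
    then have hk: "h ** k \<in> mats_over Fq" using nonscalar_in_commutative_over_Fq[OF comm H_mult[OF h k(1)]] by blast
    have kF: "k \<in> mats_over Fq" using nonscalar_in_commutative_over_Fq[OF comm k] .
    have "k \<noteq> mat 0" using k(2) by blast
    then obtain i j where ij: "k$i$j \<noteq> 0" by (auto simp: mat2_eq_iff)
    have "c * k$i$j \<in> Fq" "k$i$j \<in> Fq"
      using hk kF by (auto simp: mats_over_def c mat_scale_nth simp del: mat2_mult)
    then have "c * k$i$j / k$i$j \<in> Fq" using Fq by (intro subfield_divide)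
    then have "c \<in> Fq" using ij by simp
    then show ?thesis unfolding c by (rule mats_over_mat[OF Fq])
  qed
qed

text \<open>A vector \<open>xC\<close> in \<open>L\<close> equals \<open>xk\<close> with \<open>k = cA \<in> H\<close>, and then \<open>x\<close> is an eigenvector of \<open>CA\<^sup>-\<^sup>1\<close>, a
  matrix over \<open>\<F>\<^sub>q\<close>, which forces \<open>C = k\<close>.\<close>

lemma Fq_matrix_into_line:
  assumes C: "C \<in> mats_over Fq" "x v* C \<in> L"
  shows "C \<in> insert 0 (H \<inter> mats_over Fq)"
proof (cases "C = 0")
  case False
  have "x v* C \<noteq> 0"
  proof
    assume "x v* C = 0"
    then have "x v* C = 0 *s x" by simp
    then show False using x_eigenvector[OF C(1)] False by fastforce
  qed
  then obtain k where k: "k \<in> H" "x v* C = x v* k" using L_eq C by blast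
  obtain c A where A: "c \<noteq> 0" "A \<in> mats_over Fq" "det2 A \<noteq> 0" "k = mat c ** A"
    using H_\<Gamma>[OF k(1)] by (rule \<Gamma>E)
  have "x v* (C ** adj_inv A) = x v* (mat c ** A ** adj_inv A)"
    unfolding vector_matrix_mul_assoc[symmetric] k(2) A(4) ..
  also have "\<dots> = c *s x" using adj_inv[OF A(3)] by (simp add: matrix_mul_assoc[symmetric] vec_mult_mat del: vec2_mult)
  finally have "C ** adj_inv A = mat c"
    using x_eigenvector[OF mats_over_mult[OF Fq C(1) mats_over_adj_inv[OF Fq A(2)]]] by blast
  then have "C ** adj_inv A ** A = mat c ** A" by simp
  then have "C = k" using adj_inv[OF A(3)] by (simp add: A(4) matrix_mul_assoc[symmetric])
  then show ?thesis using k C by simp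
qed simp

text \<open>Closure under subtraction reduces to that of \<open>L\<close>, by the previous lemma.\<close>

lemma division_ring_over_Fq: "matrix_division_ring (insert 0 (H \<inter> mats_over Fq))" (is "matrix_division_ring ?D")
proof -
  have F: "M \<in> mats_over Fq" if "M \<in> ?D" for M
    using that mats_over_mat[OF Fq subfield_0[OF Fq]] by auto
  have xL: "x v* M \<in> L" if "M \<in> ?D" for M
    using that zero_in_L H_L by auto
  show ?thesis unfolding matrix_division_ring_def
  proof (intro conjI ballI impI)
    show "mat 1 \<in> ?D" using H_one mats_over_mat[OF Fq subfield_1[OF Fq]] by simp
    show "A - B \<in> ?D" if "A \<in> ?D" "B \<in> ?D" for A B
      using that by (intro Fq_matrix_into_line mats_over_diff[OF Fq])
        (simp_all add: F xL L_diff vector_matrix_mult_diff_rdistrib del: vec2_mult insert_iff)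
    show "A ** B \<in> ?D" if "A \<in> ?D" "B \<in> ?D" for A B
      using that H_mult mats_over_mult[OF Fq] by auto
    show "det2 A \<noteq> 0" if "A \<in> ?D" "A \<noteq> 0" for A using that H_det by blast
  qed
qed

lemma mpow_H: "h \<in> H \<Longrightarrow> mpow h n \<in> H"
  using mpow_in[of H] H_one H_mult by blast

lemma mpow_N_over_Fq:
  assumes "h \<in> H"
  shows "mpow h N \<in> H \<inter> mats_over Fq"
proof -
  obtain c A where A: "c \<noteq> 0" "A \<in> mats_over Fq" "h = mat c ** A"
    using H_\<Gamma>[OF assms] by (rule \<Gamma>E)
  have "mpow A N \<in> mats_over Fq"
    by (rule mpow_in) (use A(2) Fq mats_over_mult mats_over_mat subfield_1 in blast)+
  then have "mpow h N \<in> mats_over Fq"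
    unfolding A(3) mpow_mat_mult using Fq power_N_in_Fq by (intro mats_over_mult mats_over_mat)
  then show ?thesis using mpow_H[OF assms] by simp
qed

text \<open>Conjugation by \<open>h\<close> fixes \<open>d\<close> or sends it to the other root \<open>tr d - d\<close> of its characteristic
  polynomial.  The odd power \<open>h\<^sup>N\<close> lies in the commutative ring containing \<open>d\<close>, which excludes the
  latter.\<close>

lemma commutes_with_nonscalar:
  assumes d: "d \<in> H" "d \<in> mats_over Fq" and h: "h \<in> H"
  shows "h ** d = d ** h"
proof -
  let ?D = "insert 0 (H \<inter> mats_over Fq)"
  note comm = finite_matrix_division_ring_commutative[OF division_ring_over_Fq finite]
  note closed = matrix_division_ring_closed[OF division_ring_over_Fq]
  define t where "t = tr2 d"
  obtain h' where h': "h' \<in> H" "h' ** h = mat 1" "h ** h' = mat 1" using h by (rule H_inverse)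
  define d' where "d' = h ** d ** h'"
  have d'h: "d' ** h = h ** d" unfolding d'_def using h'(2) by (metis matrix_mul_assoc matrix_mul_rid)
  have "d' \<in> H" unfolding d'_def using H_mult h h'(1) d(1) by blast
  moreover have "d' \<in> mats_over Fq"
  proof -
    obtain c A where A: "c \<noteq> 0" "A \<in> mats_over Fq" "det2 A \<noteq> 0" "h = mat c ** A"
      using H_\<Gamma>[OF h] by (rule \<Gamma>E)
    have "mat c ** (d' ** A) = mat c ** (A ** d)"
      using d'h unfolding A(4) by (simp add: mat2_eq_iff algebra_simps)
    then have "d' ** A = A ** d" by (rule mat_cancel[OF A(1)])
    then have "d' = A ** d ** adj_inv A" using adj_inv[OF A(3)] by (metis matrix_mul_assoc matrix_mul_rid)
    then show ?thesis using A(2) d(2) Fq by (simp add: mats_over_mult mats_over_adj_inv)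
  qed
  ultimately have d'D: "d' \<in> ?D" by simp
  have dD: "d \<in> ?D" using d by simp
  have dd': "d ** d' = d' ** d" using comm[OF d'D dD] .
  have trace: "tr2 d' = t"
  proof -
    have cyc: "tr2 (P ** Q) = tr2 (Q ** P)" for P Q :: "'k^2^2" by (simp add: algebra_simps)
    have "tr2 d' = tr2 (h' ** (h ** d))" unfolding d'_def by (rule cyc)
    then show ?thesis using h'(2) by (simp add: matrix_mul_assoc t_def)
  qed
  have det: "det2 d' = det2 d"
  proof -
    have "det2 d' * det2 h = det2 h * det2 d" unfolding det2_mult[symmetric] d'h ..
    then show ?thesis using H_det[OF h] by simp
  qed
  have "(d' - d) ** (d' + d - mat t) = (d' ** d' - mat t ** d') - (d ** d - mat t ** d) + (d' ** d - d ** d')"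
    by (simp add: mat2_eq_iff algebra_simps)
  also have "\<dots> = 0"
    using cayley_hamilton2[of d] cayley_hamilton2[of d'] dd' unfolding trace det t_def[symmetric] by simp
  finally have prod: "(d' - d) ** (d' + d - mat t) = 0" .
  show ?thesis
  proof (cases "d' = d")
    case True
    then show ?thesis using d'h by simp
  next
    case False
    then have "det2 (d' - d) \<noteq> 0" using closed(5)[OF closed(3)[OF d'D dD]] by simp
    then have "d' + d - mat t = 0" using prod matrix_cancel_left[of "d' - d" "d' + d - mat t" 0] by simp
    then have d'_eq: "d' = mat t - d" by (simp add: eq_diff_eq)
    have "h ** (mat t - d) = d ** h"
      using d'h unfolding d'_eq by (simp add: mat2_eq_iff algebra_simps)
    then have "mpow h N ** d = d' ** mpow h N"
      using mpow_swap[of h d d' N] d'h odd_N d'_eq by simp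
    moreover have "mpow h N ** d = d ** mpow h N"
      using comm[of d "mpow h N"] mpow_N_over_Fq[OF h] dD by simp
    ultimately have "d' = d"
      using matrix_cancel_right[OF H_det[OF mpow_H[OF h]]] by metis
    then show ?thesis using False by simp
  qed
qed

text \<open>If instead all matrices of \<open>H\<close> over \<open>\<F>\<^sub>q\<close> are scalar, then so are the commutators, and by taking
  determinants they are \<open>1\<close> or \<open>-1\<close>; again \<open>h\<^sup>N\<close> excludes the sign.\<close>

lemma commute_if_scalars:
  assumes scalar: "\<And>d. d \<in> H \<Longrightarrow> d \<in> mats_over Fq \<Longrightarrow> \<exists>c. d = mat c"
    and g: "g \<in> H" and h: "h \<in> H"
  shows "g ** h = h ** g"
proof -
  obtain k' where k': "k' \<in> H" "k' ** (h ** g) = mat 1" using H_inverse[OF H_mult[OF h g]] by metis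
  define k where "k = g ** h ** k'"
  have k: "k ** (h ** g) = g ** h" unfolding k_def using k'(2) by (metis matrix_mul_assoc matrix_mul_rid)
  have "k \<in> H" unfolding k_def using H_mult g h k'(1) by blast
  moreover have "k \<in> mats_over Fq"
  proof -
    obtain c A where A: "c \<noteq> 0" "A \<in> mats_over Fq" "det2 A \<noteq> 0" "g = mat c ** A"
      using H_\<Gamma>[OF g] by (rule \<Gamma>E)
    obtain b B where B: "b \<noteq> 0" "B \<in> mats_over Fq" "det2 B \<noteq> 0" "h = mat b ** B"
      using H_\<Gamma>[OF h] by (rule \<Gamma>E)
    have "mat (b * c) ** (k ** (B ** A)) = mat (b * c) ** (A ** B)"
      using k unfolding A(4) B(4) by (simp add: mat2_eq_iff algebra_simps)
    then have kBA: "k ** (B ** A) = A ** B" by (rule mat_cancel[rotated]) (use A B in simp)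
    have "det2 (B ** A) \<noteq> 0" unfolding det2_mult using A B by simp
    then have "k = A ** B ** adj_inv (B ** A)" using kBA adj_inv by (metis matrix_mul_assoc matrix_mul_rid)
    then show ?thesis using A(2) B(2) Fq by (simp add: mats_over_mult mats_over_adj_inv)
  qed
  ultimately obtain s where s: "k = mat s" using scalar by blast
  have "det2 k * (det2 h * det2 g) = det2 g * det2 h"
    unfolding det2_mult[symmetric] k ..
  then have "det2 k = 1" using H_det[OF g] H_det[OF h] by (simp add: mult.commute)
  then have "(s - 1) * (s + 1) = 0" by (simp add: s algebra_simps)
  then consider "s = 1" | "s = -1" by (auto simp: add_eq_0_iff2)
  then show ?thesis
  proof cases
    case 1
    then show ?thesis using k s by simp
  next
    case 2
    have gh: "g ** h = (- h) ** g" using k unfolding s 2 by (simp add: mat2_eq_iff)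
    have "g ** (- h) = h ** g"
    proof -
      have "g ** (- h) = - (g ** h)" by (simp add: mat2_eq_iff)
      also have "\<dots> = h ** g" unfolding gh by (simp add: mat2_eq_iff)
      finally show ?thesis .
    qed
    then have "mpow g N ** h = (- h) ** mpow g N" using mpow_swap[of g h "- h" N] gh odd_N by simp
    moreover obtain r where r: "mpow g N = mat r" using scalar mpow_N_over_Fq[OF g] by blast
    ultimately have "h ** mpow g N = (- h) ** mpow g N" using mat_commute[of r h] by simp
    then have "h = - h" by (rule matrix_cancel_right[OF H_det[OF mpow_H[OF g]]])
    then show ?thesis using gh by metis
  qed
qed

lemma nonscalar_over_Fq:
  assumes k: "k \<in> H" "\<nexists>c. k = mat c"
  shows "H \<subseteq> mats_over Fq"
proof (rule commutative_over_Fq[OF _ k])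
  fix g h assume gh: "g \<in> H" "h \<in> H"
  show "g ** h = h ** g"
  proof (cases "\<exists>d\<in>H. d \<in> mats_over Fq \<and> (\<nexists>c. d = mat c)")
    case False
    then show ?thesis using commute_if_scalars gh by blast
  next
    case True
    then obtain d where d: "d \<in> H" "d \<in> mats_over Fq" "\<nexists>c. d = mat c" by blast
    note span = commuting_matrix_span[OF is_subfield_UNIV mats_over_UNIV d(3) mats_over_UNIV]
    obtain a b where g: "g = mat a + mat b ** d" using span[OF commutes_with_nonscalar[OF d(1,2) gh(1)]] by metis
    obtain a' b' where h: "h = mat a' + mat b' ** d" using span[OF commutes_with_nonscalar[OF d(1,2) gh(2)]] by metis
    show ?thesis unfolding g h by (simp add: mat2_eq_iff algebra_simps)
  qed
qed

end

proposition (in cubic_extension) homogeneous_line_cases: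
  assumes "homogeneous_line L"
  obtains F where "is_subfield F" "card F > 2" "L = {c *s x | c. c \<in> F}"
  | D d where "matrix_division_ring D" "D \<subseteq> mats_over Fq" "d \<in> D" "\<nexists>c. d = mat c"
      "L = {x v* M | M. M \<in> D}"
proof -
  interpret homogeneous q \<zeta> L by unfold_locales (fact assms)
  show thesis
  proof (cases "\<exists>k\<in>H. \<nexists>c. k = mat c")
    case True
    then obtain k where k: "k \<in> H" "\<nexists>c. k = mat c" by blast
    have HF: "H \<subseteq> mats_over Fq" by (rule nonscalar_over_Fq[OF k])
    show thesis
    proof (rule that(2)[OF division_ring_over_Fq _ _ k(2)])
      show "insert 0 (H \<inter> mats_over Fq) \<subseteq> mats_over Fq"
        using mats_over_mat[OF Fq subfield_0[OF Fq]] by auto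
      show "k \<in> insert 0 (H \<inter> mats_over Fq)" using k HF by blast
      have "v \<in> {x v* M | M. M \<in> insert 0 (H \<inter> mats_over Fq)}" if vL: "v \<in> L" for v
      proof (cases "v = 0")
        case True
        then have "v = x v* 0" by simp
        then show ?thesis by blast
      next
        case False
        then obtain h where "h \<in> H" "v = x v* h" using L_eq[OF vL] by blast
        then show ?thesis using HF by blast
      qed
      moreover have "x v* M \<in> L" if "M \<in> insert 0 (H \<inter> mats_over Fq)" for M
        using that zero_in_L H_L[of M] by (cases "M = 0") auto
      ultimately show "L = {x v* M | M. M \<in> insert 0 (H \<inter> mats_over Fq)}" by blast
    qed
  next
    case False
    define F where "F = {c. c *s x \<in> L}"
    have F_H: "mat c \<in> H" if "c \<in> F" "c \<noteq> 0" for c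
      using that mat_\<Gamma>[of c] by (simp add: F_def H_def vec_mult_mat del: vec2_mult)
    have LF: "L = {c *s x | c. c \<in> F}"
    proof -
      have "v \<in> {c *s x | c. c \<in> F}" if vL: "v \<in> L" for v
      proof (cases "v = 0")
        case True
        then have "v = 0 *s x" by simp
        then show ?thesis using vL unfolding F_def by blast
      next
        case nz: False
        then obtain h where h: "h \<in> H" "v = x v* h" using L_eq[OF vL] by blast
        then obtain c where "h = mat c" using False by blast
        then have "v = c *s x" using h(2) by (simp add: vec_mult_mat del: vec2_mult)
        then show ?thesis using vL unfolding F_def by blast
      qed
      then show ?thesis unfolding F_def by blast
    qed
    have "is_subfield F"
    proof (rule finite_subfieldI)
      show "1 \<in> F" using x_in_L by (simp add: F_def)
      show "a - b \<in> F" if "a \<in> F" "b \<in> F" for a b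
        using that L_diff by (simp add: F_def vector_sub_rdistrib)
      show "a * b \<in> F" if ab: "a \<in> F" "b \<in> F" for a b
      proof (cases "a = 0 \<or> b = 0")
        case True
        then show ?thesis using zero_in_L by (auto simp: F_def)
      next
        case False
        then have "x v* mat (a * b) \<in> L" using F_H ab H_mult H_L unfolding mat_mult by blast
        then show ?thesis by (simp add: F_def vec_mult_mat del: vec2_mult)
      qed
    qed simp
    moreover have "card L \<le> card F"
    proof -
      have "L = (\<lambda>c. c *s x) ` F" using LF by blast
      then show ?thesis by (simp add: card_image_le)
    qed
    then have "card F > 2" using card_L by simp
    ultimately show thesis using LF by (rule that(1))
  qed
qed

section \<open>Fields of matrices\<close>

text \<open>All three families have this form; what distinguishes them is the embedding of the field into the
  ring of matrices.\<close>

lemma field_image_division_ring: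
  fixes F :: "'b::field set" and \<phi> :: "'b \<Rightarrow> 'a::field^2^2"
  assumes F: "is_subfield F"
    and one: "\<phi> 1 = mat 1"
    and diff: "\<And>a b. a \<in> F \<Longrightarrow> b \<in> F \<Longrightarrow> \<phi> (a - b) = \<phi> a - \<phi> b"
    and mult: "\<And>a b. a \<in> F \<Longrightarrow> b \<in> F \<Longrightarrow> \<phi> (a * b) = \<phi> a ** \<phi> b"
  shows "matrix_division_ring (\<phi> ` F)" "card (\<phi> ` F) = card F"
proof -
  have zero: "\<phi> 0 = 0" using diff[of 1 1] subfield_1[OF F] by simp
  have det: "det2 (\<phi> c) \<noteq> 0" if "c \<in> F" "c \<noteq> 0" for c
  proof -
    have "\<phi> c ** \<phi> (inverse c) = mat 1"
      using mult[of c "inverse c"] one that subfield_inverse[OF F] by simp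
    then show ?thesis using det2_nonzero_iff by blast
  qed
  show "matrix_division_ring (\<phi> ` F)"
    unfolding matrix_division_ring_def
  proof (intro conjI ballI impI)
    show "mat 1 \<in> \<phi> ` F" using one subfield_1[OF F] by (metis imageI)
    fix A assume A: "A \<in> \<phi> ` F"
    show "det2 A \<noteq> 0" if "A \<noteq> 0" using A that det zero by blast
    fix B assume B: "B \<in> \<phi> ` F"
    obtain a b where "a \<in> F" "b \<in> F" "A = \<phi> a" "B = \<phi> b" using A B by blast
    then show "A - B \<in> \<phi> ` F" "A ** B \<in> \<phi> ` F"
      using diff mult subfield_diff[OF F] subfield_mult[OF F] by (metis imageI)+
  qed
  have "inj_on \<phi> F"
  proof (rule inj_onI)
    fix a b assume ab: "a \<in> F" "b \<in> F" "\<phi> a = \<phi> b"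
    then have "\<phi> (a - b) = 0" using diff by simp
    then show "a = b" using det[OF subfield_diff[OF F ab(1,2)]] by auto
  qed
  then show "card (\<phi> ` F) = card F" by (rule card_image)
qed

lemma mat_conj_add: "mat_conj (A + B) g = mat_conj A g + mat_conj B g"
  and mat_conj_diff: "mat_conj (A - B) g = mat_conj A g - mat_conj B g"
  by (simp_all add: mat_conj_def mat2_radd mat2_ladd mat2_rdiff mat2_ldiff)

lemma mat_conj_mult:
  assumes "det2 g \<noteq> 0"
  shows "mat_conj (A ** B) g = mat_conj A g ** mat_conj B g"
  unfolding mat_conj_def using matrix_inv2[OF assms] by (metis matrix_mul_assoc matrix_mul_rid)

lemma mat_conj_mat:
  assumes "det2 g \<noteq> 0"
  shows "mat_conj (mat c) g = mat c"
  unfolding mat_conj_def mat_commute[symmetric] matrix_mul_assoc[symmetric]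
  using matrix_inv2[OF assms] by simp

lemma mat_conj_eqI:
  assumes "det2 g \<noteq> 0" "g ** B = A ** g"
  shows "mat_conj A g = B"
  unfolding mat_conj_def matrix_mul_assoc[symmetric] assms(2)[symmetric]
  using matrix_inv2[OF assms(1)] by (simp add: matrix_mul_assoc)

lemma mat_conj_over:
  assumes "is_subfield S" "g \<in> GL2_over S" "A \<in> mats_over S"
  shows "mat_conj A g \<in> mats_over S"
proof -
  have g: "g \<in> mats_over S" "det2 g \<noteq> 0" using assms(2) by (simp_all add: GL2_over_iff[OF assms(1)])
  have "adj_inv g = matrix_inv g"
    by (rule matrix_cancel_left[OF g(2)]) (use adj_inv[OF g(2)] matrix_inv2[OF g(2)] in simp)
  then show ?thesis unfolding mat_conj_def
    using mats_over_adj_inv[OF assms(1) g(1)] g(1) assms mats_over_mult[OF assms(1)] by metis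
qed

section \<open>Automorphisms and endomorphism matrices\<close>

lemma field_Aut_iff:
  fixes F :: "'a::field set"
  shows "\<tau> \<in> field_Aut F \<longleftrightarrow> bij_betw \<tau> F F \<and> \<tau> 1 = 1 \<and>
    (\<forall>a\<in>F. \<forall>b\<in>F. \<tau> (a * b) = \<tau> a * \<tau> b \<and> \<tau> (a + b) = \<tau> a + \<tau> b)"
  unfolding field_Aut_def ring_iso_def ring_hom_def
  by (auto simp: ring_of_type_algebra_def bij_betw_def)

lemma Span2_eq:
  fixes E :: "'a::field set"
  shows "ring.Span ring_of_type_algebra E [b1, b2] = {k1 * b1 + k2 * b2 | k1 k2. k1 \<in> E \<and> k2 \<in> E}"
    and "ring.Span ring_of_type_algebra E [b2] = {k * b2 | k. k \<in> E}"
    and "ring.Span ring_of_type_algebra E [] = {0}"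
proof -
  interpret R: ring "ring_of_type_algebra :: 'a ring" by (rule ring_from_type_algebra)
  have z: "\<zero>\<^bsub>ring_of_type_algebra\<^esub> = (0::'a)" by (simp add: ring_of_type_algebra_def)
  show 0: "R.Span E [] = {0}" by (simp add: z)
  have ext: "R.line_extension E b W = {k * b + w | k w. k \<in> E \<and> w \<in> W}" for b W
    unfolding R.line_extension_def r_coset_def set_add_def set_mult_def
    by (auto simp: ring_of_type_algebra_def)
  show 1: "R.Span E [b2] = {k * b2 | k. k \<in> E}"
    using 0 by (simp add: ext)
  have "R.Span E [b1, b2] = R.line_extension E b1 (R.Span E [b2])" by simp
  also have "\<dots> = {k1 * b1 + k2 * b2 | k1 k2. k1 \<in> E \<and> k2 \<in> E}" unfolding 1 ext by blast
  finally show "R.Span E [b1, b2] = {k1 * b1 + k2 * b2 | k1 k2. k1 \<in> E \<and> k2 \<in> E}" .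
qed

lemma independent2_iff:
  fixes E :: "'a::field set"
  shows "ring.independent ring_of_type_algebra E [b1, b2] \<longleftrightarrow> b2 \<noteq> 0 \<and> (\<forall>k\<in>E. b1 \<noteq> k * b2)"
proof -
  interpret R: ring "ring_of_type_algebra :: 'a ring" by (rule ring_from_type_algebra)
  have carr: "b \<in> carrier ring_of_type_algebra" for b :: 'a by (simp add: ring_of_type_algebra_def)
  have step: "R.independent E (b # bs) \<longleftrightarrow> b \<notin> R.Span E bs \<and> R.independent E bs" for b bs
    by (metis R.independent.simps carr list.distinct(1) list.inject)
  show ?thesis unfolding step Span2_eq by auto
qed

lemma is_basis2_iff:
  "is_basis2 E F b1 b2 \<longleftrightarrow> b2 \<noteq> 0 \<and> (\<forall>k\<in>E. b1 \<noteq> k * b2) \<and>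
     F = {k1 * b1 + k2 * b2 | k1 k2. k1 \<in> E \<and> k2 \<in> E}"
  unfolding is_basis2_def independent2_iff Span2_eq by blast

lemma is_basis2_dimension:
  fixes E :: "'a::field set"
  assumes "is_basis2 E F b1 b2"
  shows "ring.dimension ring_of_type_algebra 2 E F"
proof -
  interpret R: ring "ring_of_type_algebra :: 'a ring" by (rule ring_from_type_algebra)
  have "R.dimension (length [b1, b2]) E (R.Span E [b1, b2])"
    by (rule R.dimension_independent) (use assms in \<open>simp add: is_basis2_def\<close>)
  then show ?thesis using assms by (simp add: is_basis2_def numeral_2_eq_2)
qed

context
  fixes E F :: "'a::field set" and b1 b2 :: 'a
  assumes E: "is_subfield E" and basis: "is_basis2 E F b1 b2"
begin

lemma basis2_unique:
  assumes "k1 \<in> E" "k2 \<in> E" "m1 \<in> E" "m2 \<in> E"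
  shows "k1 * b1 + k2 * b2 = m1 * b1 + m2 * b2 \<longleftrightarrow> k1 = m1 \<and> k2 = m2"
proof
  assume eq: "k1 * b1 + k2 * b2 = m1 * b1 + m2 * b2"
  have b: "b2 \<noteq> 0" "\<And>k. k \<in> E \<Longrightarrow> b1 \<noteq> k * b2" using basis by (auto simp: is_basis2_iff)
  have "k1 = m1"
  proof (rule ccontr)
    assume "k1 \<noteq> m1"
    then have "b1 = ((m2 - k2) / (k1 - m1)) * b2" using eq by (simp add: field_simps)
    moreover have "(m2 - k2) / (k1 - m1) \<in> E" using E assms by (intro subfield_divide subfield_diff)
    ultimately show False using b(2) by blast
  qed
  then show "k1 = m1 \<and> k2 = m2" using eq b(1) by simp
qed simp

lemma endo_matrix_eqI:
  assumes M: "M \<in> mats_over E"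
    and c: "c * b1 = M$1$1 * b1 + M$1$2 * b2" "c * b2 = M$2$1 * b1 + M$2$2 * b2"
  shows "endo_matrix E b1 b2 (\<lambda>v. c * v) = M"
  unfolding endo_matrix_def
proof (rule the_equality)
  have ME: "M$1$1 \<in> E" "M$1$2 \<in> E" "M$2$1 \<in> E" "M$2$2 \<in> E" using M by (simp_all add: mats_over_iff)
  show "M \<in> mats_over E \<and> (\<forall>l1\<in>E. \<forall>l2\<in>E. \<forall>m1\<in>E. \<forall>m2\<in>E.
        vector [l1, l2] v* M = (vector [m1, m2] :: 'a^2) \<longleftrightarrow>
        c * (l1 * b1 + l2 * b2) = m1 * b1 + m2 * b2)"
  proof (intro conjI M ballI)
    fix l1 l2 m1 m2 assume lm: "l1 \<in> E" "l2 \<in> E" "m1 \<in> E" "m2 \<in> E"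
    have "c * (l1 * b1 + l2 * b2) = l1 * (c * b1) + l2 * (c * b2)" by (simp add: algebra_simps)
    also have "\<dots> = (l1 * M$1$1 + l2 * M$2$1) * b1 + (l1 * M$1$2 + l2 * M$2$2) * b2"
      unfolding c by (simp add: algebra_simps)
    finally have "c * (l1 * b1 + l2 * b2) = m1 * b1 + m2 * b2 \<longleftrightarrow>
        l1 * M$1$1 + l2 * M$2$1 = m1 \<and> l1 * M$1$2 + l2 * M$2$2 = m2"
      using basis2_unique E lm ME by (simp add: subfield_add subfield_mult)
    then show "vector [l1, l2] v* M = (vector [m1, m2] :: 'a^2) \<longleftrightarrow>
        c * (l1 * b1 + l2 * b2) = m1 * b1 + m2 * b2"
      by (simp add: vec2_eq_iff)
  qed
  fix M' assume M': "M' \<in> mats_over E \<and> (\<forall>l1\<in>E. \<forall>l2\<in>E. \<forall>m1\<in>E. \<forall>m2\<in>E.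
        vector [l1, l2] v* M' = (vector [m1, m2] :: 'a^2) \<longleftrightarrow>
        c * (l1 * b1 + l2 * b2) = m1 * b1 + m2 * b2)"
  have P: "vector [l1, l2] v* M' = (vector [m1, m2] :: 'a^2)"
    if "l1 \<in> E" "l2 \<in> E" "m1 \<in> E" "m2 \<in> E" "c * (l1 * b1 + l2 * b2) = m1 * b1 + m2 * b2" for l1 l2 m1 m2
    using M' that by blast
  have "vector [1, 0] v* M' = (vector [M$1$1, M$1$2] :: 'a^2)"
    "vector [0, 1] v* M' = (vector [M$2$1, M$2$2] :: 'a^2)"
    by (rule P; use E ME c in \<open>simp add: subfield_0 subfield_1\<close>)+
  then show "M' = M" by (simp add: vec2_eq_iff mat2_eq_iff)
qed

lemma endo_matrix_exists:
  assumes F: "is_subfield F" and c: "c \<in> F"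
  obtains M where "M \<in> mats_over E" "c * b1 = M$1$1 * b1 + M$1$2 * b2"
    "c * b2 = M$2$1 * b1 + M$2$2 * b2" "endo_matrix E b1 b2 (\<lambda>v. c * v) = M"
proof -
  have F_eq: "F = {k1 * b1 + k2 * b2 | k1 k2. k1 \<in> E \<and> k2 \<in> E}"
    using basis by (simp add: is_basis2_iff)
  have "b1 = 1 * b1 + 0 * b2" "b2 = 0 * b1 + 1 * b2" by simp_all
  then have "b1 \<in> F" "b2 \<in> F" unfolding F_eq using subfield_0[OF E] subfield_1[OF E] by blast+
  then have "c * b1 \<in> F" "c * b2 \<in> F" using F c by (auto intro: subfield_mult)
  then obtain k1 k2 k3 k4 where k: "k1 \<in> E" "k2 \<in> E" "k3 \<in> E" "k4 \<in> E"
    "c * b1 = k1 * b1 + k2 * b2" "c * b2 = k3 * b1 + k4 * b2" unfolding F_eq by blast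
  define M :: "'a^2^2" where "M = vector [vector [k1, k2], vector [k3, k4]]"
  have M: "M \<in> mats_over E" "c * b1 = M$1$1 * b1 + M$1$2 * b2" "c * b2 = M$2$1 * b1 + M$2$2 * b2"
    using k by (simp_all add: M_def mats_over_iff)
  show thesis by (rule that[OF M endo_matrix_eqI[OF M]])
qed

text \<open>The matrices act on row vectors, so composing endomorphisms reverses the product; multiplications
  in a field commute, so the order is immaterial here.\<close>

lemma endo_matrix_hom:
  assumes F: "is_subfield F" and a: "a \<in> F" and b: "b \<in> F"
  shows "endo_matrix E b1 b2 (\<lambda>v. (a - b) * v) =
      endo_matrix E b1 b2 (\<lambda>v. a * v) - endo_matrix E b1 b2 (\<lambda>v. b * v)"
    and "endo_matrix E b1 b2 (\<lambda>v. (a * b) * v) =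
      endo_matrix E b1 b2 (\<lambda>v. a * v) ** endo_matrix E b1 b2 (\<lambda>v. b * v)"
proof -
  obtain A where A: "A \<in> mats_over E" "a * b1 = A$1$1 * b1 + A$1$2 * b2"
    "a * b2 = A$2$1 * b1 + A$2$2 * b2" "endo_matrix E b1 b2 (\<lambda>v. a * v) = A"
    using endo_matrix_exists[OF F a] .
  obtain B where B: "B \<in> mats_over E" "b * b1 = B$1$1 * b1 + B$1$2 * b2"
    "b * b2 = B$2$1 * b1 + B$2$2 * b2" "endo_matrix E b1 b2 (\<lambda>v. b * v) = B"
    using endo_matrix_exists[OF F b] .
  show "endo_matrix E b1 b2 (\<lambda>v. (a - b) * v) =
      endo_matrix E b1 b2 (\<lambda>v. a * v) - endo_matrix E b1 b2 (\<lambda>v. b * v)"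
    unfolding A(4) B(4)
    by (rule endo_matrix_eqI) (use mats_over_diff[OF E] A B in \<open>simp_all add: left_diff_distrib\<close>)
  show "endo_matrix E b1 b2 (\<lambda>v. (a * b) * v) =
      endo_matrix E b1 b2 (\<lambda>v. a * v) ** endo_matrix E b1 b2 (\<lambda>v. b * v)"
    unfolding A(4) B(4)
  proof (rule endo_matrix_eqI)
    have *: "(a * b) * v = k1 * (b * b1) + k2 * (b * b2)" if "a * v = k1 * b1 + k2 * b2" for v k1 k2
    proof -
      have "(a * b) * v = b * (a * v)" by simp
      then show ?thesis unfolding that by (simp add: algebra_simps)
    qed
    show "(a * b) * b1 = (A ** B)$1$1 * b1 + (A ** B)$1$2 * b2"
      unfolding *[OF A(2)] B(2,3) by (simp add: algebra_simps)
    show "(a * b) * b2 = (A ** B)$2$1 * b1 + (A ** B)$2$2 * b2"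
      unfolding *[OF A(3)] B(2,3) by (simp add: algebra_simps)
  qed (use mats_over_mult[OF E] A B in blast)
qed

lemma endo_matrix_one: "endo_matrix E b1 b2 (\<lambda>v. 1 * v) = mat 1"
  by (rule endo_matrix_eqI) (use E in \<open>simp_all add: mats_over_mat subfield_1\<close>)

lemma basis2_card:
  assumes "finite F"
  shows "card F > 2"
proof -
  have b: "b2 \<noteq> 0" "\<And>k. k \<in> E \<Longrightarrow> b1 \<noteq> k * b2"
    and F: "F = {k1 * b1 + k2 * b2 | k1 k2. k1 \<in> E \<and> k2 \<in> E}"
    using basis by (auto simp: is_basis2_iff)
  have "b1 \<noteq> 0" "b1 \<noteq> b2" using b(2)[of 0] b(2)[of 1] E by (simp_all add: subfield_0 subfield_1)
  moreover have "0 = 0 * b1 + 0 * b2" "b1 = 1 * b1 + 0 * b2" "b2 = 0 * b1 + 1 * b2" by simp_all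
  then have "{0, b1, b2} \<subseteq> F" unfolding F using subfield_0[OF E] subfield_1[OF E] by blast
  then have "card {0, b1, b2} \<le> card F" by (rule card_mono[OF assms])
  ultimately show ?thesis using b(1) by simp
qed

end

lemma to_ac_mat_of_ac:
  assumes "M \<in> mats_over (to_ac ` S)"
  shows "to_ac (mat_of_ac M $ i $ j) = M $ i $ j" "mat_of_ac M \<in> mats_over S"
proof -
  have M: "M $ i $ j \<in> to_ac ` S" for i j using assms by (simp add: mats_over_def)
  have "to_ac (mat_of_ac M $ i $ j) = M $ i $ j" for i j
    unfolding mat_of_ac_def using M[of i j] by (simp add: f_inv_into_f image_iff) (metis f_inv_into_f rangeI)
  then show "to_ac (mat_of_ac M $ i $ j) = M $ i $ j" by simp
  have "mat_of_ac M $ i $ j \<in> S" for i j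
    using M[of i j] \<open>\<And>j i. to_ac (mat_of_ac M $ i $ j) = M $ i $ j\<close>[of i j] by (metis imageE to_ac_eq_iff)
  then show "mat_of_ac M \<in> mats_over S" by (simp add: mats_over_def)
qed

lemma mat_of_ac_eqI:
  assumes "\<And>i j. to_ac (M' $ i $ j) = M $ i $ j"
  shows "mat_of_ac M = M'"
  unfolding mat_of_ac_def vec_eq_iff by (simp add: assms[symmetric] inv_f_f[OF inj_to_ac])

lemma is_subfield_to_ac: "is_subfield S \<Longrightarrow> is_subfield (to_ac ` S)"
  unfolding is_subfield_iff
  by (auto simp flip: to_ac_diff to_ac_mult to_ac_inverse simp: image_iff)

lemma is_subfield_Int: "is_subfield S \<Longrightarrow> is_subfield T \<Longrightarrow> is_subfield (S \<inter> T)"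
  unfolding is_subfield_iff by blast

section \<open>The three families\<close>

context cubic_extension
begin

lemma matrices_over_Fq_\<Gamma>:
  assumes "matrix_division_ring D" "D \<subseteq> mats_over Fq"
  shows "D \<subseteq> insert 0 \<Gamma>"
  using assms matrix_division_ring_closed(5) GL_\<Gamma> by blast

lemma line_i_pls:
  assumes "line_i x L"
  shows "G_affine (affine_G q) (line_orbit (affine_G q) L) \<and>
    proper_pls UNIV (line_orbit (affine_G q) L) \<and> collinear_pts (line_orbit (affine_G q) L) 0 x"
proof -
  obtain F where F: "is_subfield F" "card F > 2" "L = {c *s x | c. c \<in> F}"
    using assms by (auto simp: line_i_def)
  note D = field_image_division_ring[OF F(1), of "mat :: 'k \<Rightarrow> 'k^2^2", OF _ mat_diff mat_mult]
  show ?thesis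
  proof (rule matrix_division_ring_pls)
    show "matrix_division_ring (mat ` F :: ('k^2^2) set)" by (rule D) simp
    show "mat ` F \<subseteq> insert 0 \<Gamma>"
    proof clarify
      fix c assume "mat c \<notin> \<Gamma>"
      then have "c = 0" using mat_\<Gamma> by blast
      then show "mat c = 0" by simp
    qed
    show "card (mat ` F :: ('k^2^2) set) > 2" using D F(2) by simp
    show "L = {x v* M |M. M \<in> mat ` F}" unfolding F(3) vec_mult_mat[symmetric] by blast
  qed
qed

lemma line_ii_pls:
  assumes "line_ii q x L"
  shows "G_affine (affine_G q) (line_orbit (affine_G q) L) \<and>
    proper_pls UNIV (line_orbit (affine_G q) L) \<and> collinear_pts (line_orbit (affine_G q) L) 0 x"
proof -
  obtain F \<tau> g c1 where F: "is_subfield F" "F \<subseteq> Fq" "\<tau> \<in> field_Aut F" "c1 \<in> F" "\<tau> c1 \<noteq> c1"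
    "g \<in> GL2_over Fq" and L: "L = {x v* mat_conj (diag2 c (\<tau> c)) g | c. c \<in> F}"
    using assms by (auto simp: line_ii_def simp del: vec2_mult)
  have g: "det2 g \<noteq> 0" using F(6) by (simp add: GL2_over_iff[OF Fq])
  have \<tau>: "bij_betw \<tau> F F" "\<tau> 1 = 1" and \<tau>_mult: "\<And>a b. a \<in> F \<Longrightarrow> b \<in> F \<Longrightarrow> \<tau> (a * b) = \<tau> a * \<tau> b"
    and \<tau>_add: "\<And>a b. a \<in> F \<Longrightarrow> b \<in> F \<Longrightarrow> \<tau> (a + b) = \<tau> a + \<tau> b"
    using F(3) by (auto simp: field_Aut_iff)
  have \<tau>F: "\<tau> a \<in> F" if "a \<in> F" for a using \<tau>(1) that by (metis bij_betwE)
  have \<tau>_diff: "\<tau> (a - b) = \<tau> a - \<tau> b" if "a \<in> F" "b \<in> F" for a b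
    using \<tau>_add[OF subfield_diff[OF F(1) that] that(2)] by (simp add: eq_diff_eq)
  have \<tau>0: "\<tau> 0 = 0" using \<tau>_diff[of 1 1] subfield_1[OF F(1)] by simp
  define \<phi> where "\<phi> c = mat_conj (diag2 c (\<tau> c)) g" for c
  have one: "\<phi> 1 = mat 1"
  proof -
    have "diag2 1 (\<tau> 1) = (mat 1 :: 'k^2^2)" using \<tau>(2) by (simp add: mat2_eq_iff)
    then show ?thesis by (simp add: \<phi>_def mat_conj_mat[OF g])
  qed
  have diff: "\<phi> (a - b) = \<phi> a - \<phi> b" if "a \<in> F" "b \<in> F" for a b
  proof -
    have "diag2 (a - b) (\<tau> (a - b)) = diag2 a (\<tau> a) - diag2 b (\<tau> b)"
      using \<tau>_diff[OF that] by (simp add: mat2_eq_iff)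
    then show ?thesis by (simp add: \<phi>_def mat_conj_diff)
  qed
  have mult: "\<phi> (a * b) = \<phi> a ** \<phi> b" if "a \<in> F" "b \<in> F" for a b
  proof -
    have "diag2 (a * b) (\<tau> (a * b)) = diag2 a (\<tau> a) ** diag2 b (\<tau> b)"
      using \<tau>_mult[OF that] by (simp add: mat2_eq_iff)
    then show ?thesis by (simp add: \<phi>_def mat_conj_mult[OF g])
  qed
  note D = field_image_division_ring[OF F(1) one diff mult]
  show ?thesis
  proof (rule matrix_division_ring_pls[OF D(1)])
    have "\<phi> c \<in> mats_over Fq" if "c \<in> F" for c
      unfolding \<phi>_def using that F(2) \<tau>F[OF that] subfield_0[OF Fq]
      by (intro mat_conj_over[OF Fq F(6)]) (auto simp: mats_over_iff)
    then show "\<phi> ` F \<subseteq> insert 0 \<Gamma>" by (intro matrices_over_Fq_\<Gamma>[OF D(1)]) auto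
    have "c1 \<noteq> 0" "c1 \<noteq> 1" using F(5) \<tau>(2) \<tau>0 by auto
    moreover have "card {c1, 0, 1} \<le> card F"
      by (rule card_mono) (use F(1,4) in \<open>auto simp: subfield_0 subfield_1\<close>)
    ultimately have "card F > 2" by simp
    then show "card (\<phi> ` F) > 2" using D(2) by simp
    show "L = {x v* M |M. M \<in> \<phi> ` F}" unfolding L \<phi>_def by blast
  qed
qed

lemma line_iii_pls:
  assumes "line_iii q x L"
  shows "G_affine (affine_G q) (line_orbit (affine_G q) L) \<and>
    proper_pls UNIV (line_orbit (affine_G q) L) \<and> collinear_pts (line_orbit (affine_G q) L) 0 x"
proof -
  obtain F :: "'k alg_closure set" and E b1 b2 g where F: "finite F" "is_subfield F"
    "E = F \<inter> to_ac ` Fq" "quadratic_extension E F" "is_basis2 E F b1 b2" "g \<in> GL2_over Fq"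
    and L: "L = {x v* mat_conj (mat_of_ac (endo_matrix E b1 b2 (\<lambda>v. c * v))) g | c. c \<in> F}"
    using assms by (auto simp: line_iii_def simp del: vec2_mult)
  have E: "is_subfield E" using F(4) by (simp add: quadratic_extension_def)
  have g: "det2 g \<noteq> 0" using F(6) by (simp add: GL2_over_iff[OF Fq])
  define em where "em c = endo_matrix E b1 b2 (\<lambda>v. c * v)" for c
  have em_over: "em c \<in> mats_over (to_ac ` Fq)" if "c \<in> F" for c
  proof -
    have "em c \<in> mats_over E" using endo_matrix_exists[OF E F(5,2) that] unfolding em_def by metis
    then show ?thesis by (auto simp: F(3) mats_over_def)
  qed
  note entries = to_ac_mat_of_ac(1)[OF em_over]
  define \<phi> where "\<phi> c = mat_conj (mat_of_ac (em c)) g" for c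
  have one: "\<phi> 1 = mat 1"
  proof -
    have "mat_of_ac (em 1) = (mat 1 :: 'k^2^2)"
      unfolding em_def endo_matrix_one[OF E F(5)] by (rule mat_of_ac_eqI) simp
    then show ?thesis by (simp add: \<phi>_def mat_conj_mat[OF g])
  qed
  have diff: "\<phi> (a - b) = \<phi> a - \<phi> b" if ab: "a \<in> F" "b \<in> F" for a b
  proof -
    have "em (a - b) = em a - em b"
      unfolding em_def by (rule endo_matrix_hom(1)[OF E F(5,2) ab])
    then have "mat_of_ac (em (a - b)) = mat_of_ac (em a) - mat_of_ac (em b)"
      by (intro mat_of_ac_eqI) (simp add: entries ab)
    then show ?thesis by (simp add: \<phi>_def mat_conj_diff)
  qed
  have mult: "\<phi> (a * b) = \<phi> a ** \<phi> b" if ab: "a \<in> F" "b \<in> F" for a b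
  proof -
    have "em (a * b) = em a ** em b"
      unfolding em_def by (rule endo_matrix_hom(2)[OF E F(5,2) ab])
    then have "mat_of_ac (em (a * b)) = mat_of_ac (em a) ** mat_of_ac (em b)"
      by (intro mat_of_ac_eqI) (simp add: entries ab)
    then show ?thesis by (simp add: \<phi>_def mat_conj_mult[OF g])
  qed
  note D = field_image_division_ring[OF F(2) one diff mult]
  show ?thesis
  proof (rule matrix_division_ring_pls[OF D(1)])
    have "\<phi> c \<in> mats_over Fq" if "c \<in> F" for c
      unfolding \<phi>_def using to_ac_mat_of_ac(2)[OF em_over[OF that]] by (intro mat_conj_over[OF Fq F(6)])
    then show "\<phi> ` F \<subseteq> insert 0 \<Gamma>" by (intro matrices_over_Fq_\<Gamma>[OF D(1)]) auto
    show "card (\<phi> ` F) > 2" using D(2) basis2_card[OF E F(5,1)] by simp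
    show "L = {x v* M |M. M \<in> \<phi> ` F}" unfolding L \<phi>_def em_def by blast
  qed
qed

subsection \<open>Matrices with an eigenvalue in \<open>\<F>\<^sub>q\<close>\<close>

lemma mpow_scalar_plus_nilpotent:
  fixes M :: "'k^2^2"
  assumes "M ** M = 0"
  shows "mpow (mat r + M) (Suc n) = mat (r ^ Suc n) + mat (of_nat (Suc n) * r ^ n) ** M"
proof (induction n)
  case (Suc n)
  have "mpow (mat r + M) (Suc (Suc n)) = (mat r + M) ** mpow (mat r + M) (Suc n)" by simp
  also have "\<dots> = mat (r ^ Suc (Suc n)) + mat (of_nat (Suc (Suc n)) * r ^ Suc n) ** M
      + mat (of_nat (Suc n) * r ^ n) ** (M ** M)"
    unfolding Suc by (simp add: mat2_eq_iff algebra_simps)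
  finally show ?case using assms by simp
qed simp

text \<open>In characteristic \<open>p\<close> a division ring contains no scalar plus a nonzero nilpotent matrix, since
  the power with exponent \<open>q\<^sup>3\<close> removes the nilpotent part and keeps the scalar.\<close>

lemma no_double_eigenvalue:
  fixes D :: "('k^2^2) set"
  assumes D: "matrix_division_ring D" and d: "d \<in> D"
    and sq: "(d - mat r) ** (d - mat r) = 0"
  shows "d = mat r"
proof -
  note c = matrix_division_ring_closed[OF D]
  obtain n where n: "q ^ 3 = Suc n" using q_gt_1 by (cases "q ^ 3") auto
  have "mpow d (q ^ 3) = mat (r ^ (q ^ 3)) + mat (of_nat (q ^ 3) * r ^ n) ** (d - mat r)"
    using mpow_scalar_plus_nilpotent[OF sq, of r n] unfolding n by simp
  also have "\<dots> = mat r" by (simp only: power_q3 of_nat_q3) simp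
  finally have "mpow d (q ^ 3) = mat r" .
  moreover have "mpow d (q ^ 3) \<in> D" by (rule mpow_in) (use c d in auto)
  ultimately have "d - mat r \<in> D" using c(3) d by simp
  then show ?thesis using c(8) sq by fastforce
qed

text \<open>Let \<open>s\<close> be the other eigenvalue of \<open>d\<close>.  It differs from \<open>r\<close>, so \<open>d\<close>, and with it \<open>D\<close>, becomes
  diagonal in a basis of eigenvectors over \<open>\<F>\<^sub>q\<close>.  The set \<open>P\<close> of pairs of diagonal entries is a
  subring in which a pair with one zero entry is zero, hence the graph of an isomorphism between two
  subfields of \<open>\<F>\<^sub>q\<close>; these have the same size and therefore coincide.\<close>

lemma eigenvalue_line_ii:
  assumes D: "matrix_division_ring D" "D \<subseteq> mats_over Fq" and d: "d \<in> D" "\<nexists>c. d = mat c"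
    and r: "r \<in> Fq" "r * r - tr2 d * r + det2 d = 0" and L: "L = {x v* M | M. M \<in> D}"
  shows "line_ii q x L"
proof -
  note c = matrix_division_ring_closed[OF D(1)]
  have dF: "d \<in> mats_over Fq" using D d by blast
  define s where "s = tr2 d - r"
  have s: "s \<in> Fq" unfolding s_def using dF r(1) Fq
    by (auto simp: mats_over_iff intro!: subfield_diff subfield_add)
  have "tr2 d = r + s" "det2 d = r * s" using r(2) by (simp_all add: s_def algebra_simps)
  then have ch: "d ** d = mat (r + s) ** d - mat (r * s)" using cayley_hamilton2[of d] by metis
  have rs: "(d - mat s) ** (d - mat r) = 0" "(d - mat r) ** (d - mat s) = 0"
  proof -
    have "(d - mat s) ** (d - mat r) = d ** d - (mat (r + s) ** d - mat (r * s))"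
      "(d - mat r) ** (d - mat s) = d ** d - (mat (r + s) ** d - mat (r * s))"
      by (simp_all add: mat2_eq_iff algebra_simps)
    then show "(d - mat s) ** (d - mat r) = 0" "(d - mat r) ** (d - mat s) = 0" using ch by simp_all
  qed
  have neq: "r \<noteq> s" using no_double_eigenvalue[OF D(1) d(1), of r] rs d(2) by blast
  have row: "\<exists>u. u \<noteq> 0 \<and> u v* d = b *s u \<and> u$1 \<in> Fq \<and> u$2 \<in> Fq"
    if ab: "a \<in> Fq" "(d - mat a) ** (d - mat b) = 0" for a b
  proof -
    have "d - mat a \<noteq> 0" using d(2) by auto
    then obtain i where i: "(d - mat a)$i \<noteq> 0" by (auto simp: vec_eq_iff)
    have "(d - mat a)$i v* (d - mat b) = 0"
      using arg_cong[OF ab(2), of "\<lambda>M. M$i"]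
      by (simp add: vec2_eq_iff vec_eq_iff[of "_ ** _"] del: vector_minus_component)
    then have "(d - mat a)$i v* d = b *s (d - mat a)$i"
      by (simp add: vector_matrix_mult_diff_rdistrib vec_mult_mat del: vec2_mult vector_minus_component)
    moreover have "d - mat a \<in> mats_over Fq" using dF ab(1) Fq by (intro mats_over_diff mats_over_mat)
    then have "(d - mat a)$i$1 \<in> Fq" "(d - mat a)$i$2 \<in> Fq" unfolding mats_over_def by blast+
    ultimately show ?thesis using i by blast
  qed
  obtain u where u: "u \<noteq> 0" "u v* d = r *s u" "u$1 \<in> Fq" "u$2 \<in> Fq" using row[OF s rs(1)] by blast
  obtain v where v: "v \<noteq> 0" "v v* d = s *s v" "v$1 \<in> Fq" "v$2 \<in> Fq" using row[OF r(1) rs(2)] by blast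
  define g :: "'k^2^2" where "g = vector [u, v]"
  have g_nth: "g$1 = u" "g$2 = v" by (simp_all add: g_def)
  have gdet: "det2 g \<noteq> 0"
  proof
    assume "det2 g = 0"
    then have par: "u$1 * v$2 = u$2 * v$1" by (simp add: g_nth)
    have uv: "u$i *s v = v$i *s u" for i
      using par exhaust_2[of i] by (auto simp: vec2_eq_iff mult.commute)
    have "u$i = 0" for i
    proof -
      have "s *s (u$i *s v) = (u$i *s v) v* d"
        unfolding scalar_vector_matrix_assoc v(2) by (simp add: vec2_eq_iff)
      also have "\<dots> = r *s (u$i *s v)"
        unfolding uv scalar_vector_matrix_assoc u(2) by (simp add: vec2_eq_iff)
      finally have "u$i *s v = 0" using neq by (simp add: vector_mul_rcancel)
      then show ?thesis using v(1) by simp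
    qed
    then show False using u(1) by (simp add: vec2_eq_iff)
  qed
  have g: "g \<in> GL2_over Fq" using u v gdet by (simp add: GL2_over_iff[OF Fq] mats_over_iff g_nth)
  have conj_d: "mat_conj (diag2 r s) g = d"
  proof (rule mat_conj_eqI[OF gdet])
    have "(g ** d)$i = g$i v* d" for i by (simp add: vec2_eq_iff)
    then have "(g ** d)$1 = r *s u" "(g ** d)$2 = s *s v" using u(2) v(2) g_nth by metis+
    then show "g ** d = diag2 r s ** g"
      by (simp add: vec_eq_iff[of "_ ** _"] forall_2 vec2_eq_iff g_nth del: mat2_mult) (simp add: g_nth)
  qed
  define \<delta> where "\<delta> a b = mat_conj (diag2 a b) g" for a b
  have \<delta>_diff: "\<delta> a b - \<delta> a' b' = \<delta> (a - a') (b - b')" for a b a' b'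
    unfolding \<delta>_def mat_conj_diff[symmetric] by (rule arg_cong[of _ _ "\<lambda>A. mat_conj A g"]) (simp add: mat2_eq_iff)
  have \<delta>_mult: "\<delta> a b ** \<delta> a' b' = \<delta> (a * a') (b * b')" for a b a' b'
    unfolding \<delta>_def mat_conj_mult[OF gdet, symmetric] by (rule arg_cong[of _ _ "\<lambda>A. mat_conj A g"]) (simp add: mat2_eq_iff)
  have \<delta>_mat: "\<delta> a a = mat a" for a
  proof -
    have "diag2 a a = (mat a :: 'k^2^2)" by (simp add: mat2_eq_iff)
    then show ?thesis by (simp add: \<delta>_def mat_conj_mat[OF gdet])
  qed
  have \<delta>_det: "det2 (\<delta> a b) = a * b" for a b
  proof -
    have "g ** \<delta> a b = diag2 a b ** g"
      unfolding \<delta>_def mat_conj_def matrix_mul_assoc using matrix_inv2[OF gdet] by simp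
    then have "det2 g * det2 (\<delta> a b) = det2 (diag2 a b) * det2 g" unfolding det2_mult[symmetric] by simp
    then show ?thesis using gdet by simp
  qed
  define P where "P = {(a, b). a \<in> Fq \<and> b \<in> Fq \<and> \<delta> a b \<in> D}"
  have finP: "finite P" by simp
  have D_eq: "D = (\<lambda>(a, b). \<delta> a b) ` P"
  proof
    show "D \<subseteq> (\<lambda>(a, b). \<delta> a b) ` P"
    proof
      fix M assume M: "M \<in> D"
      have "M ** d = d ** M"
        using finite_matrix_division_ring_commutative[OF D(1) _ d(1) M] by simp
      then obtain a b where ab: "a \<in> Fq" "b \<in> Fq" "M = mat a + mat b ** d"
        using commuting_matrix_span[OF Fq dF d(2), of M] D(2) M by blast
      have "M = \<delta> (a + b * r) (a + b * s)"
      proof -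
        have "M = \<delta> (b * r) (b * s) - \<delta> (- a) (- a)"
          unfolding ab(3) \<delta>_mat \<delta>_mult[of b b r s, symmetric] \<delta>_def[of r s] conj_d by (simp add: mat2_eq_iff)
        then show ?thesis unfolding \<delta>_diff by (simp add: add.commute)
      qed
      moreover have "a + b * r \<in> Fq" "a + b * s \<in> Fq" using ab r s Fq by (auto intro: subfield_add subfield_mult)
      ultimately show "M \<in> (\<lambda>(a, b). \<delta> a b) ` P" using M by (force simp: P_def)
    qed
  qed (auto simp: P_def)
  have P_diff: "(a - a', b - b') \<in> P" if "(a, b) \<in> P" "(a', b') \<in> P" for a b a' b'
    using that c(3) Fq unfolding P_def by (auto simp: \<delta>_diff[symmetric] intro: subfield_diff)
  have P_mult: "(a * a', b * b') \<in> P" if "(a, b) \<in> P" "(a', b') \<in> P" for a b a' b'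
    using that c(4) Fq unfolding P_def by (auto simp: \<delta>_mult[symmetric] intro: subfield_mult)
  have P_one: "(1, 1) \<in> P" using c(1) subfield_1[OF Fq] by (simp add: P_def \<delta>_mat)
  have P_zero: "a = 0 \<longleftrightarrow> b = 0" if "(a, b) \<in> P" for a b
  proof (cases "\<delta> a b = 0")
    case True
    have "diag2 a b ** g = g ** \<delta> a b"
      unfolding \<delta>_def mat_conj_def matrix_mul_assoc using matrix_inv2[OF gdet] by simp
    also have "\<dots> = 0 ** g" using True by simp
    finally have "diag2 a b = (0 :: 'k^2^2)" by (rule matrix_cancel_right[OF gdet])
    then show ?thesis by (simp add: mat2_eq_iff)
  next
    case False
    then have "a * b \<noteq> 0" using c(5) that \<delta>_det by (metis (no_types, lifting) P_def case_prodD mem_Collect_eq)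
    then show ?thesis by simp
  qed
  have inj1: "inj_on fst P"
  proof (rule inj_onI, clarify)
    fix a b a' b' assume "(a, b) \<in> P" "(a', b') \<in> P" "fst (a, b) = fst (a', b')"
    then show "a = a' \<and> b = b'" using P_zero[OF P_diff[of a b a' b']] by simp
  qed
  have inj2: "inj_on snd P"
  proof (rule inj_onI, clarify)
    fix a b a' b' assume "(a, b) \<in> P" "(a', b') \<in> P" "snd (a, b) = snd (a', b')"
    then show "a = a' \<and> b = b'" using P_zero[OF P_diff[of a b a' b']] by simp
  qed
  have F1: "is_subfield (fst ` P)"
  proof (rule finite_subfieldI)
    show "1 \<in> fst ` P" using P_one by (rule rev_image_eqI) simp
    fix a b assume "a \<in> fst ` P" "b \<in> fst ` P"
    then obtain a' b' where P: "(a, a') \<in> P" "(b, b') \<in> P" by auto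
    show "a - b \<in> fst ` P" using P_diff[OF P] by (rule rev_image_eqI) simp
    show "a * b \<in> fst ` P" using P_mult[OF P] by (rule rev_image_eqI) simp
  qed simp
  have F2: "is_subfield (snd ` P)"
  proof (rule finite_subfieldI)
    show "1 \<in> snd ` P" using P_one by (rule rev_image_eqI) simp
    fix a b assume "a \<in> snd ` P" "b \<in> snd ` P"
    then obtain a' b' where P: "(a', a) \<in> P" "(b', b) \<in> P" by auto
    show "a - b \<in> snd ` P" using P_diff[OF P] by (rule rev_image_eqI) simp
    show "a * b \<in> snd ` P" using P_mult[OF P] by (rule rev_image_eqI) simp
  qed simp
  have "fst ` P = {c. c ^ card (fst ` P) = c}" "snd ` P = {c. c ^ card (snd ` P) = c}"
    using finite_subfield_eq_fixed[OF F1] finite_subfield_eq_fixed[OF F2] by simp_all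
  then have same: "snd ` P = fst ` P"
    using card_image[OF inj1] card_image[OF inj2] by metis
  define \<tau> where "\<tau> = snd \<circ> inv_into P fst"
  have \<tau>: "\<tau> a = b" if "(a, b) \<in> P" for a b
    using inv_into_f_f[OF inj1 that] by (simp add: \<tau>_def)
  have \<tau>P: "(a, \<tau> a) \<in> P" if aP: "a \<in> fst ` P" for a
  proof -
    obtain b where "(a, b) \<in> P" using aP by auto
    then show ?thesis using \<tau> by simp
  qed
  have "bij_betw (inv_into P fst) (fst ` P) P" by (rule bij_betw_inv_into[OF inj_on_imp_bij_betw[OF inj1]])
  then have "bij_betw \<tau> (fst ` P) (fst ` P)"
    unfolding \<tau>_def by (rule bij_betw_trans) (use inj2 same in \<open>simp add: bij_betw_def\<close>)
  moreover have "\<tau> (a + b) = \<tau> a + \<tau> b" if "a \<in> fst ` P" "b \<in> fst ` P" for a b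
  proof (rule \<tau>)
    have "(0, 0) \<in> P" using P_diff[OF P_one P_one] by simp
    then have "(0 - b, 0 - \<tau> b) \<in> P" by (rule P_diff[OF _ \<tau>P[OF that(2)]])
    then show "(a + b, \<tau> a + \<tau> b) \<in> P" using P_diff[OF \<tau>P[OF that(1)], of "0 - b" "0 - \<tau> b"] by simp
  qed
  moreover have "\<tau> (a * b) = \<tau> a * \<tau> b" if "a \<in> fst ` P" "b \<in> fst ` P" for a b
    by (rule \<tau>[OF P_mult[OF \<tau>P \<tau>P]]) (use that in auto)
  ultimately have aut: "\<tau> \<in> field_Aut (fst ` P)" using \<tau>[OF P_one] by (simp add: field_Aut_iff)
  have rsP: "(r, s) \<in> P" using r(1) s d(1) conj_d by (simp add: P_def \<delta>_def)
  then have "r \<in> fst ` P" by (rule rev_image_eqI) simp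
  moreover have "\<tau> r \<noteq> r" using \<tau>[OF rsP] neq by simp
  moreover have "L = {x v* mat_conj (diag2 c (\<tau> c)) g | c. c \<in> fst ` P}"
  proof -
    have "D = {\<delta> c (\<tau> c) | c. c \<in> fst ` P}"
    proof
      show "D \<subseteq> {\<delta> c (\<tau> c) | c. c \<in> fst ` P}"
      proof
        fix M assume "M \<in> D"
        then obtain a b where ab: "(a, b) \<in> P" "M = \<delta> a b" unfolding D_eq by auto
        have "a \<in> fst ` P" using ab(1) by (rule rev_image_eqI) simp
        then show "M \<in> {\<delta> c (\<tau> c) | c. c \<in> fst ` P}" using ab \<tau> by blast
      qed
      show "{\<delta> c (\<tau> c) | c. c \<in> fst ` P} \<subseteq> D"
      proof
        fix M assume "M \<in> {\<delta> c (\<tau> c) | c. c \<in> fst ` P}"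
        then obtain c where "c \<in> fst ` P" "M = \<delta> c (\<tau> c)" by blast
        then have "(c, \<tau> c) \<in> P" "M = \<delta> c (\<tau> c)" using \<tau>P by blast+
        then show "M \<in> D" unfolding P_def by blast
      qed
    qed
    then show ?thesis unfolding L \<delta>_def by blast
  qed
  moreover have "fst ` P \<subseteq> Fq" by (auto simp: P_def)
  ultimately show ?thesis unfolding line_ii_def using F1 aut g by blast
qed

subsection \<open>Matrices without an eigenvalue in \<open>\<F>\<^sub>q\<close>\<close>

lemma Fq_eq_fixed_ac: "to_ac ` Fq = {c :: 'k alg_closure. c ^ q = c}"
proof (rule card_seteq)
  show "finite {c :: 'k alg_closure. c ^ q = c}" using power_fixed_bound[OF q_gt_1] by blast
  show "to_ac ` Fq \<subseteq> {c :: 'k alg_closure. c ^ q = c}" by (auto simp: Fq_iff simp flip: to_ac_power)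
  show "card {c :: 'k alg_closure. c ^ q = c} \<le> card (to_ac ` Fq :: 'k alg_closure set)"
    using power_fixed_bound(2)[OF q_gt_1] card_image[of to_ac Fq] inj_to_ac card_Fq
    by (simp add: inj_on_def)
qed

text \<open>The map \<open>a + bd \<mapsto> a + b\<alpha>\<close> embeds \<open>D\<close> into the algebraic closure, with image \<open>F\<close>.  The Frobenius map
  preserves \<open>F\<close> and sends \<open>a + b\<alpha>\<close> to \<open>a + b(t - \<alpha>)\<close>; taking differences shows that \<open>a\<close> and \<open>b\<close>
  themselves lie in \<open>F\<close>, so \<open>1, \<alpha>\<close> is a basis of \<open>F\<close> over \<open>F \<inter> \<F>\<^sub>q\<close>.  In this basis \<open>\<alpha>\<close> acts as the
  companion matrix \<open>C\<close> of \<open>d\<close>, and the rows \<open>(1, 0)\<close> and \<open>(1, 0)d\<close> form the matrix that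
  conjugates \<open>C\<close> to \<open>d\<close>.\<close>

lemma no_eigenvalue_line_iii:
  assumes D: "matrix_division_ring D" "D \<subseteq> mats_over Fq" and d: "d \<in> D" "\<nexists>c. d = mat c"
    and no_root: "\<And>r. r \<in> Fq \<Longrightarrow> r * r - tr2 d * r + det2 d \<noteq> 0" and L: "L = {x v* M | M. M \<in> D}"
  shows "line_iii q x L"
proof -
  note c = matrix_division_ring_closed[OF D(1)]
  have dF: "d \<in> mats_over Fq" using D d by blast
  define t where "t = tr2 d"
  define n where "n = det2 d"
  have t: "t \<in> Fq" and n: "n \<in> Fq" using dF Fq
    by (auto simp: t_def n_def mats_over_iff intro!: subfield_add subfield_diff subfield_mult)
  have dd: "d ** d = mat t ** d - mat n" using cayley_hamilton2[of d] by (simp add: t_def n_def)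
  define \<iota> where "\<iota> = (to_ac :: 'k \<Rightarrow> 'k alg_closure)"
  have \<iota>: "\<iota> 0 = 0" "\<iota> 1 = 1" "\<And>a b. \<iota> (a + b) = \<iota> a + \<iota> b" "\<And>a b. \<iota> (a - b) = \<iota> a - \<iota> b"
    "\<And>a b. \<iota> (a * b) = \<iota> a * \<iota> b" "\<And>a. \<iota> (- a) = - \<iota> a" "\<And>a b. \<iota> a = \<iota> b \<longleftrightarrow> a = b"
    by (simp_all add: \<iota>_def)
  have \<iota>Fq: "is_subfield (\<iota> ` Fq)" unfolding \<iota>_def by (rule is_subfield_to_ac[OF Fq])
  have \<iota>_power: "\<iota> a ^ q = \<iota> a" if "a \<in> Fq" for a
    using that Fq_eq_fixed_ac unfolding \<iota>_def by blast
  obtain \<alpha> where root: "\<alpha> * \<alpha> = \<iota> t * \<alpha> - \<iota> n"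
  proof -
    have "\<exists>\<alpha>. poly [:\<iota> n, - \<iota> t, 1:] \<alpha> = 0" by (rule alg_closed_imp_poly_has_root) simp
    then obtain \<alpha> where "poly [:\<iota> n, - \<iota> t, 1:] \<alpha> = 0" by blast
    then have "\<alpha> * \<alpha> = \<iota> t * \<alpha> - \<iota> n" by (simp add: algebra_simps add_eq_0_iff2)
    then show thesis by (rule that)
  qed
  have \<alpha>: "\<alpha> \<notin> \<iota> ` Fq"
  proof
    assume "\<alpha> \<in> \<iota> ` Fq"
    then obtain r where r: "r \<in> Fq" "\<alpha> = \<iota> r" by blast
    have "\<iota> (r * r) = \<iota> (t * r - n)" using root by (simp add: \<iota> r)
    then have "r * r = t * r - n" using \<iota>(7) by blast
    then have "r * r - t * r + n = 0" by simp
    then show False using no_root[OF r(1)] unfolding t_def n_def by blast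
  qed
  (* The conjugate of alpha is its image under the Frobenius map, so it lies in every subfield
     that contains alpha.  This puts trace and norm of alpha into E below. *)
  have conj: "\<alpha> ^ q = \<iota> t - \<alpha>"
  proof -
    have *: "\<alpha> ^ q * \<alpha> ^ q = \<iota> t * \<alpha> ^ q - \<iota> n"
    proof -
      have "(\<alpha> ^ q) * (\<alpha> ^ q) = (\<iota> t * \<alpha> - \<iota> n) ^ q" by (simp flip: power_mult_distrib root)
      also have "\<dots> = \<iota> t * \<alpha> ^ q - \<iota> n"
        by (simp add: frobenius_diff_ac power_mult_distrib \<iota>_power t n)
      finally show ?thesis .
    qed
    have "(\<alpha> ^ q - \<alpha>) * (\<alpha> ^ q + \<alpha> - \<iota> t) = (\<alpha> ^ q * \<alpha> ^ q - \<iota> t * \<alpha> ^ q) - (\<alpha> * \<alpha> - \<iota> t * \<alpha>)"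
      by (simp add: algebra_simps)
    also have "\<dots> = 0" unfolding root * by simp
    finally have "(\<alpha> ^ q - \<alpha>) * (\<alpha> ^ q + \<alpha> - \<iota> t) = 0" .
    moreover have "\<alpha> ^ q \<noteq> \<alpha>" using \<alpha> Fq_eq_fixed_ac unfolding \<iota>_def by blast
    ultimately show ?thesis by (simp add: eq_diff_eq)
  qed
  define Q where "Q = {(a, b). a \<in> Fq \<and> b \<in> Fq \<and> mat a + mat b ** d \<in> D}"
  define ev where "ev = (\<lambda>(a, b). \<iota> a + \<iota> b * \<alpha>)"
  define F where "F = ev ` Q"
  have finF: "finite F" by (simp add: F_def)
  have F: "is_subfield F"
  proof (rule finite_subfieldI[OF finF])
    have "(1, 0) \<in> Q" using c(1) Fq by (simp add: Q_def subfield_0 subfield_1)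
    then show "1 \<in> F" unfolding F_def ev_def by (rule rev_image_eqI) (simp add: \<iota>)
    fix y z assume "y \<in> F" "z \<in> F"
    then obtain a b a' b' where ab: "(a, b) \<in> Q" "(a', b') \<in> Q" "y = \<iota> a + \<iota> b * \<alpha>" "z = \<iota> a' + \<iota> b' * \<alpha>"
      unfolding F_def ev_def by auto
    then have Q: "a \<in> Fq" "b \<in> Fq" "a' \<in> Fq" "b' \<in> Fq" "mat a + mat b ** d \<in> D" "mat a' + mat b' ** d \<in> D"
      by (auto simp: Q_def)
    have "mat (a - a') + mat (b - b') ** d = (mat a + mat b ** d) - (mat a' + mat b' ** d)"
      by (simp add: mat2_eq_iff algebra_simps)
    then have "(a - a', b - b') \<in> Q" using Q c(3) Fq by (simp add: Q_def subfield_diff)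
    then show "y - z \<in> F" unfolding F_def ev_def
      by (rule rev_image_eqI) (simp add: \<iota> ab algebra_simps)
    have "(mat a + mat b ** d) ** (mat a' + mat b' ** d)
        = mat (a * a') + mat (a * b' + b * a') ** d + mat (b * b') ** (d ** d)"
      by (simp add: mat2_eq_iff algebra_simps)
    also have "\<dots> = mat (a * a' - b * b' * n) + mat (a * b' + b * a' + b * b' * t) ** d"
      unfolding dd by (simp add: mat2_eq_iff algebra_simps)
    finally have "mat (a * a' - b * b' * n) + mat (a * b' + b * a' + b * b' * t) ** d \<in> D"
      using c(4) Q by metis
    then have "(a * a' - b * b' * n, a * b' + b * a' + b * b' * t) \<in> Q"
      using Q Fq t n by (simp add: Q_def subfield_diff subfield_mult subfield_add)
    moreover have "y * z = \<iota> (a * a' - b * b' * n) + \<iota> (a * b' + b * a' + b * b' * t) * \<alpha>"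
    proof -
      have "y * z = \<iota> (a * a') + \<iota> (a * b' + b * a') * \<alpha> + \<iota> (b * b') * (\<alpha> * \<alpha>)"
        by (simp add: ab \<iota> algebra_simps)
      then show ?thesis unfolding root by (simp add: \<iota> algebra_simps)
    qed
    ultimately show "y * z \<in> F" unfolding F_def ev_def by (intro rev_image_eqI) auto
  qed
  have \<alpha>F: "\<alpha> \<in> F"
  proof -
    have "(0, 1) \<in> Q" using d(1) Fq by (simp add: Q_def subfield_0 subfield_1)
    then show ?thesis unfolding F_def ev_def by (rule rev_image_eqI) (simp add: \<iota>)
  qed
  define E where "E = F \<inter> \<iota> ` Fq"
  have E: "is_subfield E" unfolding E_def using F \<iota>Fq by (rule is_subfield_Int)
  have tE: "\<iota> t \<in> E"
  proof -
    have "\<iota> t = \<alpha> ^ q + \<alpha>" by (simp add: conj)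
    also have "\<dots> \<in> F" using F \<alpha>F by (intro subfield_add subfield_power)
    finally show ?thesis using t by (simp add: E_def)
  qed
  have nE: "\<iota> n \<in> E"
  proof -
    have "\<iota> n = \<iota> t * \<alpha> - \<alpha> * \<alpha>" by (simp add: root)
    also have "\<dots> \<in> F" using F \<alpha>F tE by (intro subfield_diff subfield_mult) (auto simp: E_def)
    finally show ?thesis using n by (simp add: E_def)
  qed
  have coeffs: "\<iota> a \<in> E" "\<iota> b \<in> E" if "a \<in> Fq" "b \<in> Fq" "\<iota> a + \<iota> b * \<alpha> \<in> F" for a b
  proof -
    have "(\<iota> a + \<iota> b * \<alpha>) ^ q = \<iota> a + \<iota> b * \<alpha> ^ q"
      using that by (simp add: frobenius_add_ac power_mult_distrib \<iota>_power)
    then have "\<iota> b * (\<alpha> - \<alpha> ^ q) = (\<iota> a + \<iota> b * \<alpha>) - (\<iota> a + \<iota> b * \<alpha>) ^ q"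
      by (simp add: algebra_simps)
    also have "\<dots> \<in> F" using F that by (intro subfield_diff subfield_power)
    finally have *: "\<iota> b * (\<alpha> - \<alpha> ^ q) \<in> F" .
    have "\<alpha> - \<alpha> ^ q \<noteq> 0" using \<alpha> Fq_eq_fixed_ac unfolding \<iota>_def by (metis (mono_tags) mem_Collect_eq right_minus_eq)
    moreover have "\<iota> b * (\<alpha> - \<alpha> ^ q) / (\<alpha> - \<alpha> ^ q) \<in> F"
      using F \<alpha>F * by (intro subfield_divide subfield_diff subfield_power)
    ultimately have bF: "\<iota> b \<in> F" by simp
    have "(\<iota> a + \<iota> b * \<alpha>) - \<iota> b * \<alpha> \<in> F" using F bF \<alpha>F that(3) by (intro subfield_diff subfield_mult)
    then show "\<iota> a \<in> E" "\<iota> b \<in> E" using bF that by (simp_all add: E_def)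
  qed
  have basis: "is_basis2 E F 1 \<alpha>"
    unfolding is_basis2_iff
  proof (intro conjI ballI)
    show "\<alpha> \<noteq> 0" using \<alpha> subfield_0[OF \<iota>Fq] by metis
    show "1 \<noteq> k * \<alpha>" if k: "k \<in> E" for k
    proof
      assume "1 = k * \<alpha>"
      then have "\<alpha> = inverse k" by (metis inverse_unique)
      then show False using \<alpha> subfield_inverse[OF \<iota>Fq] k by (simp add: E_def)
    qed
    show "F = {k1 * 1 + k2 * \<alpha> |k1 k2. k1 \<in> E \<and> k2 \<in> E}"
    proof
      show "{k1 * 1 + k2 * \<alpha> |k1 k2. k1 \<in> E \<and> k2 \<in> E} \<subseteq> F"
        using F \<alpha>F by (auto simp: E_def intro!: subfield_add subfield_mult)
      show "F \<subseteq> {k1 * 1 + k2 * \<alpha> |k1 k2. k1 \<in> E \<and> k2 \<in> E}"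
      proof
        fix y assume y: "y \<in> F"
        then obtain a b where ab: "a \<in> Fq" "b \<in> Fq" "y = \<iota> a + \<iota> b * \<alpha>"
          by (auto simp: F_def ev_def Q_def)
        then show "y \<in> {k1 * 1 + k2 * \<alpha> |k1 k2. k1 \<in> E \<and> k2 \<in> E}"
          using coeffs[OF ab(1,2)] y by (intro CollectI exI[of _ "\<iota> a"] exI[of _ "\<iota> b"]) simp
      qed
    qed
  qed
  define C :: "'k^2^2" where "C = vector [vector [0, 1], vector [- n, t]]"
  define g :: "'k^2^2" where "g = vector [vector [1, 0], vector [d$1$1, d$1$2]]"
  have "d$1$2 \<noteq> 0"
  proof
    assume "d$1$2 = 0"
    then have "d$1$1 * d$1$1 - tr2 d * d$1$1 + det2 d = 0" by (simp add: algebra_simps)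
    then show False using no_root[of "d$1$1"] dF by (simp add: mats_over_iff)
  qed
  then have gdet: "det2 g \<noteq> 0" by (simp add: g_def)
  have g: "g \<in> GL2_over Fq"
    using gdet dF Fq by (simp add: GL2_over_iff[OF Fq] mats_over_iff g_def subfield_0 subfield_1)
  have "g ** d = C ** g"
    by (simp add: mat2_eq_iff g_def C_def t_def n_def algebra_simps)
  then have conj_d: "mat_conj C g = d" by (rule mat_conj_eqI[OF gdet])
  have line: "mat_conj (mat_of_ac (endo_matrix E 1 \<alpha> (\<lambda>v. (\<iota> a + \<iota> b * \<alpha>) * v))) g = mat a + mat b ** d"
    if ab: "a \<in> Fq" "b \<in> Fq" "\<iota> a + \<iota> b * \<alpha> \<in> F" for a b
  proof -
    define M :: "'k alg_closure^2^2" where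
      "M = vector [vector [\<iota> a, \<iota> b], vector [- \<iota> b * \<iota> n, \<iota> a + \<iota> b * \<iota> t]]"
    have "endo_matrix E 1 \<alpha> (\<lambda>v. (\<iota> a + \<iota> b * \<alpha>) * v) = M"
    proof (rule endo_matrix_eqI[OF E basis])
      show "M \<in> mats_over E"
        using coeffs[OF ab] tE nE E
        by (simp add: M_def mats_over_iff subfield_add subfield_mult subfield_uminus)
      show "(\<iota> a + \<iota> b * \<alpha>) * 1 = M$1$1 * 1 + M$1$2 * \<alpha>" by (simp add: M_def)
      have "(\<iota> a + \<iota> b * \<alpha>) * \<alpha> = \<iota> a * \<alpha> + \<iota> b * (\<alpha> * \<alpha>)" by (simp add: algebra_simps)
      then show "(\<iota> a + \<iota> b * \<alpha>) * \<alpha> = M$2$1 * 1 + M$2$2 * \<alpha>"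
        unfolding root by (simp add: M_def algebra_simps)
    qed
    moreover have "mat_of_ac M = mat a + mat b ** C"
    proof (rule mat_of_ac_eqI)
      show "to_ac ((mat a + mat b ** C)$i$j) = M$i$j" for i j
        using exhaust_2[of i] exhaust_2[of j] by (auto simp: M_def C_def \<iota>_def)
    qed
    ultimately show ?thesis
      by (simp add: mat_conj_add mat_conj_mult[OF gdet] mat_conj_mat[OF gdet] conj_d)
  qed
  have "L = {x v* mat_conj (mat_of_ac (endo_matrix E 1 \<alpha> (\<lambda>v. c * v))) g | c. c \<in> F}"
  proof
    show "L \<subseteq> {x v* mat_conj (mat_of_ac (endo_matrix E 1 \<alpha> (\<lambda>v. c * v))) g | c. c \<in> F}"
    proof
      fix w assume "w \<in> L"
      then obtain M where M: "M \<in> D" "w = x v* M" unfolding L by blast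
      have "M ** d = d ** M"
        using finite_matrix_division_ring_commutative[OF D(1) _ d(1) M(1)] by simp
      then obtain a b where ab: "a \<in> Fq" "b \<in> Fq" "M = mat a + mat b ** d"
        using commuting_matrix_span[OF Fq dF d(2), of M] D(2) M by blast
      have "(a, b) \<in> Q" using ab M by (simp add: Q_def)
      then have cF: "\<iota> a + \<iota> b * \<alpha> \<in> F" unfolding F_def ev_def by (rule rev_image_eqI) simp
      show "w \<in> {x v* mat_conj (mat_of_ac (endo_matrix E 1 \<alpha> (\<lambda>v. c * v))) g | c. c \<in> F}"
        using line[OF ab(1,2) cF] cF M(2) ab(3) by (metis (mono_tags, lifting) mem_Collect_eq)
    qed
    show "{x v* mat_conj (mat_of_ac (endo_matrix E 1 \<alpha> (\<lambda>v. c * v))) g | c. c \<in> F} \<subseteq> L"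
    proof clarify
      fix c assume cF: "c \<in> F"
      then obtain a b where ab: "a \<in> Fq" "b \<in> Fq" "mat a + mat b ** d \<in> D" "c = \<iota> a + \<iota> b * \<alpha>"
        by (auto simp: F_def ev_def Q_def)
      show "x v* mat_conj (mat_of_ac (endo_matrix E 1 \<alpha> (\<lambda>v. c * v))) g \<in> L"
        using line[OF ab(1,2) cF[unfolded ab(4)]] ab(3) unfolding ab(4) L by (intro CollectI exI conjI) (rule arg_cong, assumption)
    qed
  qed
  moreover have "quadratic_extension E F"
    unfolding quadratic_extension_def using E F is_basis2_dimension[OF basis] by (auto simp: E_def)
  ultimately have "finite F \<and> is_subfield F \<and> E = F \<inter> to_ac ` Fq \<and> quadratic_extension E F \<and>
      is_basis2 E F 1 \<alpha> \<and> g \<in> GL2_over Fq \<and>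
      L = {x v* mat_conj (mat_of_ac (endo_matrix E 1 \<alpha> (\<lambda>v. c * v))) g | c. c \<in> F}"
    using finF F basis g E_def[unfolded \<iota>_def] by simp
  then show ?thesis unfolding line_iii_def by (intro exI)
qed

proposition homogeneous_line_families:
  assumes "homogeneous_line L"
  shows "line_i x L \<or> line_ii q x L \<or> line_iii q x L"
  using assms
proof (cases rule: homogeneous_line_cases)
  case (1 F)
  then show ?thesis unfolding line_i_def by blast
next
  case (2 D d)
  show ?thesis
  proof (cases "\<exists>r\<in>Fq. r * r - tr2 d * r + det2 d = 0")
    case True
    then show ?thesis using eigenvalue_line_ii[OF 2(1-4) _ _ 2(5)] by blast
  next
    case False
    then show ?thesis using no_eigenvalue_line_iii[OF 2(1-4) _ 2(5)] by blast
  qed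
qed

end

theorem proposition12p2:
  fixes q :: nat
    and \<zeta> :: "'k::{field,finite}"
    and x :: "'k^2"
    and \<L> :: "('k^2) set set"
  assumes "primepow q"
    and "CARD('k) = q ^ 3"
    and "range (\<lambda>n::int. \<zeta> powi n) = UNIV - {0}"
    and "x = vector [1, \<zeta>]"
  shows "G_affine (affine_G q) \<L> \<and> proper_pls UNIV \<L> \<and> collinear_pts \<L> 0 x \<longleftrightarrow>
         (\<exists>L. \<L> = line_orbit (affine_G q) L \<and>
              (line_i x L \<or> line_ii q x L \<or> line_iii q x L))"
proof -
  interpret cubic_extension q \<zeta> by unfold_locales (fact assms)+
  show ?thesis unfolding assms(4)
  proof
    assume "G_affine (affine_G q) \<L> \<and> proper_pls UNIV \<L> \<and> collinear_pts \<L> 0 (vector [1, \<zeta>])"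
    then obtain L where "homogeneous_line L" "\<L> = line_orbit (affine_G q) L"
      using proper_pls_homogeneous_line by blast
    then show "\<exists>L. \<L> = line_orbit (affine_G q) L \<and>
        (line_i (vector [1, \<zeta>]) L \<or> line_ii q (vector [1, \<zeta>]) L \<or> line_iii q (vector [1, \<zeta>]) L)"
      using homogeneous_line_families by blast
  next
    assume "\<exists>L. \<L> = line_orbit (affine_G q) L \<and>
        (line_i (vector [1, \<zeta>]) L \<or> line_ii q (vector [1, \<zeta>]) L \<or> line_iii q (vector [1, \<zeta>]) L)"
    then show "G_affine (affine_G q) \<L> \<and> proper_pls UNIV \<L> \<and> collinear_pts \<L> 0 (vector [1, \<zeta>])"
      using line_i_pls line_ii_pls line_iii_pls by blast
  qed
qed

end
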